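(* For any $Q\in\mathcal Q_n$ and any $n\ge1$, $$\mathbf L_{1,n}(Q)\le 2\,\sigma_Q\,(4a^2+15|a|+2).$$
   Context: Let $d\xi_t=a\xi_t\,dt+du_t$, $\xi_0=0$, $u_t=\varrho_1w_t+\varrho_2z_t$, $z_t=\int_0^t\int_{\mathbb R}x\,(\mu-\widetilde\mu)(ds\,dx)$, where $w$ is a standard Brownian motion, $\mu$ is the jump measure (independent of $w$) with deterministic compensator $\widetilde\mu(ds\,dx)=ds\,\Pi(dx)$, and $\Pi$ is a Lévy measure on $\mathbb R\setminus\{0\}$ with $\int x^2\,\Pi(dx)=1$, $\int x^8\,\Pi(dx)<\infty$. $\mathcal Q_n$ is the family of distributions $Q$ of $(\xi_t)_{0\le t\le n}$ on the Skorokhod space $D[0,n]$ with parameters satisfying $-a_{\max}\le a\le0$, $0<\underline\varrho\le\varrho_1^2$, $\sigma_Q=\varrho_1^2+\varrho_2^2\le\varsigma^*$, where $a_{\max}(n)$, $\underline\varrho_n$, $\varsigma^*_n$ satisfy for any $\epsilon>0$: $a_{\max}(n)/n^\epsilon\to0$, $\liminf_n n^\epsilon\underline\varrho_n>0$, $n^{-\epsilon}\varsigma^*_n\to0$. The trigonometric basis is $\mathrm{Tr}_1\equiv1$ and, for $j\ge2$, $\mathrm{Tr}_j(x)=\sqrt2\cos(2\pi[j/2]x)$ for even $j$, $\mathrm{Tr}_j(x)=\sqrt2\sin(2\pi[j/2]x)$ for odd $j$ ($[\cdot]$ is the integer part). Put $\xi_{j,n}=n^{-1/2}\int_0^n\mathrm{Tr}_j(t)\,d\xi_t$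 and $\mathbf L_{1,n}(Q)=\sum_{j=1}^n\left|E_Q\xi_{j,n}^2-\sigma_Q\right|$. *)

theory Defs
  imports "HOL-Probability.Probability"
begin

section \<open>Driving noise\<close>

definition cadlag_on :: "real set \<Rightarrow> (real \<Rightarrow> real) \<Rightarrow> bool" where
  "cadlag_on T x \<longleftrightarrow>
     (\<forall>t\<in>T. continuous (at t within (T \<inter> {t..})) x \<and>
            (\<exists>l. (x \<longlongrightarrow> l) (at t within (T \<inter> {..<t}))))"

definition brownian_motion :: "'w measure \<Rightarrow> (real \<Rightarrow> 'w \<Rightarrow> real) \<Rightarrow> bool" where
  "brownian_motion M w \<longleftrightarrow>
     (\<forall>t\<ge>0. w t \<in> borel_measurable M) \<and>
     (AE \<omega> in M. w 0 \<omega> = 0) \<and>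
     (AE \<omega> in M. continuous_on {0..} (\<lambda>t. w t \<omega>)) \<and>
     (\<forall>s t. 0 \<le> s \<and> s < t \<longrightarrow>
        distributed M lborel (\<lambda>\<omega>. w t \<omega> - w s \<omega>) (normal_density 0 (sqrt (t - s)))) \<and>
     (\<forall>(t :: nat \<Rightarrow> real) k. 0 \<le> t 0 \<and> mono t \<longrightarrow>
        prob_space.indep_vars M (\<lambda>_. borel) (\<lambda>i \<omega>. w (t (Suc i)) \<omega> - w (t i) \<omega>) {..<k})"

definition levy_measure :: "real measure \<Rightarrow> bool" where
  "levy_measure \<Lambda> \<longleftrightarrow> sets \<Lambda> = sets borel \<and> emeasure \<Lambda> {0} = 0 \<and>
     (\<integral>\<^sup>+x. ennreal (min 1 (x\<^sup>2)) \<partial>\<Lambda>) < \<infinity>"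

text \<open>Random measures are families of Borel measures on \<open>\<real> \<times> \<real>\<close> (time, jump size) which charge
  only \<open>(0,\<infinity>) \<times> (\<real> \<setminus> {0})\<close>. As in Jacod--Shiryaev, \<open>\<mu>\<close> is integer-valued if it takes values
  in \<open>\<nat> \<union> {\<infinity>}\<close>, has at most one point at each time, and is optional (for such \<open>\<mu>\<close>: adapted).\<close>

definition integer_valued_random_measure ::
  "'w measure \<Rightarrow> (real \<Rightarrow> 'w measure) \<Rightarrow> ('w \<Rightarrow> (real \<times> real) measure) \<Rightarrow> bool" where
  "integer_valued_random_measure M F \<mu> \<longleftrightarrow>
     (\<forall>\<omega>\<in>space M. sets (\<mu> \<omega>) = sets borel \<and>
        emeasure (\<mu> \<omega>) (- ({0<..} \<times> (- {0}))) = 0 \<and>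
        (\<forall>A\<in>sets borel. emeasure (\<mu> \<omega>) A \<in> insert \<infinity> (range of_nat)) \<and>
        (\<forall>t. emeasure (\<mu> \<omega>) ({t} \<times> UNIV) \<le> 1)) \<and>
     (\<forall>A\<in>sets borel. (\<lambda>\<omega>. emeasure (\<mu> \<omega>) A) \<in> borel_measurable M) \<and>
     (\<forall>t\<ge>0. \<forall>A\<in>sets borel. A \<subseteq> {0..t} \<times> UNIV \<longrightarrow>
        (\<lambda>\<omega>. emeasure (\<mu> \<omega>) A) \<in> borel_measurable (F t))"

definition predictable :: "'w measure \<Rightarrow> (real \<Rightarrow> 'w measure) \<Rightarrow> ('w \<times> real) measure" where
  "predictable M F = sigma (space M \<times> {0..})
     ({A \<times> {0} | A. A \<in> sets (F 0)} \<union>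
      {A \<times> {s<..t} | A s t. 0 \<le> s \<and> s \<le> t \<and> A \<in> sets (F s)})"

text \<open>\<open>\<nu>\<close> is the compensator of \<open>\<mu>\<close>: expectations of integrals of nonnegative predictable functions
  \<open>W(\<omega>,s,x)\<close> agree. Predictability of \<open>\<nu>\<close> itself is automatic since \<open>\<nu>\<close> is deterministic.\<close>

definition deterministic_compensator ::
  "'w measure \<Rightarrow> (real \<Rightarrow> 'w measure) \<Rightarrow> ('w \<Rightarrow> (real \<times> real) measure) \<Rightarrow>
   (real \<times> real) measure \<Rightarrow> bool" where
  "deterministic_compensator M F \<mu> \<nu> \<longleftrightarrow>
     (\<forall>W \<in> borel_measurable (predictable M F \<Otimes>\<^sub>M (borel :: real measure)).
        (\<integral>\<^sup>+\<omega>. (\<integral>\<^sup>+p\<in>{0..} \<times> UNIV. W ((\<omega>, fst p), snd p) \<partial>\<mu> \<omega>) \<partial>M) =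
        (\<integral>\<^sup>+\<omega>. (\<integral>\<^sup>+p\<in>{0..} \<times> UNIV. W ((\<omega>, fst p), snd p) \<partial>\<nu>) \<partial>M))"

definition levy_compensator :: "real measure \<Rightarrow> (real \<times> real) measure" where
  "levy_compensator \<Lambda> = density lborel (indicator {0..}) \<Otimes>\<^sub>M \<Lambda>"

definition truncated_compensated_sum ::
  "('w \<Rightarrow> (real \<times> real) measure) \<Rightarrow> (real \<times> real) measure \<Rightarrow> real \<Rightarrow> real \<Rightarrow> 'w \<Rightarrow> real" where
  "truncated_compensated_sum \<mu> \<nu> e t \<omega> =
     (LINT p:{0..t} \<times> {x. e < \<bar>x\<bar>}|\<mu> \<omega>. snd p) - (LINT p:{0..t} \<times> {x. e < \<bar>x\<bar>}|\<nu>. snd p)"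

text \<open>The process \<open>\<integral>\<^sub>0\<^sup>t \<integral> x (\<mu> - \<nu>)(ds dx)\<close>: the cadlag version of the \<open>L\<^sup>2\<close>-limit of the
  compensated sums of jumps larger than \<open>e\<close>, as \<open>e\<close> tends to 0. (In general neither
  \<open>\<integral> \<bar>x\<bar> \<partial>\<mu>\<close> nor \<open>\<integral> \<bar>x\<bar> \<partial>\<nu>\<close> is finite.)\<close>

definition compensated_jump_process ::
  "'w measure \<Rightarrow> ('w \<Rightarrow> (real \<times> real) measure) \<Rightarrow> (real \<times> real) measure \<Rightarrow>
   (real \<Rightarrow> 'w \<Rightarrow> real) \<Rightarrow> bool" where
  "compensated_jump_process M \<mu> \<nu> z \<longleftrightarrow>
     (\<forall>t\<ge>0. z t \<in> borel_measurable M) \<and>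
     (\<forall>\<omega>\<in>space M. cadlag_on {0..} (\<lambda>t. z t \<omega>)) \<and>
     (\<forall>t\<ge>0. ((\<lambda>e. \<integral>\<^sup>+\<omega>. ennreal ((z t \<omega> - truncated_compensated_sum \<mu> \<nu> e t \<omega>)\<^sup>2) \<partial>M)
                \<longlongrightarrow> 0) (at_right 0))"

definition process_events :: "'w measure \<Rightarrow> (real \<Rightarrow> 'w \<Rightarrow> real) \<Rightarrow> 'w set set" where
  "process_events M w = sigma_sets (space M)
     {w t -` B \<inter> space M | t B. 0 \<le> t \<and> B \<in> sets borel}"

definition random_measure_events ::
  "'w measure \<Rightarrow> ('w \<Rightarrow> (real \<times> real) measure) \<Rightarrow> 'w set set" where
  "random_measure_events M \<mu> = sigma_sets (space M)
     {(\<lambda>\<omega>. emeasure (\<mu> \<omega>) A) -` B \<inter> space M | A B. A \<in> sets borel \<and> B \<in> sets borel}"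


section \<open>The Ornstein--Uhlenbeck--Levy process and the family of its laws\<close>

definition OU_levy_process ::
  "'w measure \<Rightarrow> (real \<Rightarrow> 'w measure) \<Rightarrow> (real \<Rightarrow> 'w \<Rightarrow> real) \<Rightarrow>
   ('w \<Rightarrow> (real \<times> real) measure) \<Rightarrow> real measure \<Rightarrow> (real \<Rightarrow> 'w \<Rightarrow> real) \<Rightarrow>
   real \<Rightarrow> real \<Rightarrow> real \<Rightarrow> (real \<Rightarrow> 'w \<Rightarrow> real) \<Rightarrow> bool" where
  "OU_levy_process M F w \<mu> \<Lambda> z a \<rho>1 \<rho>2 \<xi> \<longleftrightarrow>
     prob_space M \<and>
     filtration (space M) F \<and> (\<forall>t. subalgebra M (F t)) \<and>
     brownian_motion M w \<and>
     levy_measure \<Lambda> \<and>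
     (\<integral>\<^sup>+x. ennreal (x\<^sup>2) \<partial>\<Lambda>) = 1 \<and>
     (\<integral>\<^sup>+x. ennreal (x ^ 8) \<partial>\<Lambda>) < \<infinity> \<and>
     integer_valued_random_measure M F \<mu> \<and>
     deterministic_compensator M F \<mu> (levy_compensator \<Lambda>) \<and>
     prob_space.indep_set M (process_events M w) (random_measure_events M \<mu>) \<and>
     compensated_jump_process M \<mu> (levy_compensator \<Lambda>) z \<and>
     (\<forall>t\<ge>0. \<xi> t \<in> borel_measurable M) \<and>
     (\<forall>\<omega>\<in>space M. cadlag_on {0..} (\<lambda>t. \<xi> t \<omega>)) \<and>
     (AE \<omega> in M. \<xi> 0 \<omega> = 0) \<and>
     (AE \<omega> in M. \<forall>t\<ge>0. \<xi> t \<omega> = a * (LINT s:{0..t}|lborel. \<xi> s \<omega>) + (\<rho>1 * w t \<omega> + \<rho>2 * z t \<omega>))"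

text \<open>The Borel \<open>\<sigma>\<close>-algebra of the Skorokhod topology on \<open>D[0,n]\<close> is generated by the
  coordinate maps, i.e. it is the trace of the product \<open>\<sigma>\<close>-algebra.\<close>

definition skorokhod_space :: "nat \<Rightarrow> (real \<Rightarrow> real) measure" where
  "skorokhod_space n =
     restrict_space (\<Pi>\<^sub>M t\<in>{0..real n}. borel) {x. cadlag_on {0..real n} x}"

text \<open>The laws are listed together with the parameters \<open>(a, \<rho>1, \<rho>2)\<close> producing them. The
  underlying probability space is arbitrary on the type variable \<open>'w\<close>.\<close>

definition OU_family ::
  "'w itself \<Rightarrow> (nat \<Rightarrow> real) \<Rightarrow> (nat \<Rightarrow> real) \<Rightarrow> (nat \<Rightarrow> real) \<Rightarrow> nat \<Rightarrow>
   ((real \<Rightarrow> real) measure \<times> real \<times> real \<times> real) set" where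
  "OU_family _ amax \<rho>low \<sigma>max n =
     {(Q, a, \<rho>1, \<rho>2).
        - amax n \<le> a \<and> a \<le> 0 \<and> 0 < \<rho>low n \<and> \<rho>low n \<le> \<rho>1\<^sup>2 \<and> \<rho>1\<^sup>2 + \<rho>2\<^sup>2 \<le> \<sigma>max n \<and>
        (\<exists>(M :: 'w measure) F w \<mu> \<Lambda> z \<xi>.
           OU_levy_process M F w \<mu> \<Lambda> z a \<rho>1 \<rho>2 \<xi> \<and>
           Q = distr M (skorokhod_space n) (\<lambda>\<omega>. restrict (\<lambda>t. \<xi> t \<omega>) {0..real n}))}"

definition admissible_bounds ::
  "(nat \<Rightarrow> real) \<Rightarrow> (nat \<Rightarrow> real) \<Rightarrow> (nat \<Rightarrow> real) \<Rightarrow> bool" where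
  "admissible_bounds amax \<rho>low \<sigma>max \<longleftrightarrow>
     (\<forall>\<epsilon>>0. ((\<lambda>n. amax n / real n powr \<epsilon>) \<longlonglongrightarrow> 0) \<and>
             liminf (\<lambda>n. ereal (real n powr \<epsilon> * \<rho>low n)) > 0 \<and>
             ((\<lambda>n. real n powr (- \<epsilon>) * \<sigma>max n) \<longlonglongrightarrow> 0))"


section \<open>Stochastic Fourier coefficients\<close>

definition Tr :: "nat \<Rightarrow> real \<Rightarrow> real" where
  "Tr j x = (if j = 1 then 1
             else if even j then sqrt 2 * cos (2 * pi * real (j div 2) * x)
             else sqrt 2 * sin (2 * pi * real (j div 2) * x))"

text \<open>\<open>N k\<close> is the number of intervals of the \<open>k\<close>-th partition \<open>0 = \<pi> k 0 \<le> \<dots> \<le> \<pi> k (N k) = T\<close>.\<close>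

definition vanishing_partitions :: "real \<Rightarrow> (nat \<Rightarrow> nat) \<Rightarrow> (nat \<Rightarrow> nat \<Rightarrow> real) \<Rightarrow> bool" where
  "vanishing_partitions T N \<pi> \<longleftrightarrow>
     (\<forall>k. \<pi> k 0 = 0 \<and> \<pi> k (N k) = T \<and> (\<forall>i<N k. \<pi> k i \<le> \<pi> k (Suc i))) \<and>
     (\<forall>d>0. \<forall>\<^sub>F k in sequentially. \<forall>i<N k. \<pi> k (Suc i) - \<pi> k i < d)"

text \<open>\<open>I\<close> is (a version of) the stochastic integral \<open>\<integral>\<^sub>0\<^sup>T f dX\<close> of a continuous deterministic
  function against a semimartingale: the limit in probability of the Riemann--Ito sums along any
  deterministic partitions with mesh tending to 0. It depends only on the law of \<open>X\<close>, so that it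
  makes sense for the coordinate process on \<open>D[0,n]\<close>.\<close>

definition has_stochastic_integral ::
  "'w measure \<Rightarrow> real \<Rightarrow> (real \<Rightarrow> real) \<Rightarrow> (real \<Rightarrow> 'w \<Rightarrow> real) \<Rightarrow> ('w \<Rightarrow> real) \<Rightarrow> bool" where
  "has_stochastic_integral P T f X I \<longleftrightarrow>
     I \<in> borel_measurable P \<and>
     (\<forall>N \<pi>. vanishing_partitions T N \<pi> \<longrightarrow>
        (\<forall>\<epsilon>>0. (\<lambda>k. measure P {\<omega> \<in> space P.
            \<epsilon> < \<bar>(\<Sum>i<N k. f (\<pi> k i) * (X (\<pi> k (Suc i)) \<omega> - X (\<pi> k i) \<omega>)) - I \<omega>\<bar>})
          \<longlonglongrightarrow> 0))"

definition stochastic_integral ::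
  "'w measure \<Rightarrow> real \<Rightarrow> (real \<Rightarrow> real) \<Rightarrow> (real \<Rightarrow> 'w \<Rightarrow> real) \<Rightarrow> 'w \<Rightarrow> real" where
  "stochastic_integral P T f X = (SOME I. has_stochastic_integral P T f X I)"

definition fourier_noise :: "nat \<Rightarrow> (real \<Rightarrow> real) measure \<Rightarrow> nat \<Rightarrow> (real \<Rightarrow> real) \<Rightarrow> real" where
  "fourier_noise n Q j x =
     real n powr (- 1 / 2) * stochastic_integral Q (real n) (Tr j) (\<lambda>t y. y t) x"

definition L1 :: "nat \<Rightarrow> (real \<Rightarrow> real) measure \<Rightarrow> real \<Rightarrow> real" where
  "L1 n Q \<sigma> = (\<Sum>j=1..n. \<bar>(LINT x|Q. (fourier_noise n Q j x)\<^sup>2) - \<sigma>\<bar>)"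

end

theory Submission
  imports Defs
begin

text \<open>
  Everything rests on the covariance of the noise \<open>u = \<rho>1 w + \<rho>2 z\<close>, which is
  \<open>E u\<^sub>s u\<^sub>t = \<sigma> min s t\<close> with \<open>\<sigma> = \<rho>1\<^sup>2 + \<rho>2\<^sup>2\<close>, so that integrals of deterministic
  functions against \<open>u\<close> satisfy the Ito isometry
  \<open>E (\<integral> g du)\<^sup>2 = \<sigma> \<integral> g\<^sup>2\<close> (\<open>second_moment_parts_integral\<close>).

  The Fourier coefficient is an integral against \<open>\<xi>\<close>, not against \<open>u\<close>, but
  \<open>d\<xi> = a \<xi> dt + du\<close> is linear. If \<open>g\<close> solves the adjoint equation
  \<open>g' = f' - a g\<close> with terminal value \<open>g n = f n\<close>, then integration by parts gives
  \<open>\<integral>\<^sub>0\<^sup>n f d\<xi> = \<integral>\<^sub>0\<^sup>n g du\<close> path by path (\<open>parts_integral_of_linear_equation\<close>). Hence the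
  second moment of the \<open>j\<close>-th coefficient is \<open>\<sigma>/n \<integral>\<^sub>0\<^sup>n g\<^sup>2\<close> for the solution \<open>g\<close> that belongs
  to \<open>f = Tr j\<close> (\<open>expectation_fourier_noise_square\<close>).

  For a sinusoid of frequency \<open>\<omega>\<close> this \<open>g\<close> is a sinusoid plus a multiple of
  \<open>exp (a (n - s))\<close>. With \<open>b = - a \<ge> 0\<close> its mean square differs from 1 by at most
  \<open>(b\<^sup>2 + 5 b) / \<omega>\<^sup>2\<close> (\<open>response_sinusoid\<close>), and by at most 1 for the constant
  function. As \<open>\<omega> \<ge> j\<close>, summing over \<open>j\<close> gives \<open>\<sigma> (1 + b\<^sup>2 + 5 b)\<close>, which is below the claimed bound.

  Two points need work. The covariance of the jump part \<open>z\<close> has to be extracted from the compensator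
  formula. For a nonnegative \<open>g\<close> that vanishes near 0 let \<open>G\<^sub>t\<close> be the sum of \<open>g\<close> over the jumps up to
  time \<open>t\<close>. Almost surely \<open>g\<close> meets only finitely many of these, at most one at each time. Hence
  \<open>G\<^sub>t\<^sup>2\<close> is the sum of \<open>g\<^sup>2\<close> over the jumps plus twice the sum of \<open>G\<^sub>s\<^sub>- g\<close> over the jumps at times
  \<open>s\<close>, and the left limit \<open>G\<^sub>s\<^sub>-\<close> is predictable. The compensator then gives
  \<open>E G\<^sub>t\<^sup>2 = t \<integral> g\<^sup>2 d\<Lambda> + t\<^sup>2 (\<integral> g d\<Lambda>)\<^sup>2\<close> (\<open>expectation_jumps_square\<close>). Positive and negative
  jumps are recombined by polarization, and the limit of vanishing truncation is taken in \<open>L\<^sup>2\<close>.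
  Secondly, \<open>stochastic_integral\<close> is a choice among all limits in probability of Riemann--Ito sums.
  For smooth integrands these sums converge along every cadlag path to the expression given by
  integration by parts, and limits in probability are almost surely unique, so the choice is harmless.
\<close>

section \<open>Cadlag paths\<close>

lemma cadlag_on_subset:
  assumes "cadlag_on T x" "S \<subseteq> T"
  shows "cadlag_on S x"
  unfolding cadlag_on_def
proof (intro ballI conjI)
  fix t assume "t \<in> S"
  then have *: "continuous (at t within (T \<inter> {t..})) x" "\<exists>l. (x \<longlongrightarrow> l) (at t within (T \<inter> {..<t}))"
    using assms by (auto simp: cadlag_on_def)
  show "continuous (at t within (S \<inter> {t..})) x"
    using *(1) assms(2) by (rule_tac continuous_within_subset) auto
  show "\<exists>l. (x \<longlongrightarrow> l) (at t within (S \<inter> {..<t}))"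
    using *(2) assms(2) by (meson Int_mono order_refl tendsto_within_subset)
qed

lemma cadlag_on_cong:
  assumes "\<And>t. t \<in> T \<Longrightarrow> x t = y t"
  shows "cadlag_on T x \<longleftrightarrow> cadlag_on T y"
proof -
  have "cadlag_on T y" if "cadlag_on T x" "\<And>t. t \<in> T \<Longrightarrow> x t = y t" for x y
    unfolding cadlag_on_def
  proof (intro ballI conjI)
    fix t assume t: "t \<in> T"
    then have *: "continuous (at t within (T \<inter> {t..})) x" "\<exists>l. (x \<longlongrightarrow> l) (at t within (T \<inter> {..<t}))"
      using that by (auto simp: cadlag_on_def)
    have "eventually (\<lambda>s. x s = y s) (at t within (T \<inter> S))" for S
      unfolding eventually_at_filter using that(2) by (auto intro!: always_eventually)
    from tendsto_cong[OF this]
    have **: "(x \<longlongrightarrow> l) (at t within (T \<inter> S)) \<longleftrightarrow> (y \<longlongrightarrow> l) (at t within (T \<inter> S))" for l S .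
    show "continuous (at t within (T \<inter> {t..})) y"
      using *(1) that(2)[OF t] unfolding continuous_within ** by simp
    show "\<exists>l. (y \<longlongrightarrow> l) (at t within (T \<inter> {..<t}))"
      using *(2) unfolding ** .
  qed
  then show ?thesis using assms by metis
qed

lemma cadlag_on_right_tendsto:
  assumes "cadlag_on T x" "t \<in> T" "\<And>k. r k \<in> T" "\<And>k. t \<le> r k" "r \<longlonglongrightarrow> t"
  shows "(\<lambda>k. x (r k)) \<longlonglongrightarrow> x t"
proof -
  have "continuous (at t within (T \<inter> {t..})) x" using assms by (auto simp: cadlag_on_def)
  then show ?thesis
    unfolding continuous_within_sequentially comp_def using assms by auto
qed

text \<open>
  The one-sided limits bound the path near each time; compactness makes finitely many of these
  neighbourhoods suffice.
\<close>

lemma cadlag_on_Icc_bounded: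
  assumes "cadlag_on {0..T} x"
  obtains B where "\<And>t. t \<in> {0..T} \<Longrightarrow> \<bar>x t\<bar> \<le> B"
proof -
  have "\<exists>U B. open U \<and> t \<in> U \<and> (\<forall>s \<in> U \<inter> {0..T}. \<bar>x s\<bar> \<le> B)" if t: "t \<in> {0..T}" for t
  proof -
    obtain l where l: "(x \<longlongrightarrow> l) (at t within ({0..T} \<inter> {..<t}))"
      using assms t unfolding cadlag_on_def by blast
    have r: "(x \<longlongrightarrow> x t) (at t within ({0..T} \<inter> {t..}))"
      using assms t by (auto simp: cadlag_on_def continuous_within)
    from tendstoD[OF l zero_less_one]
    obtain U1 where U1: "open U1" "t \<in> U1" "\<And>s. s \<in> U1 \<Longrightarrow> s \<noteq> t \<Longrightarrow> s \<in> {0..T} \<inter> {..<t} \<Longrightarrow> dist (x s) l < 1"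
      unfolding eventually_at_topological by blast
    from tendstoD[OF r zero_less_one]
    obtain U2 where U2: "open U2" "t \<in> U2" "\<And>s. s \<in> U2 \<Longrightarrow> s \<noteq> t \<Longrightarrow> s \<in> {0..T} \<inter> {t..} \<Longrightarrow> dist (x s) (x t) < 1"
      unfolding eventually_at_topological by blast
    have "\<bar>x s\<bar> \<le> 1 + \<bar>l\<bar> + \<bar>x t\<bar>" if "s \<in> (U1 \<inter> U2) \<inter> {0..T}" for s
    proof -
      consider "s = t" | "s < t" | "s > t" by linarith
      then show ?thesis
        by cases (use that U1(3)[of s] U2(3)[of s] in \<open>auto simp: dist_real_def\<close>)
    qed
    then show ?thesis
      using U1 U2 by (intro exI[of _ "U1 \<inter> U2"] exI[of _ "1 + \<bar>l\<bar> + \<bar>x t\<bar>"]) auto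
  qed
  then obtain U B where UB: "\<And>t. t \<in> {0..T} \<Longrightarrow> open (U t) \<and> t \<in> U t \<and> (\<forall>s \<in> U t \<inter> {0..T}. \<bar>x s\<bar> \<le> B t)"
    by metis
  obtain C where C: "C \<subseteq> {0..T}" "finite C" "{0..T} \<subseteq> (\<Union>t\<in>C. U t)"
    using compactE_image[OF compact_Icc, of "{0..T}" U 0 T] UB by blast
  have "\<bar>x s\<bar> \<le> (\<Sum>t\<in>C. \<bar>B t\<bar>)" if s: "s \<in> {0..T}" for s
  proof -
    obtain t where t: "t \<in> C" "s \<in> U t" using C s by auto
    then have "\<bar>x s\<bar> \<le> B t" using UB[of t] C s by auto
    also have "\<dots> \<le> \<bar>B t\<bar>" by simp
    also have "\<dots> \<le> (\<Sum>t\<in>C. \<bar>B t\<bar>)" by (rule member_le_sum) (use t C in auto)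
    finally show ?thesis .
  qed
  then show ?thesis using that by blast
qed

text \<open>
  The first multiple of \<open>1 / (k + 1)\<close> strictly to the right of \<open>t\<close>. Approaching \<open>t\<close> from the
  right is what lets values of a right-continuous path on the grid converge to its value at \<open>t\<close>.
\<close>

definition next_grid :: "nat \<Rightarrow> real \<Rightarrow> real" where
  "next_grid k t = (of_int \<lfloor>t * real (Suc k)\<rfloor> + 1) / real (Suc k)"

lemma next_grid_bounds: "t \<le> next_grid k t" "next_grid k t \<le> t + 1 / real (Suc k)"
proof -
  have *: "0 < real (Suc k)" by simp
  have "t * real (Suc k) \<le> of_int \<lfloor>t * real (Suc k)\<rfloor> + 1" by linarith
  then show "t \<le> next_grid k t" using * by (simp only: next_grid_def pos_le_divide_eq)
  have "of_int \<lfloor>t * real (Suc k)\<rfloor> + 1 \<le> t * real (Suc k) + 1" by linarith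
  also have "\<dots> = (t + 1 / real (Suc k)) * real (Suc k)" by (simp add: field_simps)
  finally show "next_grid k t \<le> t + 1 / real (Suc k)" using * by (simp only: next_grid_def pos_divide_le_eq)
qed

lemma next_grid_tendsto: "(\<lambda>k. next_grid k t) \<longlonglongrightarrow> t"
proof (rule real_tendsto_sandwich[of "\<lambda>_. t" _ _ "\<lambda>k. t + 1 / real (Suc k)"])
  show "(\<lambda>k. t + 1 / real (Suc k)) \<longlonglongrightarrow> t"
    using tendsto_add[OF tendsto_const LIMSEQ_inverse_real_of_nat, of t] by (simp add: inverse_eq_divide)
qed (intro always_eventually allI next_grid_bounds tendsto_const)+

text \<open>
  Sampled at \<open>next_grid\<close>, the path depends on \<open>t\<close> through an integer only; right-continuity
  recovers the path in the limit.
\<close>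

lemma cadlag_on_borel_measurable:
  assumes x: "cadlag_on {0..T} x"
  shows "(\<lambda>t. indicator {0..T} t * x t) \<in> borel_measurable lborel"
proof (rule borel_measurable_LIMSEQ_real)
  let ?r = "\<lambda>k t. max 0 (min T (next_grid k t))"
  show "(\<lambda>t. indicator {0..T} t * x (?r k t)) \<in> borel_measurable lborel" for k
  proof -
    let ?f = "\<lambda>(i :: int) t. indicator {0..T} t * x (max 0 (min T ((of_int i + 1) / real (Suc k))))"
    have "(\<lambda>t. ?f \<lfloor>t * real (Suc k)\<rfloor> t) \<in> borel_measurable lborel"
      by (rule measurable_compose_countable[where f="?f"]) measurable
    then show ?thesis unfolding next_grid_def .
  qed
  fix t :: real
  show "(\<lambda>k. indicator {0..T} t * x (?r k t)) \<longlonglongrightarrow> indicator {0..T} t * x t"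
  proof (cases "t \<in> {0..T}")
    case True
    have "(\<lambda>k. ?r k t) \<longlonglongrightarrow> max 0 (min T t)"
      by (intro tendsto_intros next_grid_tendsto)
    then have "(\<lambda>k. x (?r k t)) \<longlonglongrightarrow> x t"
      using True next_grid_bounds(1)[of t]
      by (intro cadlag_on_right_tendsto[OF x]) (auto simp: le_max_iff_disj)
    then show ?thesis by (intro tendsto_intros)
  qed simp
qed

lemma cadlag_on_set_integrable:
  assumes "cadlag_on {0..T} x"
  shows "set_integrable lborel {0..T} x"
proof -
  obtain B where B: "\<And>t. t \<in> {0..T} \<Longrightarrow> \<bar>x t\<bar> \<le> B" using cadlag_on_Icc_bounded[OF assms] by blast
  have "integrable lborel (\<lambda>t. indicator {0..T} t * x t)"
  proof (rule Bochner_Integration.integrable_bound)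
    show "integrable lborel (\<lambda>t. indicator {0..T} t * \<bar>B\<bar>)"
      by (intro integrable_mult_left integrable_real_indicator) (auto simp: emeasure_lborel_Icc_eq)
    show "AE t in lborel. norm (indicator {0..T} t * x t) \<le> norm (indicator {0..T} t * \<bar>B\<bar>)"
      using B by (intro AE_I2) (force simp: indicator_def)
  qed (rule cadlag_on_borel_measurable[OF assms])
  then show ?thesis by (simp add: set_integrable_def)
qed

lemma cadlag_on_add:
  assumes "cadlag_on T x" "cadlag_on T y"
  shows "cadlag_on T (\<lambda>t. x t + y t)"
  unfolding cadlag_on_def
proof (intro ballI conjI)
  fix t assume t: "t \<in> T"
  show "continuous (at t within T \<inter> {t..}) (\<lambda>t. x t + y t)"
    using assms t unfolding cadlag_on_def by (intro continuous_add; blast)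
  obtain l m where "(x \<longlongrightarrow> l) (at t within T \<inter> {..<t})" "(y \<longlongrightarrow> m) (at t within T \<inter> {..<t})"
    using assms t unfolding cadlag_on_def by metis
  then show "\<exists>l. ((\<lambda>t. x t + y t) \<longlongrightarrow> l) (at t within T \<inter> {..<t})"
    by (intro exI[of _ "l + m"] tendsto_add)
qed

lemma cadlag_on_mult:
  assumes "cadlag_on T x" "cadlag_on T y"
  shows "cadlag_on T (\<lambda>t. x t * y t)"
  unfolding cadlag_on_def
proof (intro ballI conjI)
  fix t assume t: "t \<in> T"
  show "continuous (at t within T \<inter> {t..}) (\<lambda>t. x t * y t)"
    using assms t unfolding cadlag_on_def by (intro continuous_mult; blast)
  obtain l m where "(x \<longlongrightarrow> l) (at t within T \<inter> {..<t})" "(y \<longlongrightarrow> m) (at t within T \<inter> {..<t})"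
    using assms t unfolding cadlag_on_def by metis
  then show "\<exists>l. ((\<lambda>t. x t * y t) \<longlongrightarrow> l) (at t within T \<inter> {..<t})"
    by (intro exI[of _ "l * m"] tendsto_mult)
qed

lemma cadlag_on_continuous:
  assumes "continuous_on T x"
  shows "cadlag_on T x"
  unfolding cadlag_on_def
proof (intro ballI conjI)
  fix t assume "t \<in> T"
  then have x: "(x \<longlongrightarrow> x t) (at t within T)" using assms by (auto simp: continuous_on_def)
  show "continuous (at t within T \<inter> {t..}) x"
    unfolding continuous_within by (rule tendsto_within_subset[OF x]) auto
  have "(x \<longlongrightarrow> x t) (at t within T \<inter> {..<t})"
    by (rule tendsto_within_subset[OF x]) auto
  then show "\<exists>l. (x \<longlongrightarrow> l) (at t within T \<inter> {..<t})" by blast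
qed

lemma cadlag_on_continuous_mult:
  assumes "cadlag_on T x" "continuous_on T f"
  shows "cadlag_on T (\<lambda>t. f t * x t)"
  by (rule cadlag_on_mult[OF cadlag_on_continuous[OF assms(2)] assms(1)])

section \<open>Pathwise integration by parts\<close>

lemma set_integral_FTC:
  fixes f f' :: "real \<Rightarrow> real"
  assumes "a \<le> b" "\<And>t. (f has_real_derivative f' t) (at t)" "continuous_on UNIV f'"
  shows "(LINT t:{a..b}|lborel. f' t) = f b - f a"
proof -
  have "(\<integral>t. f' t * indicator {a..b} t \<partial>lborel) = f b - f a"
    using assms by (intro integral_FTC_Icc_real) (auto simp: continuous_on_eq_continuous_at)
  then show ?thesis by (simp add: set_lebesgue_integral_def mult.commute)
qed

text \<open>
  The integral of \<open>f\<close> against \<open>x\<close> as integration by parts defines it. All of its terms make sense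
  for a single cadlag path, without any probability.
\<close>

definition parts_integral :: "real \<Rightarrow> (real \<Rightarrow> real) \<Rightarrow> (real \<Rightarrow> real) \<Rightarrow> (real \<Rightarrow> real) \<Rightarrow> real" where
  "parts_integral T f f' x = f T * x T - f 0 * x 0 - (LINT t:{0..T}|lborel. f' t * x t)"

lemma summation_by_parts:
  fixes f x :: "nat \<Rightarrow> real"
  shows "(\<Sum>i<N. f i * (x (Suc i) - x i)) = f N * x N - f 0 * x 0 - (\<Sum>i<N. x (Suc i) * (f (Suc i) - f i))"
  by (induction N) (auto simp: algebra_simps)

lemma monotone_chain_cell:
  fixes \<pi> :: "nat \<Rightarrow> real"
  assumes "\<pi> 0 \<le> t" "t < \<pi> N"
  shows "\<exists>i<N. \<pi> i \<le> t \<and> t < \<pi> (Suc i)"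
  using assms by (induction N) (auto simp: less_Suc_eq not_less[symmetric])

lemma monotone_chain_le:
  fixes \<pi> :: "nat \<Rightarrow> real"
  assumes "\<And>i. i < N \<Longrightarrow> \<pi> i \<le> \<pi> (Suc i)" "i \<le> j" "j \<le> N"
  shows "\<pi> i \<le> \<pi> j"
  using assms(2,3) by (induction rule: dec_induct) (auto intro: order_trans[OF _ assms(1)])

lemma vanishing_partitions_points:
  assumes part: "vanishing_partitions T N \<pi>" and i: "i \<le> N k"
  shows "\<pi> k i \<in> {0..T}"
proof -
  have "\<pi> k 0 = 0" "\<pi> k (N k) = T" "\<And>i. i < N k \<Longrightarrow> \<pi> k i \<le> \<pi> k (Suc i)"
    using part by (auto simp: vanishing_partitions_def)
  then show ?thesis
    using monotone_chain_le[of "N k" "\<pi> k" 0 i] monotone_chain_le[of "N k" "\<pi> k" i "N k"] i by auto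
qed

text \<open>
  The step function with value \<open>c i\<close> on the \<open>i\<close>-th cell of a partition. Both the Riemann--Ito sums
  of a path and their second moments become Lebesgue integrals of such functions.
\<close>

definition step :: "(nat \<Rightarrow> real) \<Rightarrow> nat \<Rightarrow> (nat \<Rightarrow> real) \<Rightarrow> real \<Rightarrow> real" where
  "step \<pi> N c t = (\<Sum>i<N. c i * indicator {\<pi> i..<\<pi> (Suc i)} t)"

lemma step_eq:
  assumes \<pi>: "\<And>i. i < N \<Longrightarrow> \<pi> i \<le> \<pi> (Suc i)" and i: "i < N" "\<pi> i \<le> t" "t < \<pi> (Suc i)"
  shows "step \<pi> N c t = c i"
proof -
  have "indicator {\<pi> j..<\<pi> (Suc j)} t = (if j = i then 1 else 0 :: real)" if "j < N" for j
  proof -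
    consider "j = i" | "Suc j \<le> i" | "Suc i \<le> j" by linarith
    then show ?thesis
      by cases (use monotone_chain_le[of N \<pi> "Suc j" i, OF \<pi>] monotone_chain_le[of N \<pi> "Suc i" j, OF \<pi>] that i
        in \<open>auto simp: indicator_def\<close>)
  qed
  then have "step \<pi> N c t = (\<Sum>j<N. if j = i then c j else 0)"
    unfolding step_def by (intro sum.cong) auto
  then show ?thesis using i by simp
qed

lemma step_measurable [measurable]: "step \<pi> N c \<in> borel_measurable borel"
  unfolding step_def[abs_def] by measurable

lemma step_partition_cases:
  assumes part: "vanishing_partitions T N \<pi>" and t: "t \<in> {0..<T}"
  obtains i where "i < N k" "\<pi> k i \<le> t" "t < \<pi> k (Suc i)" "\<And>c. step (\<pi> k) (N k) c t = c i"
proof -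
  have \<pi>: "\<pi> k 0 = 0" "\<pi> k (N k) = T" "\<And>i. i < N k \<Longrightarrow> \<pi> k i \<le> \<pi> k (Suc i)"
    using part by (auto simp: vanishing_partitions_def)
  obtain i where i: "i < N k" "\<pi> k i \<le> t" "t < \<pi> k (Suc i)"
    using monotone_chain_cell[of "\<pi> k" t "N k"] t \<pi> by auto
  show ?thesis using that[OF i step_eq[OF \<pi>(3) i]] by blast
qed

lemma step_outside:
  assumes part: "vanishing_partitions T N \<pi>" and t: "t \<notin> {0..<T}"
  shows "step (\<pi> k) (N k) c t = 0"
proof -
  have "indicator {\<pi> k i..<\<pi> k (Suc i)} t = (0::real)" if "i < N k" for i
    using vanishing_partitions_points[OF part, of i k] vanishing_partitions_points[OF part, of "Suc i" k] that t
    by (auto simp: indicator_def)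
  then show ?thesis by (simp add: step_def)
qed

lemma vanishing_partitions_tendsto:
  assumes part: "vanishing_partitions T N \<pi>" and i: "\<And>k. i k < N k" "\<And>k. \<pi> k (i k) \<le> t" "\<And>k. t < \<pi> k (Suc (i k))"
  shows "(\<lambda>k. \<pi> k (i k)) \<longlonglongrightarrow> t" "(\<lambda>k. \<pi> k (Suc (i k))) \<longlonglongrightarrow> t"
proof -
  have close: "\<forall>\<^sub>F k in sequentially. \<pi> k (Suc (i k)) - \<pi> k (i k) < d" if "0 < d" for d
  proof -
    have "\<forall>\<^sub>F k in sequentially. \<forall>i<N k. \<pi> k (Suc i) - \<pi> k i < d"
      using part that by (auto simp: vanishing_partitions_def)
    then show ?thesis by (rule eventually_mono) (use i(1) in blast)
  qed
  show "(\<lambda>k. \<pi> k (i k)) \<longlonglongrightarrow> t"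
  proof (rule tendstoI)
    fix d :: real assume "0 < d"
    from close[OF this] show "\<forall>\<^sub>F k in sequentially. dist (\<pi> k (i k)) t < d"
    proof eventually_elim
      case (elim k)
      then show ?case using i(2,3)[of k] by (simp add: dist_real_def)
    qed
  qed
  show "(\<lambda>k. \<pi> k (Suc (i k))) \<longlonglongrightarrow> t"
  proof (rule tendstoI)
    fix d :: real assume "0 < d"
    from close[OF this] show "\<forall>\<^sub>F k in sequentially. dist (\<pi> k (Suc (i k))) t < d"
    proof eventually_elim
      case (elim k)
      then show ?case using i(2,3)[of k] by (simp add: dist_real_def)
    qed
  qed
qed

lemma continuous_on_Icc_bounded:
  fixes f :: "real \<Rightarrow> real"
  assumes "continuous_on UNIV f"
  obtains B where "\<And>t. t \<in> {a..b} \<Longrightarrow> \<bar>f t\<bar> \<le> B"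
proof -
  have "compact (f ` {a..b})"
    using assms by (intro compact_continuous_image) (auto intro: continuous_on_subset)
  then obtain B where "\<forall>y\<in>f ` {a..b}. norm y \<le> B"
    using compact_imp_bounded bounded_iff by metis
  then show ?thesis by (intro that[of B]) simp
qed

text \<open>
  Abel summation moves the increments from \<open>x\<close> to \<open>f\<close>. What remains is the integral of \<open>f'\<close>
  against the step function that takes the value of \<open>x\<close> at the right end of each cell. As the mesh
  vanishes these right ends approach every \<open>t < T\<close> from the right, so right-continuity gives pointwise
  and boundedness gives dominated convergence.
\<close>

lemma Riemann_sums_tendsto_parts_integral:
  assumes x: "cadlag_on {0..T} x"
    and f: "\<And>t. (f has_real_derivative f' t) (at t)" "continuous_on UNIV f'"
    and part: "vanishing_partitions T N \<pi>"
  shows "(\<lambda>k. \<Sum>i<N k. f (\<pi> k i) * (x (\<pi> k (Suc i)) - x (\<pi> k i))) \<longlonglongrightarrow> parts_integral T f f' x"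
proof -
  have \<pi>: "\<pi> k 0 = 0" "\<pi> k (N k) = T" "\<And>i. i < N k \<Longrightarrow> \<pi> k i \<le> \<pi> k (Suc i)" for k
    using part by (auto simp: vanishing_partitions_def)
  note in_T = vanishing_partitions_points[OF part]
  obtain B where B: "\<And>t. t \<in> {0..T} \<Longrightarrow> \<bar>x t\<bar> \<le> B" using cadlag_on_Icc_bounded[OF x] by blast
  obtain B' where B': "\<And>t. t \<in> {0..T} \<Longrightarrow> \<bar>f' t\<bar> \<le> B'" using continuous_on_Icc_bounded[OF f(2)] by blast
  have [measurable]: "f' \<in> borel_measurable borel"
    using f(2) by (rule borel_measurable_continuous_onI)
  define y where "y k = step (\<pi> k) (N k) (\<lambda>i. x (\<pi> k (Suc i)))" for k
  let ?c = "\<lambda>k i. indicator {\<pi> k i..<\<pi> k (Suc i)} :: real \<Rightarrow> real"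
  have sum_eq: "(\<Sum>i<N k. x (\<pi> k (Suc i)) * (f (\<pi> k (Suc i)) - f (\<pi> k i))) = (LINT t|lborel. f' t * y k t)" for k
  proof -
    have int: "integrable lborel (\<lambda>t. indicator {a..<b} t * f' t)" for a b :: real
    proof -
      have "set_integrable lborel {a..b} f'"
        using f(2) by (intro borel_integrable_atLeastAtMost') (auto intro: continuous_on_subset)
      then have "set_integrable lborel {a..<b} f'"
        by (rule set_integrable_subset) auto
      then show ?thesis by (simp add: set_integrable_def)
    qed
    have "(\<Sum>i<N k. x (\<pi> k (Suc i)) * (f (\<pi> k (Suc i)) - f (\<pi> k i))) =
      (\<Sum>i<N k. x (\<pi> k (Suc i)) * (LINT t|lborel. ?c k i t * f' t))"
    proof (intro sum.cong refl)
      fix i assume "i \<in> {..<N k}"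
      then have "f (\<pi> k (Suc i)) - f (\<pi> k i) = (LINT t:{\<pi> k i..\<pi> k (Suc i)}|lborel. f' t)"
        using set_integral_FTC[OF _ f, of "\<pi> k i" "\<pi> k (Suc i)"] \<pi> by auto
      also have "\<dots> = (LINT t|lborel. ?c k i t * f' t)"
        unfolding set_lebesgue_integral_def
      proof (rule integral_cong_AE)
        show "AE t in lborel. indicator {\<pi> k i..\<pi> k (Suc i)} t *\<^sub>R f' t = ?c k i t * f' t"
          using AE_lborel_singleton[of "\<pi> k (Suc i)"] by eventually_elim (auto simp: indicator_def)
      qed measurable
      finally show "x (\<pi> k (Suc i)) * (f (\<pi> k (Suc i)) - f (\<pi> k i)) = x (\<pi> k (Suc i)) * (LINT t|lborel. ?c k i t * f' t)"
        by simp
    qed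
    also have "\<dots> = (LINT t|lborel. (\<Sum>i<N k. x (\<pi> k (Suc i)) * (?c k i t * f' t)))"
      using int by (simp add: integral_sum)
    also have "\<dots> = (LINT t|lborel. f' t * y k t)"
      unfolding y_def step_def sum_distrib_left by (intro Bochner_Integration.integral_cong sum.cong refl) auto
    finally show ?thesis .
  qed
  have "(\<lambda>k. LINT t|lborel. f' t * y k t) \<longlonglongrightarrow> (LINT t|lborel. indicator {0..T} t * (f' t * x t))"
  proof (rule integral_dominated_convergence[where w="\<lambda>t. indicator {0..T} t * (\<bar>B'\<bar> * \<bar>B\<bar>)"])
    show "(\<lambda>t. indicator {0..T} t * (f' t * x t)) \<in> borel_measurable lborel"
      using cadlag_on_borel_measurable[OF cadlag_on_continuous_mult[OF x continuous_on_subset[OF f(2)]]] by simp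
    show "(\<lambda>t. f' t * y k t) \<in> borel_measurable lborel" for k
      unfolding y_def by measurable
    show "integrable lborel (\<lambda>t. indicator {0..T} t * (\<bar>B'\<bar> * \<bar>B\<bar>))"
      by (intro integrable_mult_left integrable_real_indicator) (auto simp: emeasure_lborel_Icc_eq)
    have ne: "AE t in lborel. t \<noteq> T" by (rule AE_lborel_singleton)
    show "AE t in lborel. (\<lambda>k. f' t * y k t) \<longlonglongrightarrow> indicator {0..T} t * (f' t * x t)"
      using ne
    proof eventually_elim
      case (elim t)
      show ?case
      proof (cases "t \<in> {0..<T}")
        case True
        obtain i where i: "\<And>k. i k < N k" "\<And>k. \<pi> k (i k) \<le> t" "\<And>k. t < \<pi> k (Suc (i k))"
          and y: "\<And>k. y k t = x (\<pi> k (Suc (i k)))"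
        proof -
          have "\<exists>i. i < N k \<and> \<pi> k i \<le> t \<and> t < \<pi> k (Suc i) \<and> y k t = x (\<pi> k (Suc i))" for k
            unfolding y_def by (rule step_partition_cases[OF part True, of k]) auto
          then show ?thesis using that by metis
        qed
        have "(\<lambda>k. x (\<pi> k (Suc (i k)))) \<longlonglongrightarrow> x t"
          using i in_T True by (intro cadlag_on_right_tendsto[OF x _ _ _ vanishing_partitions_tendsto(2)[OF part i]])
            (auto simp: less_imp_le Suc_le_eq)
        then have "(\<lambda>k. f' t * y k t) \<longlonglongrightarrow> f' t * x t" unfolding y by (intro tendsto_intros)
        then show ?thesis using True by simp
      next
        case False
        then have "t \<notin> {0..T}" using elim by auto
        then show ?thesis unfolding y_def step_outside[OF part False] by simp
      qed
    qed
    show "AE t in lborel. norm (f' t * y k t) \<le> indicator {0..T} t * (\<bar>B'\<bar> * \<bar>B\<bar>)" for k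
    proof (rule AE_I2)
      fix t :: real
      show "norm (f' t * y k t) \<le> indicator {0..T} t * (\<bar>B'\<bar> * \<bar>B\<bar>)"
      proof (cases "t \<in> {0..<T}")
        case True
        obtain i where i: "i < N k" "y k t = x (\<pi> k (Suc i))"
          unfolding y_def by (rule step_partition_cases[OF part True, of k]) blast
        have "\<bar>y k t\<bar> \<le> \<bar>B\<bar>" unfolding i(2) using B[OF in_T[of "Suc i" k]] i by auto
        moreover have "\<bar>f' t\<bar> \<le> \<bar>B'\<bar>" using B'[of t] True by auto
        ultimately have "\<bar>f' t\<bar> * \<bar>y k t\<bar> \<le> \<bar>B'\<bar> * \<bar>B\<bar>" by (intro mult_mono) auto
        then show ?thesis using True by (simp add: abs_mult)
      next
        case False
        then show ?thesis unfolding y_def step_outside[OF part False] by simp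
      qed
    qed
  qed
  then have "(\<lambda>k. f T * x T - f 0 * x 0 - (LINT t|lborel. f' t * y k t)) \<longlonglongrightarrow> parts_integral T f f' x"
    unfolding parts_integral_def set_lebesgue_integral_def by (intro tendsto_intros) simp
  moreover have "(\<Sum>i<N k. f (\<pi> k i) * (x (\<pi> k (Suc i)) - x (\<pi> k i))) =
      f T * x T - f 0 * x 0 - (LINT t|lborel. f' t * y k t)" for k
    unfolding sum_eq[symmetric] using summation_by_parts[of "\<lambda>i. f (\<pi> k i)" "\<lambda>i. x (\<pi> k i)" "N k"]
    by (simp only: \<pi>(1,2))
  ultimately show ?thesis by (simp only:)
qed

section \<open>The linear equation and its adjoint\<close>

lemma integrable_pair_mult:
  fixes f :: "'a \<Rightarrow> real" and g :: "'b \<Rightarrow> real"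
  assumes "sigma_finite_measure M" "sigma_finite_measure N" and f: "integrable M f" and g: "integrable N g"
  shows "integrable (M \<Otimes>\<^sub>M N) (\<lambda>(x, y). f x * g y)"
proof -
  interpret pair_sigma_finite M N using assms by (simp add: pair_sigma_finite_def)
  have [measurable]: "f \<in> borel_measurable M" "g \<in> borel_measurable N"
    using f g by auto
  show ?thesis
  proof (rule Fubini_integrable)
    show "integrable M (\<lambda>x. \<integral>y. norm (case (x, y) of (x, y) \<Rightarrow> f x * g y) \<partial>N)"
      using f by (simp add: abs_mult)
    show "AE x in M. integrable N (\<lambda>y. case (x, y) of (x, y) \<Rightarrow> f x * g y)"
      using g by simp
  qed measurable
qed

text \<open>
  Fubini on the triangle \<open>s \<le> t\<close>; the inner integral of \<open>g'\<close> over \<open>{s..T}\<close> is \<open>g T - g s\<close>.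
\<close>

lemma set_integral_running_integral_parts:
  assumes int: "set_integrable lborel {0..T} x" "set_integrable lborel {0..T} (\<lambda>s. g s * x s)"
    and g: "\<And>t. (g has_real_derivative g' t) (at t)" "continuous_on UNIV g'"
  shows "(LINT t:{0..T}|lborel. g' t * (LINT s:{0..t}|lborel. x s)) =
    g T * (LINT s:{0..T}|lborel. x s) - (LINT s:{0..T}|lborel. g s * x s)"
proof -
  have ig': "set_integrable lborel {0..T} g'"
    using g(2) by (intro borel_integrable_atLeastAtMost') (auto intro: continuous_on_subset)
  let ?F = "\<lambda>(t, s). indicator {(t, s). s \<le> t} (t, s) * ((indicator {0..T} t * g' t) * (indicator {0..T} s * x s)) :: real"
  have "integrable (lborel \<Otimes>\<^sub>M lborel) (\<lambda>p :: real \<times> real. indicator {(t, s). s \<le> t} p *\<^sub>R (case p of (t, s) \<Rightarrow> (indicator {0..T} t * g' t) * (indicator {0..T} s * x s)))"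
  proof (rule integrable_mult_indicator)
    show "integrable (lborel \<Otimes>\<^sub>M lborel) (\<lambda>p :: real \<times> real. (case p of (t, s) \<Rightarrow> (indicator {0..T} t * g' t) * (indicator {0..T} s * x s)))"
      using int(1) ig' by (intro integrable_pair_mult) (auto simp: set_integrable_def lborel.sigma_finite_measure_axioms)
    have "Measurable.pred (lborel \<Otimes>\<^sub>M lborel) (\<lambda>p :: real \<times> real. snd p \<le> fst p)"
      by measurable
    then show "{(t :: real, s :: real). s \<le> t} \<in> sets (lborel \<Otimes>\<^sub>M lborel)"
      by (simp add: pred_def space_pair_measure case_prod_unfold)
  qed
  then have F: "integrable (lborel \<Otimes>\<^sub>M lborel) ?F"
    by (simp add: case_prod_unfold)
  have "(LINT t:{0..T}|lborel. g' t * (LINT s:{0..t}|lborel. x s)) = (\<integral>t. (\<integral>s. ?F (t, s) \<partial>lborel) \<partial>lborel)"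
    unfolding set_lebesgue_integral_def
  proof (intro Bochner_Integration.integral_cong refl)
    fix t :: real
    have "indicator {0..T} t *\<^sub>R (g' t * (LBINT s. indicat_real {0..t} s *\<^sub>R x s)) = (LBINT s. indicator {0..T} t * g' t * (indicat_real {0..t} s *\<^sub>R x s))"
      by simp
    also have "\<dots> = (LBINT s. ?F (t, s))"
      by (intro Bochner_Integration.integral_cong refl) (auto simp: indicator_def)
    finally show "indicator {0..T} t *\<^sub>R (g' t * (LBINT s. indicat_real {0..t} s *\<^sub>R x s)) = (LBINT s. ?F (t, s))" .
  qed
  also have "\<dots> = (\<integral>s. (\<integral>t. ?F (t, s) \<partial>lborel) \<partial>lborel)"
    using lborel_pair.Fubini_integral[of "\<lambda>t s. ?F (t, s)"] F by simp
  also have "\<dots> = (\<integral>s. g T * (indicator {0..T} s *\<^sub>R x s) - indicator {0..T} s *\<^sub>R (g s * x s) \<partial>lborel)"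
  proof (intro Bochner_Integration.integral_cong refl)
    fix s :: real
    show "(\<integral>t. ?F (t, s) \<partial>lborel) = g T * (indicator {0..T} s *\<^sub>R x s) - indicator {0..T} s *\<^sub>R (g s * x s)"
    proof (cases "s \<in> {0..T}")
      case True
      then have "(\<integral>t. ?F (t, s) \<partial>lborel) = (\<integral>t. x s * (indicator {s..T} t *\<^sub>R g' t) \<partial>lborel)"
        by (intro Bochner_Integration.integral_cong refl) (auto simp: indicator_def)
      also have "\<dots> = x s * (g T - g s)"
        using set_integral_FTC[OF _ g, of s T] True by (simp add: set_lebesgue_integral_def)
      finally show ?thesis using True by (simp add: algebra_simps)
    qed simp
  qed
  also have "\<dots> = g T * (LINT s:{0..T}|lborel. x s) - (LINT s:{0..T}|lborel. g s * x s)"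
    using int by (simp add: set_lebesgue_integral_def set_integrable_def)
  finally show ?thesis .
qed

text \<open>
  In \<open>\<integral> f dx\<close> the drift contributes \<open>a \<integral> f x\<close>, which is again an integral of the path. The adjoint
  equation for \<open>g\<close> is made so that these contributions cancel: integrating the running integral of
  \<open>x\<close> by parts against \<open>g'\<close> returns \<open>\<integral> g x\<close>, and \<open>g' + a g = f'\<close>. The terminal condition removes
  the boundary term.
\<close>

lemma parts_integral_of_linear_equation:
  assumes x: "cadlag_on {0..T} x" and T: "0 \<le> T"
    and eq: "\<And>t. t \<in> {0..T} \<Longrightarrow> x t = a * (LINT s:{0..t}|lborel. x s) + u t"
    and g: "\<And>t. (g has_real_derivative g' t) (at t)" "continuous_on UNIV g'"
    and ode: "\<And>t. g' t = f' t - a * g t" and "g T = f T" and x0: "x 0 = 0"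
  shows "parts_integral T f f' x = parts_integral T g g' u"
proof -
  have sing: "(LINT s:{0..0}|lborel. x s) = 0"
    using set_borel_integral_eq_integral(2)[OF cadlag_on_set_integrable[OF cadlag_on_subset[OF x, of "{0..0}"]]] T by simp
  have u0: "u 0 = 0" using eq[of 0] T x0 sing by simp
  have cont_g: "continuous_on {0..T} g"
    using g(1) by (auto intro!: continuous_at_imp_continuous_on DERIV_isCont)
  define Y where "Y t = (LINT s:{0..t}|lborel. x s)" for t
  have intx: "set_integrable lborel {0..T} (\<lambda>t. h t * x t)" if "continuous_on {0..T} h" for h
    by (intro cadlag_on_set_integrable cadlag_on_continuous_mult x that)
  have Y: "Y t = integral {0..t} x" if "t \<in> {0..T}" for t
    unfolding Y_def using that
    by (intro set_borel_integral_eq_integral set_integrable_subset[OF cadlag_on_set_integrable[OF x]]) auto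
  have "continuous_on {0..T} (\<lambda>t. integral {0..t} x)"
    using cadlag_on_set_integrable[OF x] by (intro indefinite_integral_continuous_1 set_borel_integral_eq_integral)
  then have "continuous_on {0..T} Y" by (subst continuous_on_cong[OF refl Y]) auto
  then have intY: "set_integrable lborel {0..T} (\<lambda>t. g' t * Y t)"
    using g(2) by (intro borel_integrable_atLeastAtMost' continuous_intros) (auto intro: continuous_on_subset)
  have "(LINT t:{0..T}|lborel. g' t * u t) = (LINT t:{0..T}|lborel. g' t * x t - a * (g' t * Y t))"
    using eq by (intro set_lebesgue_integral_cong) (auto simp: Y_def algebra_simps)
  also have "\<dots> = (LINT t:{0..T}|lborel. g' t * x t) - a * (LINT t:{0..T}|lborel. g' t * Y t)"
    using intx[of g'] intY g(2) by (subst set_integral_diff) (auto intro: continuous_on_subset)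
  also have "(LINT t:{0..T}|lborel. g' t * Y t) = g T * Y T - (LINT s:{0..T}|lborel. g s * x s)"
    unfolding Y_def by (rule set_integral_running_integral_parts[OF cadlag_on_set_integrable[OF x] intx[OF cont_g] g])
  finally have *: "(LINT t:{0..T}|lborel. g' t * u t) =
    (LINT t:{0..T}|lborel. g' t * x t) - a * (g T * Y T - (LINT s:{0..T}|lborel. g s * x s))" .
  have "(LINT t:{0..T}|lborel. f' t * x t) = (LINT t:{0..T}|lborel. g' t * x t + a * (g t * x t))"
    by (intro set_lebesgue_integral_cong) (auto simp: ode algebra_simps)
  also have "\<dots> = (LINT t:{0..T}|lborel. g' t * x t) + a * (LINT t:{0..T}|lborel. g t * x t)"
    using intx[of g'] intx[OF cont_g] g(2) by (subst set_integral_add) (auto intro: continuous_on_subset)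
  finally have "(LINT t:{0..T}|lborel. f' t * x t) = (LINT t:{0..T}|lborel. g' t * x t) + a * (LINT t:{0..T}|lborel. g t * x t)" .
  then show ?thesis
    using eq[of T] T unfolding parts_integral_def * x0 u0 \<open>g T = f T\<close>[symmetric] by (simp add: Y_def algebra_simps)
qed

section \<open>Response of the adjoint equation to the trigonometric basis\<close>

text \<open>
  All square and product terms have elementary antiderivatives. Periodicity kills the oscillating
  boundary terms, and with the exponential normalized to 1 at \<open>T\<close> only \<open>q = exp (- b T)\<close> survives.
\<close>

lemma integral_square_trig_exp:
  fixes b \<omega> T \<alpha> \<beta> \<gamma> :: real
  defines "D \<equiv> b\<^sup>2 + \<omega>\<^sup>2" and "q \<equiv> exp (- b * T)"
  assumes \<omega>: "\<omega> \<noteq> 0" and T: "0 \<le> T" and per: "cos (\<omega> * T) = 1" "sin (\<omega> * T) = 0"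
  shows "(LINT s:{0..T}|lborel. (\<alpha> * cos (\<omega> * s) + \<beta> * sin (\<omega> * s) + b * \<gamma> * exp (b * (s - T)))\<^sup>2) =
    (\<alpha>\<^sup>2 + \<beta>\<^sup>2) * T / 2 + b * \<gamma>\<^sup>2 * (1 - q\<^sup>2) / 2 + 2 * b * \<gamma> * (\<alpha> * b - \<beta> * \<omega>) * (1 - q) / D"
proof -
  have D: "D \<noteq> 0" using \<omega> by (simp add: D_def sum_power2_eq_zero_iff)
  \<comment> \<open>the divisions become constant factors, so that differentiation produces no quotients\<close>
  define p where "p = 1 / (2 * \<omega>)"
  define e where "e = 1 / D"
  have p: "\<omega> * p = 1 / 2" and e: "e * (b\<^sup>2 + \<omega>\<^sup>2) = 1"
    using \<omega> D by (simp_all add: p_def e_def D_def)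
  define G where "G s = \<alpha>\<^sup>2 * (s * (1/2) + p * (sin (\<omega> * s) * cos (\<omega> * s)))
      + \<beta>\<^sup>2 * (s * (1/2) - p * (sin (\<omega> * s) * cos (\<omega> * s)))
      + 2 * \<alpha> * \<beta> * p * (sin (\<omega> * s))\<^sup>2
      + b * \<gamma>\<^sup>2 * (1/2) * (exp (b * (s - T)))\<^sup>2
      + 2 * b * \<gamma> * e * (exp (b * (s - T)) *
        (\<alpha> * (b * cos (\<omega> * s) + \<omega> * sin (\<omega> * s)) + \<beta> * (b * sin (\<omega> * s) - \<omega> * cos (\<omega> * s))))" for s
  have "(G has_real_derivative (\<alpha> * cos (\<omega> * s) + \<beta> * sin (\<omega> * s) + b * \<gamma> * exp (b * (s - T)))\<^sup>2) (at s)" for s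
  proof -
    define C S E where "C = cos (\<omega> * s)" and "S = sin (\<omega> * s)" and "E = exp (b * (s - T))"
    have SC: "S\<^sup>2 + C\<^sup>2 = 1" by (simp add: C_def S_def)
    have "(G has_real_derivative
        \<alpha>\<^sup>2 * (1/2 + \<omega> * p * (C\<^sup>2 - S\<^sup>2)) + \<beta>\<^sup>2 * (1/2 - \<omega> * p * (C\<^sup>2 - S\<^sup>2))
      + 2 * \<alpha> * \<beta> * (\<omega> * p) * (2 * S * C) + (b * \<gamma> * E)\<^sup>2
      + 2 * b * \<gamma> * E * (e * (b\<^sup>2 + \<omega>\<^sup>2)) * (\<alpha> * C + \<beta> * S)) (at s)"
      unfolding G_def C_def S_def E_def
      by (auto intro!: derivative_eq_intros simp: algebra_simps power2_eq_square)
    also have "\<alpha>\<^sup>2 * (1/2 + \<omega> * p * (C\<^sup>2 - S\<^sup>2)) + \<beta>\<^sup>2 * (1/2 - \<omega> * p * (C\<^sup>2 - S\<^sup>2)) = \<alpha>\<^sup>2 * C\<^sup>2 + \<beta>\<^sup>2 * S\<^sup>2"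
    proof -
      have "1/2 + 1/2 * (C\<^sup>2 - S\<^sup>2) = C\<^sup>2" "1/2 - 1/2 * (C\<^sup>2 - S\<^sup>2) = S\<^sup>2"
        using SC by argo+
      then show ?thesis unfolding p by (simp only:)
    qed
    finally show ?thesis
      unfolding p e C_def[symmetric] S_def[symmetric] E_def[symmetric]
      by (simp add: power2_eq_square algebra_simps)
  qed
  note FTC = set_integral_FTC[OF T this]
  have "(LINT s:{0..T}|lborel. (\<alpha> * cos (\<omega> * s) + \<beta> * sin (\<omega> * s) + b * \<gamma> * exp (b * (s - T)))\<^sup>2) = G T - G 0"
    by (rule FTC) (intro continuous_intros)
  also have "\<dots> = (\<alpha>\<^sup>2 + \<beta>\<^sup>2) * T / 2 + b * \<gamma>\<^sup>2 * (1 - q\<^sup>2) / 2 + 2 * b * \<gamma> * (\<alpha> * b - \<beta> * \<omega>) * (1 - q) * e"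
  proof -
    have "exp (b * (0 - T)) = q" by (simp add: q_def)
    then show ?thesis
      unfolding G_def per by (simp add: algebra_simps add_divide_distrib diff_divide_distrib)
  qed
  finally show ?thesis by (simp add: e_def)
qed

text \<open>
  The solution of the adjoint equation for \<open>f = p cos + r sin\<close>. Undetermined coefficients give a
  sinusoid whose square amplitude is smaller than that of \<open>f\<close> by the factor \<open>\<omega>\<^sup>2 / (b\<^sup>2 + \<omega>\<^sup>2)\<close>; the
  exponential restores the terminal value. The loss of amplitude costs \<open>b\<^sup>2 / (b\<^sup>2 + \<omega>\<^sup>2)\<close> in the mean
  square, and the terms with the exponential cost \<open>5 b / (b\<^sup>2 + \<omega>\<^sup>2)\<close> over the whole interval, which is
  why \<open>T \<ge> 1\<close> enters.
\<close>

lemma response_sinusoid: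
  fixes b \<omega> T p r :: real
  assumes b: "0 \<le> b" and \<omega>: "0 < \<omega>" and T: "1 \<le> T" and per: "cos (\<omega> * T) = 1" "sin (\<omega> * T) = 0"
    and pr: "p\<^sup>2 + r\<^sup>2 = 2"
  obtains g g' where
    "\<And>t. (g has_real_derivative g' t) (at t)" "continuous_on UNIV g'"
    "\<And>t. g' t = \<omega> * (r * cos (\<omega> * t) - p * sin (\<omega> * t)) + b * g t" "g T = p"
    "\<bar>(LINT s:{0..T}|lborel. (g s)\<^sup>2) / T - 1\<bar> \<le> (b\<^sup>2 + 5 * b) / \<omega>\<^sup>2"
proof
  define D where "D = b\<^sup>2 + \<omega>\<^sup>2"
  define \<gamma> where "\<gamma> = (b * p + \<omega> * r) / D"
  define \<alpha> where "\<alpha> = \<omega> * (\<omega> * p - b * r) / D"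
  have D: "0 < D" "\<omega>\<^sup>2 \<le> D" using \<omega> by (auto simp: D_def add_nonneg_pos)
  have \<gamma>D: "\<gamma> * D = b * p + \<omega> * r" and \<alpha>D: "\<alpha> * D = \<omega> * (\<omega> * p - b * r)"
    using D by (simp_all add: \<gamma>_def \<alpha>_def)
  have p: "\<alpha> + b * \<gamma> = p"
  proof -
    have "(\<alpha> + b * \<gamma>) * D = \<alpha> * D + b * (\<gamma> * D)" by (simp add: algebra_simps)
    also have "\<dots> = p * D" unfolding \<gamma>D \<alpha>D by (simp add: D_def power2_eq_square algebra_simps)
    finally show ?thesis using D by simp
  qed
  have r: "\<alpha> * b - \<omega> * \<gamma> * \<omega> = - (\<omega> * r)"
  proof -
    have "(\<alpha> * b - \<omega> * \<gamma> * \<omega>) * D = (\<alpha> * D) * b - \<omega> * (\<gamma> * D) * \<omega>" by (simp add: algebra_simps)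
    also have "\<dots> = - (\<omega> * r) * D" unfolding \<gamma>D \<alpha>D by (simp add: D_def power2_eq_square algebra_simps)
    finally show ?thesis using D(1) by (metis less_irrefl mult_right_cancel)
  qed
  have amp: "\<alpha>\<^sup>2 + (\<omega> * \<gamma>)\<^sup>2 = 2 * (1 - b\<^sup>2 / D)"
  proof -
    have "(\<alpha>\<^sup>2 + (\<omega> * \<gamma>)\<^sup>2) * D\<^sup>2 = (\<alpha> * D)\<^sup>2 + (\<omega> * (\<gamma> * D))\<^sup>2"
      by (simp add: power_mult_distrib algebra_simps)
    also have "\<dots> = \<omega>\<^sup>2 * (p\<^sup>2 + r\<^sup>2) * D"
      unfolding \<gamma>D \<alpha>D by (simp add: D_def power2_eq_square algebra_simps)
    also have "\<dots> = 2 * (1 - b\<^sup>2 / D) * D\<^sup>2"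
    proof -
      have "(1 - b\<^sup>2 / D) * D = \<omega>\<^sup>2" using D by (simp add: left_diff_distrib) (simp add: D_def)
      moreover have "2 * (1 - b\<^sup>2 / D) * D\<^sup>2 = 2 * ((1 - b\<^sup>2 / D) * D) * D"
        by (simp only: power2_eq_square mult.assoc)
      ultimately show ?thesis unfolding pr by (simp only: mult.commute mult.left_commute)
    qed
    finally show ?thesis using D by simp
  qed
  have \<gamma>: "\<gamma>\<^sup>2 \<le> 2 / D"
  proof -
    have "(\<gamma> * D)\<^sup>2 + (\<omega> * p - b * r)\<^sup>2 = (p\<^sup>2 + r\<^sup>2) * D"
      unfolding \<gamma>D by (simp add: D_def power2_eq_square algebra_simps)
    then have "\<gamma>\<^sup>2 * D\<^sup>2 \<le> 2 * D"
      unfolding pr power_mult_distrib by (smt (verit) zero_le_power2)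
    then show ?thesis using D by (simp add: power2_eq_square field_simps)
  qed
  define g where "g s = \<alpha> * cos (\<omega> * s) + \<omega> * \<gamma> * sin (\<omega> * s) + b * \<gamma> * exp (b * (s - T))" for s
  show "(g has_real_derivative \<omega> * (r * cos (\<omega> * t) - p * sin (\<omega> * t)) + b * g t) (at t)" for t
  proof -
    have "(g has_real_derivative - (\<alpha> * \<omega>) * sin (\<omega> * t) + (\<omega> * \<gamma> * \<omega>) * cos (\<omega> * t) + b * \<gamma> * b * exp (b * (t - T))) (at t)"
      unfolding g_def by (auto intro!: derivative_eq_intros simp: mult_ac)
    also have "\<omega> * \<gamma> * \<omega> = \<alpha> * b + \<omega> * r" using r by simp
    also have "- (\<alpha> * \<omega>) * sin (\<omega> * t) + (\<alpha> * b + \<omega> * r) * cos (\<omega> * t) + b * \<gamma> * b * exp (b * (t - T))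
        = \<omega> * (r * cos (\<omega> * t) - p * sin (\<omega> * t)) + b * g t"
      by (simp add: g_def p[symmetric] algebra_simps)
    finally show ?thesis .
  qed
  show "continuous_on UNIV (\<lambda>t. \<omega> * (r * cos (\<omega> * t) - p * sin (\<omega> * t)) + b * g t)"
    unfolding g_def by (intro continuous_intros)
  show "g T = p" using p by (simp add: g_def per)
  define q where "q = exp (- b * T)"
  have q: "0 \<le> q" "q \<le> 1" "0 \<le> q\<^sup>2" "q\<^sup>2 \<le> 1" using b T by (auto simp: q_def power_le_one)
  \<comment> \<open>the square of the exponential, and its product with the sinusoid\<close>
  define X where "X = b * (\<gamma>\<^sup>2 * (1 - q\<^sup>2) / 2)"
  define Y where "Y = 2 * (b / D) * ((\<gamma> * (\<omega> * r)) * (1 - q))"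
  have "(LINT s:{0..T}|lborel. (g s)\<^sup>2) = (\<alpha>\<^sup>2 + (\<omega> * \<gamma>)\<^sup>2) * T / 2
      + b * \<gamma>\<^sup>2 * (1 - q\<^sup>2) / 2 + 2 * b * \<gamma> * (\<alpha> * b - \<omega> * \<gamma> * \<omega>) * (1 - q) / D"
    unfolding g_def q_def D_def using \<omega> T per by (intro integral_square_trig_exp) auto
  also have "\<dots> = T * (1 - b\<^sup>2 / D) + X - Y"
    unfolding amp r X_def Y_def by (simp add: algebra_simps diff_divide_distrib)
  finally have "(LINT s:{0..T}|lborel. (g s)\<^sup>2) = T * (1 - b\<^sup>2 / D) + X - Y" .
  then have "(LINT s:{0..T}|lborel. (g s)\<^sup>2) / T - 1 = - (b\<^sup>2 / D) + X / T - Y / T"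
    using T by (simp add: add_divide_distrib diff_divide_distrib)
  also have "\<bar>\<dots>\<bar> \<le> b\<^sup>2 / D + 5 * (b / D)"
  proof -
    have "\<gamma>\<^sup>2 * (1 - q\<^sup>2) / 2 \<le> 1 / D"
      using mult_mono[OF \<gamma>, of "1 - q\<^sup>2" 1] q D by simp
    then have "X \<le> b * (1 / D)" unfolding X_def using b by (rule mult_left_mono)
    moreover have "0 \<le> X" unfolding X_def using b q by simp
    ultimately have X: "\<bar>X\<bar> \<le> b / D" by simp
    have "(\<gamma> * (\<omega> * r))\<^sup>2 \<le> 2 / D * (\<omega>\<^sup>2 * 2)"
    proof -
      have "r\<^sup>2 \<le> 2" unfolding pr[symmetric] by simp
      then show ?thesis
        unfolding power_mult_distrib using D by (intro mult_mono \<gamma> mult_left_mono) auto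
    qed
    also have "\<dots> \<le> 2\<^sup>2" using D by (simp add: divide_le_eq)
    finally have "\<bar>\<gamma> * (\<omega> * r)\<bar> \<le> 2" by (metis abs_le_square_iff abs_numeral)
    then have "\<bar>\<gamma> * (\<omega> * r)\<bar> * \<bar>1 - q\<bar> \<le> 2 * 1" using q by (intro mult_mono) auto
    then have "2 * (b / D) * (\<bar>\<gamma> * (\<omega> * r)\<bar> * \<bar>1 - q\<bar>) \<le> 2 * (b / D) * (2 * 1)"
      using b D by (intro mult_left_mono) auto
    moreover have "\<bar>Y\<bar> = 2 * (b / D) * (\<bar>\<gamma> * (\<omega> * r)\<bar> * \<bar>1 - q\<bar>)"
      unfolding Y_def using b D by (simp add: abs_mult)
    ultimately have Y: "\<bar>Y\<bar> \<le> 4 * (b / D)" by simp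
    have div: "\<bar>x / T\<bar> \<le> y" if "\<bar>x\<bar> \<le> y" for x y
    proof -
      have "0 \<le> y" using that by linarith
      then show ?thesis using that T mult_left_mono[of 1 T y] by (simp add: divide_le_eq)
    qed
    have tri: "\<bar>- u + x - y\<bar> \<le> u + 5 * w" if "0 \<le> u" "\<bar>x\<bar> \<le> w" "\<bar>y\<bar> \<le> 4 * w" for u x y w :: real
      using that by linarith
    show ?thesis using D by (intro tri div X Y) auto
  qed
  also have "\<dots> = (b\<^sup>2 + 5 * b) / D" by (simp add: add_divide_distrib)
  also have "\<dots> \<le> (b\<^sup>2 + 5 * b) / \<omega>\<^sup>2" using b D \<omega> by (intro divide_left_mono) auto
  finally show "\<bar>(LINT s:{0..T}|lborel. (g s)\<^sup>2) / T - 1\<bar> \<le> (b\<^sup>2 + 5 * b) / \<omega>\<^sup>2" .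
qed simp

text \<open>
  Integer \<open>n\<close> is a multiple of the period, so \<open>response_sinusoid\<close> applies for \<open>j \<ge> 2\<close>. For \<open>j = 1\<close> the
  solution is the bare exponential, whose mean square lies between 0 and 1.
\<close>

lemma response_Tr:
  fixes b :: real and n j :: nat
  assumes b: "0 \<le> b" and n: "1 \<le> n" and j: "1 \<le> j"
  obtains f' g g' where
    "\<And>t. (Tr j has_real_derivative f' t) (at t)" "continuous_on UNIV f'"
    "\<And>t. (g has_real_derivative g' t) (at t)" "continuous_on UNIV g'"
    "\<And>t. g' t = f' t + b * g t" "g (real n) = Tr j (real n)"
    "\<bar>(LINT s:{0..real n}|lborel. (g s)\<^sup>2) / real n - 1\<bar> \<le> (if j = 1 then 1 else (b\<^sup>2 + 5 * b) / (real j)\<^sup>2)"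
proof (cases "j = 1")
  case True
  let ?g = "\<lambda>s. exp (b * (s - real n))"
  have Tr: "Tr j = (\<lambda>_. 1)" using True by (auto simp: Tr_def)
  have "\<bar>(LINT s:{0..real n}|lborel. (?g s)\<^sup>2) / real n - 1\<bar> \<le> 1"
  proof -
    have "(LINT s:{0..real n}|lborel. (?g s)\<^sup>2) \<le> (LINT s:{0..real n}|lborel. 1)"
      using b by (intro set_integral_mono borel_integrable_atLeastAtMost' continuous_intros)
        (auto simp: power_le_one_iff mult_nonneg_nonpos)
    also have "\<dots> = real n" by (simp add: set_lebesgue_integral_def)
    finally have "(LINT s:{0..real n}|lborel. (?g s)\<^sup>2) / real n \<le> 1" using n by simp
    moreover have "0 \<le> (LINT s:{0..real n}|lborel. (?g s)\<^sup>2) / real n"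
      by (intro divide_nonneg_nonneg Bochner_Integration.integral_nonneg) (auto simp: set_lebesgue_integral_def)
    ultimately show ?thesis by linarith
  qed
  then show ?thesis
    by (intro that[of "\<lambda>_. 0" ?g "\<lambda>s. b * ?g s"])
      (auto simp: True Tr[unfolded True One_nat_def] intro!: derivative_eq_intros continuous_intros)
next
  case False
  define \<omega> where "\<omega> = 2 * pi * real (j div 2)"
  \<comment> \<open>already \<open>j / 3 \<le> j div 2\<close> and \<open>3 \<le> 2 * pi\<close> give a frequency of at least \<open>j\<close>\<close>
  have j2: "1 \<le> j div 2" "j \<le> 3 * (j div 2)" using False j by linarith+
  have "1 * real j \<le> 2 * pi * real (j div 2)"
  proof -
    have "real j \<le> 3 * real (j div 2)" using j2(2) by (metis of_nat_le_iff of_nat_mult of_nat_numeral)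
    also have "\<dots> \<le> 2 * pi * real (j div 2)" using pi_gt3 by (intro mult_right_mono) auto
    finally show ?thesis by simp
  qed
  then have \<omega>j: "real j \<le> \<omega>" by (simp add: \<omega>_def)
  then have \<omega>: "0 < \<omega>" using j by linarith
  have arg: "\<omega> * real n = 2 * pi * of_int (int (j div 2 * n))" by (simp add: \<omega>_def)
  have per: "cos (\<omega> * real n) = 1" "sin (\<omega> * real n) = 0"
    unfolding arg by (rule cos_int_2pin, rule sin_int_2pin)
  have bound: "(b\<^sup>2 + 5 * b) / \<omega>\<^sup>2 \<le> (b\<^sup>2 + 5 * b) / (real j)\<^sup>2"
    using b \<omega>j \<omega> j by (intro divide_left_mono power_mono mult_pos_pos) auto
  have n': "1 \<le> real n" using n by simp
  define p r where "p = (if even j then sqrt 2 else 0)" and "r = (if even j then 0 else sqrt 2)"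
  have Tr: "Tr j = (\<lambda>x. p * cos (\<omega> * x) + r * sin (\<omega> * x))"
    using False by (auto simp: Tr_def \<omega>_def p_def r_def)
  have pr: "p\<^sup>2 + r\<^sup>2 = 2" by (simp add: p_def r_def)
  obtain g g' where g: "\<And>t. (g has_real_derivative g' t) (at t)" "continuous_on UNIV g'"
    "\<And>t. g' t = \<omega> * (r * cos (\<omega> * t) - p * sin (\<omega> * t)) + b * g t" "g (real n) = p"
    "\<bar>(LINT s:{0..real n}|lborel. (g s)\<^sup>2) / real n - 1\<bar> \<le> (b\<^sup>2 + 5 * b) / \<omega>\<^sup>2"
    using response_sinusoid[OF b \<omega> n' per pr] by blast
  show ?thesis
  proof (rule that)
    show "(Tr j has_real_derivative \<omega> * (r * cos (\<omega> * t) - p * sin (\<omega> * t))) (at t)" for t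
      unfolding Tr by (auto intro!: derivative_eq_intros simp: algebra_simps)
    show "continuous_on UNIV (\<lambda>t. \<omega> * (r * cos (\<omega> * t) - p * sin (\<omega> * t)))" by (intro continuous_intros)
    show "g (real n) = Tr j (real n)" by (simp add: Tr per g(4))
    show "\<bar>(LINT s:{0..real n}|lborel. (g s)\<^sup>2) / real n - 1\<bar> \<le> (if j = 1 then 1 else (b\<^sup>2 + 5 * b) / (real j)\<^sup>2)"
      using g(5) bound False by simp
  qed (fact g)+
qed

text \<open>
  Telescoping with \<open>1 / j\<^sup>2 \<le> 1 / (j - 1) - 1 / j\<close>.
\<close>

lemma sum_inverse_squares_le:
  "(\<Sum>j=2..n. 1 / (real j)\<^sup>2) \<le> 1"
proof (cases "n \<ge> 1")
  case True
  then have "(\<Sum>j=2..n. 1 / (real j)\<^sup>2) \<le> 1 - 1 / real n"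
  proof (induction n rule: dec_induct)
    case (step n)
    have "1 / (real (Suc n))\<^sup>2 \<le> 1 / real n - 1 / real (Suc n)"
    proof -
      have "1 / (real (Suc n))\<^sup>2 \<le> 1 / (real n * real (Suc n))"
        using step unfolding power2_eq_square by (intro divide_left_mono mult_right_mono) auto
      also have "\<dots> = 1 / real n - 1 / real (Suc n)"
        using step by (simp add: field_simps)
      finally show ?thesis .
    qed
    then show ?case using step by simp
  qed simp
  also have "\<dots> \<le> 1" by simp
  finally show ?thesis .
qed simp

section \<open>Square-integrable random variables\<close>

lemma abs_mult_le_squares: "\<bar>x * y\<bar> \<le> x\<^sup>2 + (y::real)\<^sup>2"
proof -
  have "0 \<le> (\<bar>x\<bar> - \<bar>y\<bar>)\<^sup>2" by simp
  then have "2 * (\<bar>x\<bar> * \<bar>y\<bar>) \<le> x\<^sup>2 + y\<^sup>2" by (simp add: power2_diff)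
  moreover have "0 \<le> \<bar>x\<bar> * \<bar>y\<bar>" by simp
  ultimately show ?thesis unfolding abs_mult by linarith
qed

lemma integrable_mult_of_squares:
  fixes X Y :: "'a \<Rightarrow> real"
  assumes "X \<in> borel_measurable M" "Y \<in> borel_measurable M"
    and "integrable M (\<lambda>x. (X x)\<^sup>2)" "integrable M (\<lambda>x. (Y x)\<^sup>2)"
  shows "integrable M (\<lambda>x. X x * Y x)"
proof (rule Bochner_Integration.integrable_bound[OF Bochner_Integration.integrable_add[OF assms(3,4)]])
  show "(\<lambda>x. X x * Y x) \<in> borel_measurable M" using assms by simp
  show "AE x in M. norm (X x * Y x) \<le> norm ((X x)\<^sup>2 + (Y x)\<^sup>2)"
  proof (rule AE_I2)
    fix x show "norm (X x * Y x) \<le> norm ((X x)\<^sup>2 + (Y x)\<^sup>2)"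
      using abs_mult_le_squares[of "X x" "Y x"] by simp
  qed
qed

lemma integrable_square_add:
  fixes X Y :: "'a \<Rightarrow> real"
  assumes "X \<in> borel_measurable M" "Y \<in> borel_measurable M"
    and "integrable M (\<lambda>x. (X x)\<^sup>2)" "integrable M (\<lambda>x. (Y x)\<^sup>2)"
  shows "integrable M (\<lambda>x. (X x + Y x)\<^sup>2)"
proof -
  have "integrable M (\<lambda>x. (X x)\<^sup>2 + (Y x)\<^sup>2 + 2 * (X x * Y x))"
    using assms integrable_mult_of_squares[OF assms] by auto
  then show ?thesis by (simp add: power2_sum mult.assoc)
qed

lemma integral_Cauchy_Schwarz:
  fixes X Y :: "'a \<Rightarrow> real"
  assumes "X \<in> borel_measurable M" "Y \<in> borel_measurable M"
    and "integrable M (\<lambda>x. (X x)\<^sup>2)" "integrable M (\<lambda>x. (Y x)\<^sup>2)"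
  shows "\<bar>\<integral>x. X x * Y x \<partial>M\<bar> \<le> sqrt (\<integral>x. (X x)\<^sup>2 \<partial>M) * sqrt (\<integral>x. (Y x)\<^sup>2 \<partial>M)"
proof -
  define a b c where "a = (\<integral>x. (X x)\<^sup>2 \<partial>M)" and "b = (\<integral>x. (Y x)\<^sup>2 \<partial>M)" and "c = (\<integral>x. X x * Y x \<partial>M)"
  have quad: "0 \<le> a + 2 * r * c + r\<^sup>2 * b" for r
  proof -
    have "0 \<le> (\<integral>x. (X x + r * Y x)\<^sup>2 \<partial>M)" by (intro Bochner_Integration.integral_nonneg) auto
    also have "\<dots> = (\<integral>x. (X x)\<^sup>2 + 2 * r * (X x * Y x) + r\<^sup>2 * (Y x)\<^sup>2 \<partial>M)"
      by (intro Bochner_Integration.integral_cong) (auto simp: power2_eq_square algebra_simps)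
    also have "\<dots> = a + 2 * r * c + r\<^sup>2 * b"
      using assms integrable_mult_of_squares[OF assms] by (simp add: a_def b_def c_def)
    finally show ?thesis .
  qed
  have b: "0 \<le> b" unfolding b_def by (intro Bochner_Integration.integral_nonneg) auto
  have a: "0 \<le> a" unfolding a_def by (intro Bochner_Integration.integral_nonneg) auto
  have "c\<^sup>2 \<le> a * b"
  proof (cases "b = 0")
    case True
    have "c = 0"
    proof (rule ccontr)
      assume "c \<noteq> 0"
      then show False using quad[of "- (a + 1) / (2 * c)"] True by (simp add: field_simps)
    qed
    then show ?thesis using True by simp
  next
    case False
    then have b: "0 < b" using b by simp
    have "0 \<le> b * (a + 2 * (- c / b) * c + (- c / b)\<^sup>2 * b)"
      using quad[of "- c / b"] b by simp
    also have "\<dots> = a * b - c\<^sup>2" using b by (simp add: power2_eq_square field_simps)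
    finally show ?thesis by simp
  qed
  then have "sqrt (c\<^sup>2) \<le> sqrt (a * b)" by (rule real_sqrt_le_mono)
  then show ?thesis by (simp add: real_sqrt_mult a_def b_def c_def)
qed

text \<open>
  Mean square convergence of square-integrable functions. The limit is only required to be measurable,
  since its square-integrability follows.
\<close>

definition L2_tendsto :: "'a measure \<Rightarrow> (nat \<Rightarrow> 'a \<Rightarrow> real) \<Rightarrow> ('a \<Rightarrow> real) \<Rightarrow> bool" where
  "L2_tendsto M X L \<longleftrightarrow> L \<in> borel_measurable M \<and> (\<forall>k. X k \<in> borel_measurable M \<and> integrable M (\<lambda>x. (X k x)\<^sup>2)) \<and>
     (\<lambda>k. \<integral>\<^sup>+x. ennreal ((L x - X k x)\<^sup>2) \<partial>M) \<longlonglongrightarrow> 0"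

lemma L2_tendsto_square_integrable:
  assumes "L2_tendsto M X L"
  shows "integrable M (\<lambda>x. (L x)\<^sup>2)"
    and "\<forall>\<^sub>F k in sequentially. integrable M (\<lambda>x. (X k x - L x)\<^sup>2)"
    and "(\<lambda>k. \<integral>x. (X k x - L x)\<^sup>2 \<partial>M) \<longlonglongrightarrow> 0"
proof -
  have [measurable]: "L \<in> borel_measurable M" "\<And>k. X k \<in> borel_measurable M"
    and sq: "\<And>k. integrable M (\<lambda>x. (X k x)\<^sup>2)"
    and lim: "(\<lambda>k. \<integral>\<^sup>+x. ennreal ((X k x - L x)\<^sup>2) \<partial>M) \<longlonglongrightarrow> 0"
    using assms by (auto simp: L2_tendsto_def power2_commute)
  have "\<forall>\<^sub>F k in sequentially. (\<integral>\<^sup>+x. ennreal ((X k x - L x)\<^sup>2) \<partial>M) < 1"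
    using lim by (rule order_tendstoD) simp
  then show ev: "\<forall>\<^sub>F k in sequentially. integrable M (\<lambda>x. (X k x - L x)\<^sup>2)"
    by eventually_elim (auto intro!: integrableI_bounded simp: less_top[symmetric] elim: order.strict_trans)
  then obtain k where k: "integrable M (\<lambda>x. (X k x - L x)\<^sup>2)" by (auto simp: eventually_sequentially)
  then have "integrable M (\<lambda>x. (X k x + (L x - X k x))\<^sup>2)"
    using sq by (intro integrable_square_add) (auto simp: power2_commute)
  then show "integrable M (\<lambda>x. (L x)\<^sup>2)" by simp
  have "(\<integral>x. (X k x - L x)\<^sup>2 \<partial>M) = enn2real (\<integral>\<^sup>+x. ennreal ((X k x - L x)\<^sup>2) \<partial>M)" for k
    by (intro integral_eq_nn_integral) auto
  then show "(\<lambda>k. \<integral>x. (X k x - L x)\<^sup>2 \<partial>M) \<longlonglongrightarrow> 0"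
    using tendsto_enn2real[of _ 0] lim by simp
qed

text \<open>
  With \<open>X k Y k - L K = (X k - L) (Y k - K) + (X k - L) K + L (Y k - K)\<close>, each term is controlled by
  the Cauchy--Schwarz inequality.
\<close>

lemma L2_tendsto_integral_mult:
  assumes X: "L2_tendsto M X L" and Y: "L2_tendsto M Y K"
  shows "(\<lambda>k. \<integral>x. X k x * Y k x \<partial>M) \<longlonglongrightarrow> (\<integral>x. L x * K x \<partial>M)"
proof -
  have [measurable]: "L \<in> borel_measurable M" "\<And>k. X k \<in> borel_measurable M" "K \<in> borel_measurable M" "\<And>k. Y k \<in> borel_measurable M"
    using X Y by (auto simp: L2_tendsto_def)
  note sqL = L2_tendsto_square_integrable[OF X] and sqK = L2_tendsto_square_integrable[OF Y]
  define a where "a k = sqrt (\<integral>x. (X k x - L x)\<^sup>2 \<partial>M)" for k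
  define b where "b k = sqrt (\<integral>x. (Y k x - K x)\<^sup>2 \<partial>M)" for k
  define l where "l = sqrt (\<integral>x. (L x)\<^sup>2 \<partial>M)"
  define m where "m = sqrt (\<integral>x. (K x)\<^sup>2 \<partial>M)"
  have lim: "a \<longlonglongrightarrow> 0" "b \<longlonglongrightarrow> 0"
    unfolding a_def b_def using tendsto_real_sqrt[OF sqL(3)] tendsto_real_sqrt[OF sqK(3)] by simp_all
  have "(\<lambda>k. a k * b k + a k * m + l * b k) \<longlonglongrightarrow> 0 * 0 + 0 * m + l * 0"
    by (intro tendsto_intros lim)
  then have lim': "(\<lambda>k. a k * b k + a k * m + l * b k) \<longlonglongrightarrow> 0" by simp
  have "\<forall>\<^sub>F k in sequentially. norm ((\<integral>x. X k x * Y k x \<partial>M) - (\<integral>x. L x * K x \<partial>M)) \<le> a k * b k + a k * m + l * b k"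
    using sqL(2) sqK(2)
  proof eventually_elim
    case (elim k)
    note int = integrable_mult_of_squares[OF _ _ elim(1) elim(2)] integrable_mult_of_squares[OF _ _ elim(1) sqK(1)]
      integrable_mult_of_squares[OF _ _ sqL(1) elim(2)] integrable_mult_of_squares[OF _ _ sqL(1) sqK(1)]
    have "(\<integral>x. X k x * Y k x \<partial>M) = (\<integral>x. ((X k x - L x) * (Y k x - K x) + (X k x - L x) * K x + L x * (Y k x - K x)) + L x * K x \<partial>M)"
      by (intro Bochner_Integration.integral_cong) (auto simp: algebra_simps)
    also have "\<dots> = (\<integral>x. (X k x - L x) * (Y k x - K x) \<partial>M) + (\<integral>x. (X k x - L x) * K x \<partial>M) + (\<integral>x. L x * (Y k x - K x) \<partial>M) + (\<integral>x. L x * K x \<partial>M)"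
      using int by (subst Bochner_Integration.integral_add | simp)+
    finally have eq: "(\<integral>x. X k x * Y k x \<partial>M) - (\<integral>x. L x * K x \<partial>M) =
      (\<integral>x. (X k x - L x) * (Y k x - K x) \<partial>M) + (\<integral>x. (X k x - L x) * K x \<partial>M) + (\<integral>x. L x * (Y k x - K x) \<partial>M)" by simp
    have "\<bar>\<integral>x. (X k x - L x) * (Y k x - K x) \<partial>M\<bar> \<le> a k * b k"
      unfolding a_def b_def using elim by (intro integral_Cauchy_Schwarz) auto
    moreover have "\<bar>\<integral>x. (X k x - L x) * K x \<partial>M\<bar> \<le> a k * m"
      unfolding a_def m_def using elim sqK(1) by (intro integral_Cauchy_Schwarz) auto
    moreover have "\<bar>\<integral>x. L x * (Y k x - K x) \<partial>M\<bar> \<le> l * b k"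
      unfolding l_def b_def using elim sqL(1) by (intro integral_Cauchy_Schwarz) auto
    ultimately show ?case unfolding eq real_norm_def by linarith
  qed
  then have "(\<lambda>k. (\<integral>x. X k x * Y k x \<partial>M) - (\<integral>x. L x * K x \<partial>M)) \<longlonglongrightarrow> 0"
    using lim' by (rule Lim_null_comparison)
  then show ?thesis by (simp add: LIM_zero_iff)
qed

lemma L2_tendsto_const:
  "X \<in> borel_measurable M \<Longrightarrow> integrable M (\<lambda>x. (X x)\<^sup>2) \<Longrightarrow> L2_tendsto M (\<lambda>_. X) X"
  by (simp add: L2_tendsto_def)

section \<open>The isometry for noise with orthogonal increments\<close>

lemma Riemann_sum_measurable:
  fixes X :: "real \<Rightarrow> 'a \<Rightarrow> real"
  assumes part: "vanishing_partitions T N \<pi>" and X: "\<And>t. t \<in> {0..T} \<Longrightarrow> X t \<in> borel_measurable M"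
  shows "(\<lambda>\<omega>. \<Sum>i<N k. f (\<pi> k i) * (X (\<pi> k (Suc i)) \<omega> - X (\<pi> k i) \<omega>)) \<in> borel_measurable M"
proof (intro borel_measurable_sum borel_measurable_times borel_measurable_diff borel_measurable_const)
  fix i assume "i \<in> {..<N k}"
  then show "X (\<pi> k (Suc i)) \<in> borel_measurable M" "X (\<pi> k i) \<in> borel_measurable M"
    by (auto intro!: X vanishing_partitions_points[OF part])
qed

lemma uniform_partitions: "0 \<le> T \<Longrightarrow> vanishing_partitions T Suc (\<lambda>k i. T * real i / real (Suc k))"
  unfolding vanishing_partitions_def
proof (intro conjI allI impI)
  fix d :: real assume T: "0 \<le> T" and d: "0 < d"
  have "(\<lambda>k. T * inverse (real (Suc k))) \<longlonglongrightarrow> T * 0"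
    by (intro tendsto_intros LIMSEQ_inverse_real_of_nat)
  then have "(\<lambda>k. T / real (Suc k)) \<longlonglongrightarrow> 0" by (simp add: divide_inverse)
  from order_tendstoD(2)[OF this d]
  show "\<forall>\<^sub>F k in sequentially. \<forall>i<Suc k. T * real (Suc i) / real (Suc k) - T * real i / real (Suc k) < d"
    by eventually_elim (simp add: diff_divide_distrib[symmetric] algebra_simps)
qed (auto intro!: divide_right_mono mult_left_mono)

text \<open>
  The length of the overlap of two intervals, written as the second difference of \<open>min\<close> that also
  gives the covariance of the corresponding increments of the noise.
\<close>

lemma integral_indicator_Ico_mult:
  fixes a b c d :: real
  assumes "a \<le> b" "c \<le> d"
  shows "integrable lborel (\<lambda>t. indicator {a..<b} t * indicator {c..<d} t :: real)"
    and "(\<integral>t. indicator {a..<b} t * indicator {c..<d} t \<partial>lborel) = min b d - min b c - min a d + min a c"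
proof -
  have eq: "indicator {a..<b} t * indicator {c..<d} t = (indicator {max a c..<min b d} t :: real)" for t
    by (auto simp: indicator_def)
  show "integrable lborel (\<lambda>t. indicator {a..<b} t * indicator {c..<d} t :: real)"
    unfolding eq
  proof (rule integrable_real_indicator)
    have "emeasure lborel {max a c..<min b d} \<le> emeasure lborel {a..b}" by (rule emeasure_mono) auto
    also have "\<dots> < \<infinity>" using assms by simp
    finally show "emeasure lborel {max a c..<min b d} < \<infinity>" .
  qed simp
  have "(\<integral>t. indicator {a..<b} t * indicator {c..<d} t \<partial>lborel) = measure lborel {max a c..<min b d}"
    unfolding eq by simp
  also have "\<dots> = max 0 (min b d - max a c)"
  proof (cases "max a c \<le> min b d")
    case False
    then have "{max a c..<min b d} = {}" by (intro atLeastLessThan_empty) linarith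
    then show ?thesis using False by (simp only: measure_empty)
  qed (simp add: measure_lborel_Ico)
  also have "\<dots> = min b d - min b c - min a d + min a c"
    using assms by linarith
  finally show "(\<integral>t. indicator {a..<b} t * indicator {c..<d} t \<partial>lborel) = min b d - min b c - min a d + min a c" .
qed

text \<open>
  Increments of \<open>u\<close> have the covariance \<open>\<sigma>\<close> times the length of overlap, which is the \<open>L\<^sup>2\<close> product of
  the indicators of the intervals. By bilinearity the correspondence between Riemann--Ito sums and
  step functions preserves inner products up to the factor \<open>\<sigma>\<close>, for any two of the partitions.
\<close>

lemma (in prob_space) Riemann_sum_isometry:
  fixes u :: "real \<Rightarrow> 'a \<Rightarrow> real" and g :: "real \<Rightarrow> real"
  assumes part: "vanishing_partitions T N \<pi>"
    and u: "\<And>t. t \<in> {0..T} \<Longrightarrow> u t \<in> borel_measurable M"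
    and sq: "\<And>t. t \<in> {0..T} \<Longrightarrow> integrable M (\<lambda>\<omega>. (u t \<omega>)\<^sup>2)"
    and cov: "\<And>s t. s \<in> {0..T} \<Longrightarrow> t \<in> {0..T} \<Longrightarrow> expectation (\<lambda>\<omega>. u s \<omega> * u t \<omega>) = \<sigma> * min s t"
  defines "R \<equiv> \<lambda>k \<omega>. \<Sum>i<N k. g (\<pi> k i) * (u (\<pi> k (Suc i)) \<omega> - u (\<pi> k i) \<omega>)"
    and "G \<equiv> \<lambda>k. step (\<pi> k) (N k) (\<lambda>i. g (\<pi> k i))"
  shows "integrable M (\<lambda>\<omega>. R k \<omega> * R l \<omega>)" and "integrable lborel (\<lambda>t. G k t * G l t)"
    and "expectation (\<lambda>\<omega>. R k \<omega> * R l \<omega>) = \<sigma> * (\<integral>t. G k t * G l t \<partial>lborel)"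
proof -
  let ?d = "\<lambda>k i \<omega>. u (\<pi> k (Suc i)) \<omega> - u (\<pi> k i) \<omega>"
  let ?c = "\<lambda>k i t. indicator {\<pi> k i..<\<pi> k (Suc i)} t :: real"
  have mono: "\<pi> k i \<le> \<pi> k (Suc i)" if "i < N k" for k i
    using part that by (auto simp: vanishing_partitions_def)
  have pts: "\<pi> k i \<in> {0..T}" "\<pi> k (Suc i) \<in> {0..T}" if "i < N k" for k i
    using vanishing_partitions_points[OF part, of _ k] that by auto
  have uu: "integrable M (\<lambda>\<omega>. u s \<omega> * u t \<omega>)" if "s \<in> {0..T}" "t \<in> {0..T}" for s t
    using that by (intro integrable_mult_of_squares u sq)
  have d_eq: "?d k i \<omega> * ?d l j \<omega> = u (\<pi> k (Suc i)) \<omega> * u (\<pi> l (Suc j)) \<omega> - u (\<pi> k (Suc i)) \<omega> * u (\<pi> l j) \<omega>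
      - u (\<pi> k i) \<omega> * u (\<pi> l (Suc j)) \<omega> + u (\<pi> k i) \<omega> * u (\<pi> l j) \<omega>" for k l i j \<omega>
    by (simp add: algebra_simps)
  have d: "integrable M (\<lambda>\<omega>. ?d k i \<omega> * ?d l j \<omega>)"
    "expectation (\<lambda>\<omega>. ?d k i \<omega> * ?d l j \<omega>) = \<sigma> * (\<integral>t. ?c k i t * ?c l j t \<partial>lborel)" if ij: "i < N k" "j < N l" for k l i j
    unfolding d_eq integral_indicator_Ico_mult(2)[OF mono[OF ij(1)] mono[OF ij(2)]]
    using uu pts[OF ij(1)] pts[OF ij(2)] by (simp_all add: cov min.commute algebra_simps)
  have RR: "R k \<omega> * R l \<omega> = (\<Sum>i<N k. \<Sum>j<N l. g (\<pi> k i) * g (\<pi> l j) * (?d k i \<omega> * ?d l j \<omega>))" for \<omega>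
    unfolding R_def sum_product by (intro sum.cong refl) simp
  have GG: "G k t * G l t = (\<Sum>i<N k. \<Sum>j<N l. g (\<pi> k i) * g (\<pi> l j) * (?c k i t * ?c l j t))" for t
    unfolding G_def step_def sum_product by (intro sum.cong refl) (simp only: mult_ac)
  have c: "integrable lborel (\<lambda>t. ?c k i t * ?c l j t)" if "i < N k" "j < N l" for i j
    by (rule integral_indicator_Ico_mult(1)[OF mono[OF that(1)] mono[OF that(2)]])
  show "integrable M (\<lambda>\<omega>. R k \<omega> * R l \<omega>)" "integrable lborel (\<lambda>t. G k t * G l t)"
    unfolding RR GG by (intro Bochner_Integration.integrable_sum integrable_mult_right d(1) c; simp)+
  have "expectation (\<lambda>\<omega>. R k \<omega> * R l \<omega>) = (\<Sum>i<N k. expectation (\<lambda>\<omega>. \<Sum>j<N l. g (\<pi> k i) * g (\<pi> l j) * (?d k i \<omega> * ?d l j \<omega>)))"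
    unfolding RR by (intro Bochner_Integration.integral_sum Bochner_Integration.integrable_sum integrable_mult_right d(1)) auto
  also have "\<dots> = (\<Sum>i<N k. \<Sum>j<N l. expectation (\<lambda>\<omega>. g (\<pi> k i) * g (\<pi> l j) * (?d k i \<omega> * ?d l j \<omega>)))"
    by (intro sum.cong refl Bochner_Integration.integral_sum integrable_mult_right d(1)) auto
  also have "\<dots> = (\<Sum>i<N k. \<Sum>j<N l. g (\<pi> k i) * g (\<pi> l j) * (\<sigma> * (\<integral>t. ?c k i t * ?c l j t \<partial>lborel)))"
    by (intro sum.cong refl) (simp only: d(2) lessThan_iff integral_mult_right_zero)
  also have "\<dots> = \<sigma> * (\<Sum>i<N k. \<Sum>j<N l. g (\<pi> k i) * g (\<pi> l j) * (\<integral>t. ?c k i t * ?c l j t \<partial>lborel))"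
    unfolding sum_distrib_left by (intro sum.cong refl) (simp only: mult_ac)
  also have "(\<Sum>i<N k. \<Sum>j<N l. g (\<pi> k i) * g (\<pi> l j) * (\<integral>t. ?c k i t * ?c l j t \<partial>lborel))
      = (\<Sum>i<N k. \<integral>t. (\<Sum>j<N l. g (\<pi> k i) * g (\<pi> l j) * (?c k i t * ?c l j t)) \<partial>lborel)"
    unfolding integral_mult_right_zero[symmetric]
    by (intro sum.cong refl Bochner_Integration.integral_sum[symmetric] integrable_mult_right c) auto
  also have "\<dots> = (\<integral>t. G k t * G l t \<partial>lborel)"
    unfolding GG by (intro Bochner_Integration.integral_sum[symmetric] Bochner_Integration.integrable_sum integrable_mult_right c) auto
  finally show "expectation (\<lambda>\<omega>. R k \<omega> * R l \<omega>) = \<sigma> * (\<integral>t. G k t * G l t \<partial>lborel)" .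
qed

text \<open>
  The Ito isometry. The step functions \<open>G k\<close> converge to \<open>g\<close> in \<open>L\<^sup>2\<close>, so
  by \<open>Riemann_sum_isometry\<close> the Riemann--Ito sums are a Cauchy sequence in \<open>L\<^sup>2\<close>. They converge
  almost surely to the integral, and Fatou's lemma turns the Cauchy property into convergence in
  \<open>L\<^sup>2\<close> to this limit. Second moments pass to the limit.
\<close>

lemma (in prob_space) second_moment_parts_integral:
  fixes u :: "real \<Rightarrow> 'a \<Rightarrow> real"
  assumes T: "0 \<le> T"
    and u: "\<And>t. t \<in> {0..T} \<Longrightarrow> u t \<in> borel_measurable M"
    and cadlag: "AE \<omega> in M. cadlag_on {0..T} (\<lambda>t. u t \<omega>)"
    and sq: "\<And>t. t \<in> {0..T} \<Longrightarrow> integrable M (\<lambda>\<omega>. (u t \<omega>)\<^sup>2)"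
    and cov: "\<And>s t. s \<in> {0..T} \<Longrightarrow> t \<in> {0..T} \<Longrightarrow> expectation (\<lambda>\<omega>. u s \<omega> * u t \<omega>) = \<sigma> * min s t"
    and g: "\<And>t. (g has_real_derivative g' t) (at t)" "continuous_on UNIV g'"
    and I: "I \<in> borel_measurable M" "AE \<omega> in M. I \<omega> = parts_integral T g g' (\<lambda>t. u t \<omega>)"
    and \<sigma>: "0 \<le> \<sigma>"
  shows "expectation (\<lambda>\<omega>. (I \<omega>)\<^sup>2) = \<sigma> * (LINT t:{0..T}|lborel. (g t)\<^sup>2)"
proof -
  define \<pi> where "\<pi> = (\<lambda>k i. T * real i / real (Suc k))"
  have part: "vanishing_partitions T Suc \<pi>" unfolding \<pi>_def by (rule uniform_partitions[OF T])
  define R where "R k \<omega> = (\<Sum>i<Suc k. g (\<pi> k i) * (u (\<pi> k (Suc i)) \<omega> - u (\<pi> k i) \<omega>))" for k \<omega>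
  define G where "G k = step (\<pi> k) (Suc k) (\<lambda>i. g (\<pi> k i))" for k
  define L where "L t = indicator {0..<T} t * g t" for t
  have iso: "integrable M (\<lambda>\<omega>. R k \<omega> * R l \<omega>)" "integrable lborel (\<lambda>t. G k t * G l t)"
    "expectation (\<lambda>\<omega>. R k \<omega> * R l \<omega>) = \<sigma> * (\<integral>t. G k t * G l t \<partial>lborel)" for k l
    unfolding R_def G_def by (rule Riemann_sum_isometry[where g=g, OF part u sq cov]; assumption)+
  have cg: "continuous_on UNIV g"
    using g(1) by (auto intro!: continuous_at_imp_continuous_on DERIV_isCont)
  have [measurable]: "g \<in> borel_measurable borel" by (rule borel_measurable_continuous_onI[OF cg])
  have Rm[measurable]: "R k \<in> borel_measurable M" for k
    unfolding R_def by (rule Riemann_sum_measurable[OF part u])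
  have Gm[measurable]: "G k \<in> borel_measurable borel" for k unfolding G_def by measurable
  have Lm[measurable]: "L \<in> borel_measurable borel" unfolding L_def[abs_def] by measurable
  note [measurable] = I(1)
  obtain B where B: "\<And>t. t \<in> {0..T} \<Longrightarrow> \<bar>g t\<bar> \<le> B" using continuous_on_Icc_bounded[OF cg] by blast
  have G_cases: "\<exists>i. i < Suc k \<and> \<pi> k i \<le> t \<and> t < \<pi> k (Suc i) \<and> G k t = g (\<pi> k i)" if "t \<in> {0..<T}" for k t
    unfolding G_def by (rule step_partition_cases[OF part that, of k]) auto
  have G_lim: "(\<lambda>k. G k t) \<longlonglongrightarrow> L t" for t
  proof (cases "t \<in> {0..<T}")
    case True
    obtain i where i: "\<And>k. i k < Suc k" "\<And>k. \<pi> k (i k) \<le> t" "\<And>k. t < \<pi> k (Suc (i k))"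
      and Gi: "\<And>k. G k t = g (\<pi> k (i k))"
      using G_cases[OF True] by metis
    have "isCont g t" using g(1) by (rule DERIV_isCont)
    from isCont_tendsto_compose[OF this vanishing_partitions_tendsto(1)[OF part i]]
    show ?thesis unfolding Gi using True by (simp add: L_def)
  next
    case False
    then show ?thesis unfolding G_def step_outside[OF part False] by (simp add: L_def)
  qed
  have bound: "\<bar>G k t\<bar> \<le> indicator {0..T} t * \<bar>B\<bar>" "\<bar>L t\<bar> \<le> indicator {0..T} t * \<bar>B\<bar>" for k t
  proof -
    show "\<bar>L t\<bar> \<le> indicator {0..T} t * \<bar>B\<bar>"
      using B[of t] by (auto simp: L_def indicator_def)
    show "\<bar>G k t\<bar> \<le> indicator {0..T} t * \<bar>B\<bar>"
    proof (cases "t \<in> {0..<T}")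
      case True
      then obtain i where "i < Suc k" "G k t = g (\<pi> k i)" using G_cases by blast
      then show ?thesis using B[OF vanishing_partitions_points[OF part, of i k]] True by simp
    qed (simp add: G_def step_outside[OF part])
  qed
  have w: "integrable lborel (\<lambda>t. indicator {0..T} t * c)" for c :: real
    using T by (intro integrable_mult_left integrable_real_indicator) auto
  have square_le: "x\<^sup>2 \<le> indicator {0..T} t * c\<^sup>2" if "\<bar>x\<bar> \<le> indicator {0..T} t * c" for x c t :: real
    using that power_mono[of "\<bar>x\<bar>" "indicator {0..T} t * c" 2] by (auto simp: indicator_def split: if_splits)
  have diff_le: "(G k t - L t)\<^sup>2 \<le> indicator {0..T} t * (2 * \<bar>B\<bar>)\<^sup>2" for k t
    using bound(1)[of k t] bound(2)[of t] by (intro square_le) linarith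
  have "(\<lambda>k. \<integral>t. G k t * G k t \<partial>lborel) \<longlonglongrightarrow> (\<integral>t. L t * L t \<partial>lborel)"
    using square_le[OF bound(1)]
    by (intro integral_dominated_convergence[OF _ _ w[of "\<bar>B\<bar>\<^sup>2"]] AE_I2 tendsto_mult G_lim)
       (auto simp: power2_eq_square)
  then have energy: "(\<lambda>k. expectation (\<lambda>\<omega>. R k \<omega> * R k \<omega>)) \<longlonglongrightarrow> \<sigma> * (\<integral>t. L t * L t \<partial>lborel)"
    unfolding iso(3) by (rule tendsto_mult_left)
  define d where "d k = (\<integral>t. (G k t - L t)\<^sup>2 \<partial>lborel)" for k
  have d_int: "integrable lborel (\<lambda>t. (G k t - L t)\<^sup>2)" for k
    by (rule Bochner_Integration.integrable_bound[OF w[of "(2 * \<bar>B\<bar>)\<^sup>2"]]) (use diff_le[of k] in auto)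
  have "d \<longlonglongrightarrow> (\<integral>t. (0::real) \<partial>(lborel :: real measure))"
    unfolding d_def
  proof (rule integral_dominated_convergence[where w="\<lambda>t. indicator {0..T} t * (2 * \<bar>B\<bar>)\<^sup>2"])
    show "AE t in lborel. (\<lambda>k. (G k t - L t)\<^sup>2) \<longlonglongrightarrow> 0"
    proof (rule AE_I2)
      fix t
      have "(\<lambda>k. (G k t - L t)\<^sup>2) \<longlonglongrightarrow> (L t - L t)\<^sup>2" by (intro tendsto_intros G_lim)
      then show "(\<lambda>k. (G k t - L t)\<^sup>2) \<longlonglongrightarrow> 0" by simp
    qed
  qed (use diff_le w in auto)
  then have d_lim: "d \<longlonglongrightarrow> 0" by simp
  \<comment> \<open>compare both sums with the common limit \<open>L\<close> of the step functions\<close>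
  have cauchy: "(\<integral>\<^sup>+\<omega>. ennreal ((R l \<omega> - R k \<omega>)\<^sup>2) \<partial>M) \<le> ennreal (2 * \<sigma> * (d k + d l))" for k l
  proof -
    have sq_eq: "(x - y)\<^sup>2 = x * x - 2 * (x * y) + y * y" for x y :: real
      by (simp add: power2_eq_square algebra_simps)
    have "(\<integral>t. (G l t - G k t)\<^sup>2 \<partial>lborel) \<le> (\<integral>t. 2 * (G k t - L t)\<^sup>2 + 2 * (G l t - L t)\<^sup>2 \<partial>lborel)"
    proof (rule integral_mono)
      show "integrable lborel (\<lambda>t. (G l t - G k t)\<^sup>2)" unfolding sq_eq using iso(2) by simp
      show "integrable lborel (\<lambda>t. 2 * (G k t - L t)\<^sup>2 + 2 * (G l t - L t)\<^sup>2)" using d_int by simp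
      show "(G l t - G k t)\<^sup>2 \<le> 2 * (G k t - L t)\<^sup>2 + 2 * (G l t - L t)\<^sup>2" for t
        using zero_le_power2[of "(G k t - L t) + (G l t - L t)"] by (simp add: power2_eq_square algebra_simps)
    qed
    also have "\<dots> = 2 * (d k + d l)" using d_int by (simp add: d_def)
    finally have le: "\<sigma> * (\<integral>t. (G l t - G k t)\<^sup>2 \<partial>lborel) \<le> \<sigma> * (2 * (d k + d l))"
      using \<sigma> by (rule mult_left_mono)
    have "(\<integral>\<^sup>+\<omega>. ennreal ((R l \<omega> - R k \<omega>)\<^sup>2) \<partial>M) = ennreal (expectation (\<lambda>\<omega>. (R l \<omega> - R k \<omega>)\<^sup>2))"
    proof (rule nn_integral_eq_integral)
      show "integrable M (\<lambda>\<omega>. (R l \<omega> - R k \<omega>)\<^sup>2)" unfolding sq_eq using iso(1) by simp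
    qed simp
    also have "expectation (\<lambda>\<omega>. (R l \<omega> - R k \<omega>)\<^sup>2) = \<sigma> * (\<integral>t. (G l t - G k t)\<^sup>2 \<partial>lborel)"
      unfolding sq_eq using iso(1,2) by (simp add: iso(3) distrib_left right_diff_distrib)
    finally show ?thesis using ennreal_leI[OF le] by (simp only: mult.assoc mult.left_commute)
  qed
  have lim: "AE \<omega> in M. (\<lambda>l. R l \<omega>) \<longlonglongrightarrow> I \<omega>"
    using cadlag I(2)
  proof eventually_elim
    case (elim \<omega>)
    from Riemann_sums_tendsto_parts_integral[OF elim(1) g part] show ?case by (simp only: R_def elim(2))
  qed
  \<comment> \<open>let the finer partition go to the limit inside the second moment\<close>
  have fatou: "(\<integral>\<^sup>+\<omega>. ennreal ((I \<omega> - R k \<omega>)\<^sup>2) \<partial>M) \<le> ennreal (2 * \<sigma> * d k)" for k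
  proof -
    have "(\<integral>\<^sup>+\<omega>. ennreal ((I \<omega> - R k \<omega>)\<^sup>2) \<partial>M) = (\<integral>\<^sup>+\<omega>. liminf (\<lambda>l. ennreal ((R l \<omega> - R k \<omega>)\<^sup>2)) \<partial>M)"
    proof (rule nn_integral_cong_AE)
      show "AE \<omega> in M. ennreal ((I \<omega> - R k \<omega>)\<^sup>2) = liminf (\<lambda>l. ennreal ((R l \<omega> - R k \<omega>)\<^sup>2))"
        using lim
      proof eventually_elim
        case (elim \<omega>)
        then have "(\<lambda>l. ennreal ((R l \<omega> - R k \<omega>)\<^sup>2)) \<longlonglongrightarrow> ennreal ((I \<omega> - R k \<omega>)\<^sup>2)"
          by (intro tendsto_ennrealI tendsto_intros)
        then show ?case using lim_imp_Liminf sequentially_bot by metis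
      qed
    qed
    also have "\<dots> \<le> liminf (\<lambda>l. \<integral>\<^sup>+\<omega>. ennreal ((R l \<omega> - R k \<omega>)\<^sup>2) \<partial>M)"
      by (rule nn_integral_liminf) measurable
    also have "\<dots> \<le> liminf (\<lambda>l. ennreal (2 * \<sigma> * (d k + d l)))"
      by (intro Liminf_mono always_eventually allI cauchy)
    also have "\<dots> = ennreal (2 * \<sigma> * (d k + 0))"
      by (intro lim_imp_Liminf sequentially_bot tendsto_ennrealI tendsto_intros d_lim)
    finally show ?thesis by simp
  qed
  have "L2_tendsto M R I"
    unfolding L2_tendsto_def
  proof (intro conjI allI)
    have "(\<lambda>k. ennreal (2 * \<sigma> * d k)) \<longlonglongrightarrow> ennreal (2 * \<sigma> * 0)"
      by (intro tendsto_ennrealI tendsto_intros d_lim)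
    then have up: "(\<lambda>k. ennreal (2 * \<sigma> * d k)) \<longlonglongrightarrow> 0" by simp
    show "(\<lambda>k. \<integral>\<^sup>+\<omega>. ennreal ((I \<omega> - R k \<omega>)\<^sup>2) \<partial>M) \<longlonglongrightarrow> 0"
      by (rule tendsto_sandwich[OF _ _ tendsto_const up]) (simp_all add: fatou)
    show "integrable M (\<lambda>\<omega>. (R k \<omega>)\<^sup>2)" for k using iso(1)[of k k] by (simp add: power2_eq_square)
  qed measurable
  from L2_tendsto_integral_mult[OF this this]
  have "expectation (\<lambda>\<omega>. I \<omega> * I \<omega>) = \<sigma> * (\<integral>t. L t * L t \<partial>lborel)"
    by (rule LIMSEQ_unique[OF _ energy])
  also have "(\<integral>t. L t * L t \<partial>lborel) = (LINT t:{0..T}|lborel. (g t)\<^sup>2)"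
    unfolding set_lebesgue_integral_def
  proof (rule integral_cong_AE)
    show "AE t in lborel. L t * L t = indicator {0..T} t *\<^sub>R (g t)\<^sup>2"
      using AE_lborel_singleton[of T] by eventually_elim (auto simp: L_def indicator_def power2_eq_square)
  qed measurable
  finally show ?thesis by (simp add: power2_eq_square)
qed

section \<open>Integer-valued measures on time and jump size\<close>

lemma fst_borel_measurable [measurable]: "fst \<in> borel_measurable (borel :: (real \<times> real) measure)"
  and snd_borel_measurable [measurable]: "snd \<in> borel_measurable (borel :: (real \<times> real) measure)"
  by (simp_all flip: borel_prod)

lemma integer_valued_less_one:
  assumes "(x::ennreal) \<in> insert \<infinity> (range of_nat)" "x < 1"
  shows "x = 0"
proof -
  obtain n :: nat where n: "x = of_nat n" using assms by auto
  then have "n = 0" using assms(2) by (cases n) auto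
  then show ?thesis using n by simp
qed

text \<open>
  A point without mass has neighbourhoods of mass below 1, hence of mass 0. By the Lindelof property
  countably many of them cover all such points, which therefore form a null set.
\<close>

lemma integer_valued_finite_measure_atomic:
  fixes m :: "'a::{metric_space, second_countable_topology} measure"
  assumes fin: "finite_measure m" and sets[measurable_cong]: "sets m = sets borel"
    and int: "\<And>A. A \<in> sets borel \<Longrightarrow> emeasure m A \<in> insert \<infinity> (range of_nat)"
  shows "AE p in m. 1 \<le> emeasure m {p}"
proof -
  interpret finite_measure m by fact
  define F where "F = {U. open U \<and> emeasure m U = 0}"
  obtain F' where F': "F' \<subseteq> F" "countable F'" "\<Union>F' = \<Union>F"
    using Lindelof[of F] by (auto simp: F_def)
  have "(\<Union>U\<in>F'. U) \<in> null_sets m"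
    using F' by (intro null_sets_UN') (auto simp: F_def null_sets_def sets)
  moreover have "{p \<in> space m. \<not> 1 \<le> emeasure m {p}} \<subseteq> (\<Union>U\<in>F'. U)"
  proof
    fix p assume "p \<in> {p \<in> space m. \<not> 1 \<le> emeasure m {p}}"
    then have zero: "emeasure m {p} = 0"
      using integer_valued_less_one[OF int[of "{p}"]] by auto
    have "(\<lambda>k. emeasure m (ball p (1 / real (Suc k)))) \<longlonglongrightarrow> emeasure m (\<Inter>k. ball p (1 / real (Suc k)))"
      by (intro Lim_emeasure_decseq) (auto simp: sets decseq_def intro!: subset_ball divide_left_mono)
    also have "(\<Inter>k. ball p (1 / real (Suc k))) = {p}"
    proof (intro equalityI subsetI)
      fix q assume q: "q \<in> (\<Inter>k. ball p (1 / real (Suc k)))"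
      show "q \<in> {p}"
      proof (rule ccontr)
        assume "q \<notin> {p}"
        then have "0 < dist p q" by auto
        then obtain k where "inverse (real (Suc k)) < dist p q" using reals_Archimedean by blast
        moreover have "dist p q < 1 / real (Suc k)" using q by auto
        ultimately show False by (simp add: inverse_eq_divide)
      qed
    qed auto
    finally have "\<forall>\<^sub>F k in sequentially. emeasure m (ball p (1 / real (Suc k))) < 1"
      unfolding zero by (rule order_tendstoD) simp
    then obtain k where "emeasure m (ball p (1 / real (Suc k))) < 1"
      by (auto simp: eventually_sequentially)
    then have "ball p (1 / real (Suc k)) \<in> F"
      using integer_valued_less_one[OF int] by (auto simp: F_def)
    moreover have "p \<in> ball p (1 / real (Suc k))" by simp
    ultimately have "p \<in> \<Union>F" by blast
    then show "p \<in> (\<Union>U\<in>F'. U)" using F'(3) by auto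
  qed
  ultimately show ?thesis by (rule AE_I')
qed

text \<open>
  Almost every point is an atom of mass at least 1. Since its time slice has mass at most 1, the
  atom is the whole slice.
\<close>

lemma nn_integral_same_time:
  fixes m :: "(real \<times> real) measure"
  assumes fin: "finite_measure m" and sets: "sets m = sets borel"
    and int: "\<And>A. A \<in> sets borel \<Longrightarrow> emeasure m A \<in> insert \<infinity> (range of_nat)"
    and one: "\<And>t. emeasure m ({t} \<times> UNIV) \<le> 1"
    and f: "f \<in> borel_measurable borel" and g: "g \<in> borel_measurable borel"
  shows "(\<integral>\<^sup>+p. (\<integral>\<^sup>+q. f p * g q * indicator {q. fst q = fst p} q \<partial>m) \<partial>m) = (\<integral>\<^sup>+p. f p * g p \<partial>m)"
proof (rule nn_integral_cong_AE)
  interpret finite_measure m by fact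
  have atomic: "AE p in m. 1 \<le> emeasure m {p}"
    by (rule integer_valued_finite_measure_atomic[OF fin sets int])
  show "AE p in m. (\<integral>\<^sup>+q. f p * g q * indicator {q. fst q = fst p} q \<partial>m) = f p * g p"
    using atomic
  proof eventually_elim
    case (elim p)
    have S: "{fst p} \<times> UNIV \<in> sets m" "{p} \<in> sets m"
      unfolding sets by (auto intro!: borel_closed closed_Times)
    have "emeasure m {p} \<le> emeasure m ({fst p} \<times> UNIV)"
      by (intro emeasure_mono S) (cases p, auto)
    then have eq: "emeasure m {p} = 1" "emeasure m ({fst p} \<times> UNIV) = 1"
      using elim one[of "fst p"] by auto
    have "emeasure m ({fst p} \<times> UNIV - {p}) = 0"
      using S eq by (subst emeasure_Diff) (auto simp: mem_Times_iff)
    then have "AE q in m. q \<notin> {fst p} \<times> UNIV - {p}"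
      using S by (intro AE_not_in) (auto simp: null_sets_def)
    then have "(\<integral>\<^sup>+q. f p * g q * indicator {q. fst q = fst p} q \<partial>m) = (\<integral>\<^sup>+q. f p * g p * indicator {p} q \<partial>m)"
      by (intro nn_integral_cong_AE, eventually_elim) (auto simp: indicator_def mem_Times_iff)
    also have "\<dots> = f p * g p"
      using S eq by (simp add: nn_integral_cmult_indicator)
    finally show ?case .
  qed
qed

text \<open>
  The product of two sums over jumps is a double sum. It is split according to which of the two jumps
  comes first; pairs with equal times reduce to the diagonal by \<open>nn_integral_same_time\<close>.
\<close>

lemma nn_integral_mult_time_split:
  fixes m :: "(real \<times> real) measure"
  assumes fin: "finite_measure m" and sets[measurable_cong]: "sets m = sets borel"
    and int: "\<And>A. A \<in> sets borel \<Longrightarrow> emeasure m A \<in> insert \<infinity> (range of_nat)"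
    and one: "\<And>t. emeasure m ({t} \<times> UNIV) \<le> 1"
    and f[measurable]: "f \<in> borel_measurable borel" and g[measurable]: "g \<in> borel_measurable borel"
  shows "(\<integral>\<^sup>+p. f p \<partial>m) * (\<integral>\<^sup>+p. g p \<partial>m) = (\<integral>\<^sup>+p. f p * g p \<partial>m)
    + (\<integral>\<^sup>+q. g q * (\<integral>\<^sup>+p. f p * indicator {..<fst q} (fst p) \<partial>m) \<partial>m)
    + (\<integral>\<^sup>+q. f q * (\<integral>\<^sup>+p. g p * indicator {..<fst q} (fst p) \<partial>m) \<partial>m)"
proof -
  interpret finite_measure m by fact
  interpret P: pair_sigma_finite m m by unfold_locales
  have [measurable]: "fst \<in> borel_measurable m"
    using fst_borel_measurable by (simp add: measurable_cong_sets[OF sets refl])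
  have "(\<integral>\<^sup>+p. f p \<partial>m) * (\<integral>\<^sup>+p. g p \<partial>m) = (\<integral>\<^sup>+p. (\<integral>\<^sup>+q. f p * g q \<partial>m) \<partial>m)"
    by (simp add: nn_integral_cmult nn_integral_multc)
  also have "\<dots> = (\<integral>\<^sup>+p. (\<integral>\<^sup>+q. f p * g q * indicator {q. fst q = fst p} q + f p * g q * indicator {..<fst q} (fst p)
      + f p * g q * indicator {..<fst p} (fst q) \<partial>m) \<partial>m)"
    by (intro nn_integral_cong) (auto simp: indicator_def)
  also have "\<dots> = (\<integral>\<^sup>+p. (\<integral>\<^sup>+q. f p * g q * indicator {q. fst q = fst p} q \<partial>m) \<partial>m)
      + (\<integral>\<^sup>+p. (\<integral>\<^sup>+q. f p * g q * indicator {..<fst q} (fst p) \<partial>m) \<partial>m)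
      + (\<integral>\<^sup>+p. (\<integral>\<^sup>+q. f p * g q * indicator {..<fst p} (fst q) \<partial>m) \<partial>m)"
    by (simp add: nn_integral_add indicator_def[abs_def] cong: if_cong)
  also have "(\<integral>\<^sup>+p. (\<integral>\<^sup>+q. f p * g q * indicator {q. fst q = fst p} q \<partial>m) \<partial>m) = (\<integral>\<^sup>+p. f p * g p \<partial>m)"
    by (rule nn_integral_same_time[OF fin sets int one f g])
  also have "(\<integral>\<^sup>+p. (\<integral>\<^sup>+q. f p * g q * indicator {..<fst q} (fst p) \<partial>m) \<partial>m) =
      (\<integral>\<^sup>+q. (\<integral>\<^sup>+p. f p * g q * indicator {..<fst q} (fst p) \<partial>m) \<partial>m)"
    by (rule P.Fubini'[symmetric]) (simp add: indicator_def[abs_def] cong: if_cong)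
  also have "\<dots> = (\<integral>\<^sup>+q. g q * (\<integral>\<^sup>+p. f p * indicator {..<fst q} (fst p) \<partial>m) \<partial>m)"
    by (intro nn_integral_cong) (simp add: nn_integral_cmult[symmetric] mult_ac)
  also have "(\<integral>\<^sup>+p. (\<integral>\<^sup>+q. f p * g q * indicator {..<fst p} (fst q) \<partial>m) \<partial>m) =
      (\<integral>\<^sup>+q. f q * (\<integral>\<^sup>+p. g p * indicator {..<fst q} (fst p) \<partial>m) \<partial>m)"
    by (intro nn_integral_cong) (simp add: nn_integral_cmult[symmetric] mult_ac)
  finally show ?thesis .
qed

section \<open>Integrals against a random measure with Levy compensator\<close>

text \<open>
  Only the masses of subsets of \<open>K\<close> need to be measurable. For \<open>K\<close> in the past of \<open>t\<close> this covers
  adaptedness, and for the sigma-algebra generated by the random measure it covers independence.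
\<close>

lemma nn_integral_random_measure_measurable:
  fixes f :: "'b::topological_space \<Rightarrow> ennreal"
  assumes sets: "\<And>\<omega>. \<omega> \<in> space N \<Longrightarrow> sets (\<mu> \<omega>) = sets borel"
    and meas: "\<And>A. A \<in> sets borel \<Longrightarrow> A \<subseteq> K \<Longrightarrow> (\<lambda>\<omega>. emeasure (\<mu> \<omega>) A) \<in> borel_measurable N"
    and K: "K \<in> sets borel" and f: "f \<in> borel_measurable borel"
  shows "(\<lambda>\<omega>. \<integral>\<^sup>+p. f p * indicator K p \<partial>\<mu> \<omega>) \<in> borel_measurable N"
  using f
proof (induction rule: borel_measurable_induct)
  case (cong f g)
  then show ?case by simp
next
  case (set A)
  have "(\<lambda>\<omega>. emeasure (\<mu> \<omega>) (A \<inter> K)) \<in> borel_measurable N"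
    using set K by (intro meas) auto
  then show ?case
  proof (subst measurable_cong)
    fix \<omega> assume \<omega>: "\<omega> \<in> space N"
    have "(\<integral>\<^sup>+p. indicator A p * indicator K p \<partial>\<mu> \<omega>) = (\<integral>\<^sup>+p. indicator (A \<inter> K) p \<partial>\<mu> \<omega>)"
      by (intro nn_integral_cong) (auto simp: indicator_def)
    then show "(\<integral>\<^sup>+p. indicator A p * indicator K p \<partial>\<mu> \<omega>) = emeasure (\<mu> \<omega>) (A \<inter> K)"
      using set K sets[OF \<omega>] by simp
  qed
next
  case (mult u c)
  have "(\<lambda>\<omega>. c * (\<integral>\<^sup>+p. u p * indicator K p \<partial>\<mu> \<omega>)) \<in> borel_measurable N"
    using mult by simp
  then show ?case
  proof (subst measurable_cong)
    fix \<omega> assume \<omega>: "\<omega> \<in> space N"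
    note [measurable_cong] = sets[OF \<omega>] and [measurable] = K mult(2)
    show "(\<integral>\<^sup>+p. c * u p * indicator K p \<partial>\<mu> \<omega>) = c * (\<integral>\<^sup>+p. u p * indicator K p \<partial>\<mu> \<omega>)"
      by (simp add: nn_integral_cmult mult.assoc)
  qed
next
  case (add u v)
  have "(\<lambda>\<omega>. (\<integral>\<^sup>+p. u p * indicator K p \<partial>\<mu> \<omega>) + (\<integral>\<^sup>+p. v p * indicator K p \<partial>\<mu> \<omega>)) \<in> borel_measurable N"
    using add by simp
  then show ?case
  proof (subst measurable_cong)
    fix \<omega> assume \<omega>: "\<omega> \<in> space N"
    note [measurable_cong] = sets[OF \<omega>] and [measurable] = K add(1) add(4)
    have m: "u \<in> borel_measurable borel" "v \<in> borel_measurable borel" using add by auto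
    show "(\<integral>\<^sup>+p. (v p + u p) * indicator K p \<partial>\<mu> \<omega>) = (\<integral>\<^sup>+p. u p * indicator K p \<partial>\<mu> \<omega>) + (\<integral>\<^sup>+p. v p * indicator K p \<partial>\<mu> \<omega>)"
      using m by (simp add: nn_integral_add distrib_right add.commute)
  qed
next
  case (seq U)
  have "(\<lambda>\<omega>. SUP i. \<integral>\<^sup>+p. U i p * indicator K p \<partial>\<mu> \<omega>) \<in> borel_measurable N"
    using seq by (intro borel_measurable_SUP) auto
  then show ?case
  proof (subst measurable_cong)
    fix \<omega> assume \<omega>: "\<omega> \<in> space N"
    note [measurable_cong] = sets[OF \<omega>] and [measurable] = K seq(1)
    have "(\<integral>\<^sup>+p. (SUP i. U i) p * indicator K p \<partial>\<mu> \<omega>) = (\<integral>\<^sup>+p. (SUP i. U i p * indicator K p) \<partial>\<mu> \<omega>)"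
      by (intro nn_integral_cong) (simp add: SUP_mult_right_ennreal SUP_apply image_image)
    also have "\<dots> = (SUP i. \<integral>\<^sup>+p. U i p * indicator K p \<partial>\<mu> \<omega>)"
      using \<open>incseq U\<close> by (intro nn_integral_monotone_convergence_SUP) (auto simp: incseq_def le_fun_def intro!: mult_right_mono)
    finally show "(\<integral>\<^sup>+p. (SUP i. U i) p * indicator K p \<partial>\<mu> \<omega>) = (SUP i. \<integral>\<^sup>+p. U i p * indicator K p \<partial>\<mu> \<omega>)" .
  qed
qed

text \<open>
  A random measure as in the theorem, with a compensator that is homogeneous in time. Sigma-finiteness
  of the Levy measure gives access to Fubini for its product with Lebesgue measure.
\<close>

locale levy_jump_measure = prob_space M for M :: "'w measure" +
  fixes F :: "real \<Rightarrow> 'w measure" and \<mu> :: "'w \<Rightarrow> (real \<times> real) measure" and \<Lambda> :: "real measure"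
  assumes filtration: "filtration (space M) F" and subalgebra: "\<And>t. subalgebra M (F t)"
    and integer_valued: "integer_valued_random_measure M F \<mu>"
    and compensator: "deterministic_compensator M F \<mu> (levy_compensator \<Lambda>)"
    and sets_\<Lambda> [measurable_cong]: "sets \<Lambda> = sets borel"
    and sigma_finite_\<Lambda>: "sigma_finite_measure \<Lambda>"
begin

sublocale \<Lambda>: sigma_finite_measure \<Lambda> by (rule sigma_finite_\<Lambda>)

lemma sets_\<mu>: "\<omega> \<in> space M \<Longrightarrow> sets (\<mu> \<omega>) = sets borel"
  and emeasure_\<mu>_integer: "\<omega> \<in> space M \<Longrightarrow> A \<in> sets borel \<Longrightarrow> emeasure (\<mu> \<omega>) A \<in> insert \<infinity> (range of_nat)"
  and emeasure_\<mu>_time: "\<omega> \<in> space M \<Longrightarrow> emeasure (\<mu> \<omega>) ({t} \<times> UNIV) \<le> 1"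
  and emeasure_\<mu>_measurable: "A \<in> sets borel \<Longrightarrow> (\<lambda>\<omega>. emeasure (\<mu> \<omega>) A) \<in> borel_measurable M"
  and emeasure_\<mu>_adapted: "0 \<le> t \<Longrightarrow> A \<in> sets borel \<Longrightarrow> A \<subseteq> {0..t} \<times> UNIV \<Longrightarrow> (\<lambda>\<omega>. emeasure (\<mu> \<omega>) A) \<in> borel_measurable (F t)"
  using integer_valued unfolding integer_valued_random_measure_def by blast+

lemma AE_\<mu>_support: 
  assumes "\<omega> \<in> space M"
  shows "AE p in \<mu> \<omega>. 0 < fst p \<and> snd p \<noteq> 0"
proof -
  have "open ({0<..} \<times> (- {0}) :: (real \<times> real) set)" by (intro open_Times) auto
  then have "- ({0<..} \<times> (- {0})) \<in> sets (borel :: (real \<times> real) measure)" by (auto intro!: borel_open)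
  then have "- ({0<..} \<times> (- {0})) \<in> null_sets (\<mu> \<omega>)"
    using integer_valued assms unfolding integer_valued_random_measure_def by (auto simp: null_sets_def)
  from AE_not_in[OF this] show ?thesis by eventually_elim (auto simp: mem_Times_iff)
qed

lemma space_F: "space (F t) = space M"
  using subalgebra by (auto simp: subalgebra_def)

lemma F_measurable_M: "f \<in> borel_measurable (F t) \<Longrightarrow> f \<in> borel_measurable M"
  using subalgebra measurable_from_subalg by blast

definition jumps :: "(real \<Rightarrow> ennreal) \<Rightarrow> real set \<Rightarrow> 'w \<Rightarrow> ennreal" where
  "jumps g S \<omega> = (\<integral>\<^sup>+p. g (snd p) * indicator (S \<times> UNIV) p \<partial>\<mu> \<omega>)"

lemma Times_UNIV_borel [measurable]: "S \<in> sets borel \<Longrightarrow> S \<times> (UNIV :: real set) \<in> sets (borel :: (real \<times> real) measure)"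
  by (simp flip: borel_prod)

lemma jumps_measurable:
  assumes "g \<in> borel_measurable borel" "S \<in> sets borel"
  shows "jumps g S \<in> borel_measurable M"
  unfolding jumps_def[abs_def] using assms
  by (intro nn_integral_random_measure_measurable sets_\<mu> emeasure_\<mu>_measurable) auto

lemma jumps_adapted:
  assumes "g \<in> borel_measurable borel" "S \<in> sets borel" "S \<subseteq> {0..t}" "0 \<le> t"
  shows "jumps g S \<in> borel_measurable (F t)"
  unfolding jumps_def[abs_def] using assms
  by (intro nn_integral_random_measure_measurable sets_\<mu> emeasure_\<mu>_adapted[of t]) (auto simp: space_F)

lemma jumps_mono: "S \<subseteq> S' \<Longrightarrow> jumps g S \<omega> \<le> jumps g S' \<omega>"
  unfolding jumps_def by (intro nn_integral_mono mult_left_mono) (auto simp: indicator_def)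

lemma space_predictable: "space (predictable M F) = space M \<times> {0..}"
  and predictable_gen0: "A \<in> sets (F 0) \<Longrightarrow> A \<times> {0} \<in> sets (predictable M F)"
  and predictable_gen: "0 \<le> s \<Longrightarrow> s \<le> t \<Longrightarrow> A \<in> sets (F s) \<Longrightarrow> A \<times> {s<..t} \<in> sets (predictable M F)"
proof -
  let ?G = "{A \<times> {0} | A. A \<in> sets (F 0)} \<union> {A \<times> {s<..t} | A s t. 0 \<le> s \<and> s \<le> t \<and> A \<in> sets (F s)}"
  have G: "?G \<subseteq> Pow (space M \<times> {0..})"
    using sets.sets_into_space[of _ "F _"] unfolding space_F by fastforce
  show "space (predictable M F) = space M \<times> {0..}"
    using G by (simp add: predictable_def space_measure_of)
  have "sets (predictable M F) = sigma_sets (space M \<times> {0..}) ?G"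
    using G by (simp add: predictable_def sets_measure_of)
  then show "A \<in> sets (F 0) \<Longrightarrow> A \<times> {0} \<in> sets (predictable M F)"
    "0 \<le> s \<Longrightarrow> s \<le> t \<Longrightarrow> A \<in> sets (F s) \<Longrightarrow> A \<times> {s<..t} \<in> sets (predictable M F)"
    by (auto intro!: sigma_sets.Basic)
qed

text \<open>
  Deterministic functions of time are predictable.
\<close>

lemma predictable_time [measurable]: "snd \<in> borel_measurable (predictable M F)"
proof (subst borel_measurable_iff_le, intro allI)
  fix c :: real
  have M: "space M \<in> sets (F 0)" using sets.top[of "F 0"] by (simp add: space_F)
  have "{p \<in> space (predictable M F). snd p \<le> c} = (if 0 \<le> c then space M \<times> {0} \<union> space M \<times> {0<..c} else {})"
    by (auto simp: space_predictable)
  also have "\<dots> \<in> sets (predictable M F)"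
    using M by (auto intro!: predictable_gen0 predictable_gen)
  finally show "{p \<in> space (predictable M F). snd p \<le> c} \<in> sets (predictable M F)" .
qed

text \<open>
  A strict upper level set of a function with values in \<open>{0..\<infinity>}\<close> avoids the zeros outside the
  interval, so it is a generator of the predictable sigma-algebra.
\<close>

lemma predictable_step:
  assumes Y: "Y \<in> borel_measurable (F s)" and s: "0 \<le> s" "s \<le> t"
  shows "(\<lambda>p. Y (fst p) * indicator {s<..t} (snd p) :: ennreal) \<in> borel_measurable (predictable M F)"
proof (rule borel_measurableI_greater)
  fix c :: ennreal
  have "{p \<in> space (predictable M F). c < Y (fst p) * indicator {s<..t} (snd p)} = {\<omega> \<in> space (F s). c < Y \<omega>} \<times> {s<..t}"
    using s by (auto simp: space_predictable space_F indicator_def split: if_splits)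
  also have "\<dots> \<in> sets (predictable M F)"
    using Y s by (intro predictable_gen) auto
  finally show "{p \<in> space (predictable M F). c < Y (fst p) * indicator {s<..t} (snd p)} \<in> sets (predictable M F)" .
qed

lemma nn_integral_levy_compensator:
  assumes [measurable]: "v \<in> borel_measurable borel" "h \<in> borel_measurable borel"
  shows "(\<integral>\<^sup>+p. v (fst p) * h (snd p) \<partial>levy_compensator \<Lambda>) = (\<integral>\<^sup>+r. v r * indicator {0..} r \<partial>lborel) * (integral\<^sup>N \<Lambda> h)"
proof -
  have "(\<integral>\<^sup>+p. v (fst p) * h (snd p) \<partial>levy_compensator \<Lambda>)
      = (\<integral>\<^sup>+r. (\<integral>\<^sup>+x. v r * h x \<partial>\<Lambda>) \<partial>density lborel (indicator {0..}))"
    unfolding levy_compensator_def by (subst \<Lambda>.nn_integral_fst[symmetric]) auto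
  also have "\<dots> = (\<integral>\<^sup>+r. v r * (integral\<^sup>N \<Lambda> h) \<partial>density lborel (indicator {0..}))"
    by (simp add: nn_integral_cmult)
  also have "\<dots> = (\<integral>\<^sup>+r. v r \<partial>density lborel (indicator {0..})) * (integral\<^sup>N \<Lambda> h)"
    by (simp add: nn_integral_multc)
  also have "(\<integral>\<^sup>+r. v r \<partial>density lborel (indicator {0..})) = (\<integral>\<^sup>+r. v r * indicator {0..} r \<partial>lborel)"
    by (subst nn_integral_density) (auto simp: mult.commute)
  finally show ?thesis .
qed

text \<open>
  The compensator formula for integrands \<open>V(\<omega>, s) h(x)\<close>, with the integral over the product
  compensator carried out. Joint measurability of \<open>V\<close> lets the integral of \<open>h\<close> leave the expectation.
\<close>

lemma expectation_predictable:
  assumes V: "V \<in> borel_measurable (predictable M F)" and h[measurable]: "h \<in> borel_measurable borel"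
    and V'[measurable]: "V \<in> borel_measurable (M \<Otimes>\<^sub>M lborel)"
    and supp: "\<And>\<omega> r. r < 0 \<Longrightarrow> V (\<omega>, r) = 0"
  shows "(\<integral>\<^sup>+\<omega>. (\<integral>\<^sup>+p. V (\<omega>, fst p) * h (snd p) \<partial>\<mu> \<omega>) \<partial>M) = (\<integral>\<^sup>+\<omega>. (\<integral>\<^sup>+r. V (\<omega>, r) \<partial>lborel) \<partial>M) * (integral\<^sup>N \<Lambda> h)"
proof -
  let ?W = "\<lambda>p. V (fst p) * h (snd p)"
  have W: "?W \<in> borel_measurable (predictable M F \<Otimes>\<^sub>M (borel :: real measure))"
    using V by measurable
  have ind: "V (\<omega>, fst p) * h (snd p) * indicator ({0..} \<times> UNIV) p = V (\<omega>, fst p) * h (snd p)" for \<omega> and p :: "real \<times> real"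
    using supp[of "fst p" \<omega>] by (auto simp: indicator_def mem_Times_iff)
  have "(\<integral>\<^sup>+\<omega>. (\<integral>\<^sup>+p. V (\<omega>, fst p) * h (snd p) \<partial>\<mu> \<omega>) \<partial>M) = (\<integral>\<^sup>+\<omega>. (\<integral>\<^sup>+p. V (\<omega>, fst p) * h (snd p) \<partial>levy_compensator \<Lambda>) \<partial>M)"
    using compensator[unfolded deterministic_compensator_def, rule_format, OF W] by (simp add: ind)
  also have "\<dots> = (\<integral>\<^sup>+\<omega>. (\<integral>\<^sup>+r. V (\<omega>, r) \<partial>lborel) * (integral\<^sup>N \<Lambda> h) \<partial>M)"
  proof (rule nn_integral_cong)
    fix \<omega> assume \<omega>: "\<omega> \<in> space M"
    have "(\<integral>\<^sup>+r. V (\<omega>, r) * indicator {0..} r \<partial>lborel) = (\<integral>\<^sup>+r. V (\<omega>, r) \<partial>lborel)"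
      using supp by (intro nn_integral_cong) (auto simp: indicator_def)
    then show "(\<integral>\<^sup>+p. V (\<omega>, fst p) * h (snd p) \<partial>levy_compensator \<Lambda>) = (\<integral>\<^sup>+r. V (\<omega>, r) \<partial>lborel) * (integral\<^sup>N \<Lambda> h)"
      using nn_integral_levy_compensator[OF _ h, of "\<lambda>r. V (\<omega>, r)"] measurable_compose[OF measurable_Pair1'[OF \<omega>] V'] by simp
  qed
  also have "\<dots> = (\<integral>\<^sup>+\<omega>. (\<integral>\<^sup>+r. V (\<omega>, r) \<partial>lborel) \<partial>M) * (integral\<^sup>N \<Lambda> h)"
    by (rule nn_integral_multc) measurable
  finally show ?thesis .
qed

text \<open>
  An \<open>F s\<close>-measurable factor is a predictable integrand on \<open>{s<..t}\<close>. Hence, in expectation, later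
  jumps multiply with the past as if they were independent of it.
\<close>

lemma expectation_jumps_adapted:
  assumes Y: "Y \<in> borel_measurable (F s)" and s: "0 \<le> s" "s \<le> t" and h[measurable]: "h \<in> borel_measurable borel"
  shows "(\<integral>\<^sup>+\<omega>. Y \<omega> * jumps h {s<..t} \<omega> \<partial>M) = (\<integral>\<^sup>+\<omega>. Y \<omega> \<partial>M) * ennreal (t - s) * (integral\<^sup>N \<Lambda> h)"
proof -
  let ?V = "\<lambda>p. Y (fst p) * indicator {s<..t} (snd p) :: ennreal"
  have [measurable]: "Y \<in> borel_measurable M" by (rule F_measurable_M[OF Y])
  have "(\<integral>\<^sup>+\<omega>. Y \<omega> * jumps h {s<..t} \<omega> \<partial>M) = (\<integral>\<^sup>+\<omega>. (\<integral>\<^sup>+p. ?V (\<omega>, fst p) * h (snd p) \<partial>\<mu> \<omega>) \<partial>M)"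
  proof (rule nn_integral_cong)
    fix \<omega> assume \<omega>: "\<omega> \<in> space M"
    note [measurable_cong] = sets_\<mu>[OF \<omega>]
    show "Y \<omega> * jumps h {s<..t} \<omega> = (\<integral>\<^sup>+p. ?V (\<omega>, fst p) * h (snd p) \<partial>\<mu> \<omega>)"
      unfolding jumps_def
      by (subst nn_integral_cmult[symmetric]) (auto intro!: nn_integral_cong simp: indicator_def mem_Times_iff)
  qed
  also have "\<dots> = (\<integral>\<^sup>+\<omega>. (\<integral>\<^sup>+r. ?V (\<omega>, r) \<partial>lborel) \<partial>M) * (integral\<^sup>N \<Lambda> h)"
    using s by (intro expectation_predictable predictable_step Y h) (auto simp: indicator_def)
  also have "(\<integral>\<^sup>+\<omega>. (\<integral>\<^sup>+r. ?V (\<omega>, r) \<partial>lborel) \<partial>M) = (\<integral>\<^sup>+\<omega>. Y \<omega> * ennreal (t - s) \<partial>M)"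
    using s by (intro nn_integral_cong) (simp add: nn_integral_cmult_indicator)
  also have "\<dots> = (\<integral>\<^sup>+\<omega>. Y \<omega> \<partial>M) * ennreal (t - s)"
    by (rule nn_integral_multc) measurable
  finally show ?thesis .
qed

lemma expectation_jumps:
  assumes S[measurable]: "S \<in> sets borel" "S \<subseteq> {0..}" and h[measurable]: "h \<in> borel_measurable borel"
  shows "(\<integral>\<^sup>+\<omega>. jumps h S \<omega> \<partial>M) = emeasure lborel S * (integral\<^sup>N \<Lambda> h)"
proof -
  let ?V = "\<lambda>p. indicator S (snd p) :: ennreal"
  have "(\<integral>\<^sup>+\<omega>. jumps h S \<omega> \<partial>M) = (\<integral>\<^sup>+\<omega>. (\<integral>\<^sup>+p. ?V (\<omega>, fst p) * h (snd p) \<partial>\<mu> \<omega>) \<partial>M)"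
    unfolding jumps_def by (intro nn_integral_cong) (auto simp: indicator_def mem_Times_iff)
  also have "\<dots> = (\<integral>\<^sup>+\<omega>. (\<integral>\<^sup>+r. ?V (\<omega>, r) \<partial>lborel) \<partial>M) * (integral\<^sup>N \<Lambda> h)"
    using S(2) by (intro expectation_predictable h) (auto simp: indicator_def)
  finally show ?thesis by (simp add: emeasure_space_1)
qed

text \<open>
  This writes the sum over the jumps strictly before \<open>s\<close> as a countable supremum of predictable
  steps: the sums over \<open>{0<..c}\<close> increase to it when rational \<open>c\<close> increase to \<open>s\<close>.
\<close>

lemma jumps_left_limit:
  assumes g[measurable]: "g \<in> borel_measurable borel" and \<omega>: "\<omega> \<in> space M"
  shows "(SUP c\<in>{c\<in>\<rat>. 0 \<le> c \<and> c \<le> t}. jumps g {0<..c} \<omega> * indicator {c<..t} s) = jumps g {0<..<s} \<omega> * indicator {0<..t} s"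
proof (cases "s \<in> {0<..t}")
  case False
  then have "indicator {c<..t} s = (0 :: ennreal)" if "0 \<le> c" for c using that by (auto simp: indicator_def)
  then have "(SUP c\<in>{c\<in>\<rat>. 0 \<le> c \<and> c \<le> t}. jumps g {0<..c} \<omega> * indicator {c<..t} s) = (SUP c\<in>{c\<in>\<rat>. 0 \<le> c \<and> c \<le> t}. 0)"
    by (intro SUP_cong) auto
  also have "\<dots> = 0" by (intro antisym SUP_least) auto
  finally show ?thesis using False by simp
next
  case True
  let ?S = "SUP c\<in>{c\<in>\<rat>. 0 \<le> c \<and> c \<le> t}. jumps g {0<..c} \<omega> * indicator {c<..t} s"
  note [measurable_cong] = sets_\<mu>[OF \<omega>]
  have "\<exists>c\<in>\<rat>. s - s / real (Suc k) < c \<and> c < s - s / real (Suc (Suc k))" for k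
    using True by (intro Rats_dense_in_real) (auto intro!: divide_strict_left_mono)
  then obtain c where c: "\<And>k. c k \<in> \<rat>" "\<And>k. s - s / real (Suc k) < c k" "\<And>k. c k < s - s / real (Suc (Suc k))"
    by metis
  have c0: "0 \<le> c k" "c k < s" for k
  proof -
    have "s / real (Suc k) \<le> s" "0 < s / real (Suc (Suc k))" using True by (auto simp: field_simps)
    then show "0 \<le> c k" "c k < s" using c(2)[of k] c(3)[of k] by linarith+
  qed
  have mono: "incseq c"
    using c by (intro incseq_SucI) (metis less_trans less_imp_le)
  have lim: "c \<longlonglongrightarrow> s"
  proof (rule real_tendsto_sandwich[of "\<lambda>k. s - s / real (Suc k)" _ _ "\<lambda>_. s"])
    have "(\<lambda>k. s - s * inverse (real (Suc k))) \<longlonglongrightarrow> s - s * 0"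
      by (intro tendsto_intros LIMSEQ_inverse_real_of_nat)
    then show "(\<lambda>k. s - s / real (Suc k)) \<longlonglongrightarrow> s" by (simp add: divide_inverse)
  qed (use c c0 in \<open>auto intro!: always_eventually less_imp_le\<close>)
  have un: "(SUP k. indicator ({0<..c k} \<times> UNIV) p) = (indicator ({0<..<s} \<times> UNIV) p :: ennreal)" for p :: "real \<times> real"
  proof (cases "p \<in> {0<..<s} \<times> UNIV")
    case True
    then have "eventually (\<lambda>k. fst p < c k) sequentially" by (intro order_tendstoD[OF lim]) auto
    then obtain k where "fst p < c k" by (auto simp: eventually_sequentially)
    then have "indicator ({0<..c k} \<times> UNIV) p = (1::ennreal)" using True by (auto simp: indicator_def mem_Times_iff)
    moreover have "indicator ({0<..c k} \<times> UNIV) p \<le> (SUP k. indicator ({0<..c k} \<times> UNIV) p :: ennreal)"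
      by (rule SUP_upper) simp
    moreover have "(SUP k. indicator ({0<..c k} \<times> UNIV) p) \<le> (1::ennreal)"
      by (rule SUP_least) (simp add: indicator_def)
    ultimately have "(SUP k. indicator ({0<..c k} \<times> UNIV) p) = (1::ennreal)"
      by (metis order_antisym)
    then show ?thesis using True by simp
  next
    case False
    then have "indicator ({0<..c k} \<times> UNIV) p = (0::ennreal)" for k
      using c0[of k] by (auto simp: indicator_def mem_Times_iff)
    then show ?thesis using False by simp
  qed
  have "jumps g {0<..<s} \<omega> = (\<integral>\<^sup>+p. (SUP k. g (snd p) * indicator ({0<..c k} \<times> UNIV) p) \<partial>\<mu> \<omega>)"
    unfolding jumps_def by (intro nn_integral_cong) (simp add: SUP_mult_left_ennreal[symmetric] un)
  also have "\<dots> = (SUP k. jumps g {0<..c k} \<omega>)"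
    unfolding jumps_def
  proof (intro nn_integral_monotone_convergence_SUP)
    show "incseq (\<lambda>k p. g (snd p) * indicator ({0<..c k} \<times> UNIV) p)"
    proof (intro incseq_SucI le_funI mult_left_mono)
      fix k and p :: "real \<times> real"
      show "indicator ({0<..c k} \<times> UNIV) p \<le> (indicator ({0<..c (Suc k)} \<times> UNIV) p :: ennreal)"
        using incseq_SucD[OF mono, of k] by (cases p) (simp add: indicator_def)
    qed simp
  qed measurable
  also have "\<dots> \<le> ?S"
  proof (rule SUP_least)
    fix k
    have "jumps g {0<..c k} \<omega> = jumps g {0<..c k} \<omega> * indicator {c k<..t} s" using c0[of k] True by auto
    also have "\<dots> \<le> ?S"
      using c(1) c0[of k] True by (intro SUP_upper) auto
    finally show "jumps g {0<..c k} \<omega> \<le> ?S" .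
  qed
  finally have "jumps g {0<..<s} \<omega> \<le> ?S" .
  moreover have "?S \<le> jumps g {0<..<s} \<omega>"
  proof (rule SUP_least)
    fix c
    show "jumps g {0<..c} \<omega> * indicator {c<..t} s \<le> jumps g {0<..<s} \<omega>"
    proof (cases "c < s")
      case True
      then have "jumps g {0<..c} \<omega> \<le> jumps g {0<..<s} \<omega>" by (intro jumps_mono) auto
      then show ?thesis by (auto simp: indicator_def)
    qed simp
  qed
  ultimately have "?S = jumps g {0<..<s} \<omega>"
    by (intro order_antisym)
  then show ?thesis using True by simp
qed

text \<open>
  The expected sum over pairs of jumps of which the first comes strictly earlier. The left limit is
  predictable, its expectation at time \<open>r\<close> is \<open>r\<close> times the integral of \<open>g\<close>, and \<open>\<integral>\<^sub>0\<^sup>t r dr = t\<^sup>2 / 2\<close>.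
\<close>

lemma expectation_jumps_before:
  assumes g[measurable]: "g \<in> borel_measurable borel" and h[measurable]: "h \<in> borel_measurable borel" and t: "0 \<le> t"
  shows "(\<integral>\<^sup>+\<omega>. (\<integral>\<^sup>+q. jumps g {0<..<fst q} \<omega> * indicator {0<..t} (fst q) * h (snd q) \<partial>\<mu> \<omega>) \<partial>M)
    = ennreal (t\<^sup>2 / 2) * (integral\<^sup>N \<Lambda> g) * (integral\<^sup>N \<Lambda> h)"
proof -
  interpret P: pair_sigma_finite M lborel by unfold_locales
  let ?C = "{c\<in>\<rat>. 0 \<le> c \<and> c \<le> t}"
  have C: "countable ?C" by (intro countable_subset[OF _ countable_rat]) auto
  define V where "V p = (SUP c\<in>?C. jumps g {0<..c} (fst p) * indicator {c<..t} (snd p))" for p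
  have V_eq: "V (\<omega>, s) = jumps g {0<..<s} \<omega> * indicator {0<..t} s" if "\<omega> \<in> space M" for \<omega> s
    unfolding V_def using jumps_left_limit[OF g that] by simp
  have Vp: "V \<in> borel_measurable (predictable M F)"
    unfolding V_def[abs_def] using C
    by (intro borel_measurable_SUP predictable_step jumps_adapted) auto
  have Vm[measurable]: "V \<in> borel_measurable (M \<Otimes>\<^sub>M lborel)"
    unfolding V_def[abs_def] using C jumps_measurable[OF g]
    by (intro borel_measurable_SUP) auto
  have "(\<integral>\<^sup>+\<omega>. (\<integral>\<^sup>+q. jumps g {0<..<fst q} \<omega> * indicator {0<..t} (fst q) * h (snd q) \<partial>\<mu> \<omega>) \<partial>M)
     = (\<integral>\<^sup>+\<omega>. (\<integral>\<^sup>+q. V (\<omega>, fst q) * h (snd q) \<partial>\<mu> \<omega>) \<partial>M)"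
    by (intro nn_integral_cong) (simp add: V_eq)
  also have "\<dots> = (\<integral>\<^sup>+\<omega>. (\<integral>\<^sup>+r. V (\<omega>, r) \<partial>lborel) \<partial>M) * (integral\<^sup>N \<Lambda> h)"
  proof (intro expectation_predictable Vp Vm h)
    fix \<omega> and r :: real assume "r < 0"
    then have "V (\<omega>, r) = (SUP c\<in>?C. 0 :: ennreal)" unfolding V_def by (intro SUP_cong) auto
    also have "\<dots> = 0" by (intro antisym SUP_least) auto
    finally show "V (\<omega>, r) = 0" .
  qed
  also have "(\<integral>\<^sup>+\<omega>. (\<integral>\<^sup>+r. V (\<omega>, r) \<partial>lborel) \<partial>M) = (\<integral>\<^sup>+r. (\<integral>\<^sup>+\<omega>. V (\<omega>, r) \<partial>M) \<partial>lborel)"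
    by (rule P.Fubini'[symmetric]) simp
  also have "\<dots> = (\<integral>\<^sup>+r. ennreal r * indicator {0..t} r * (integral\<^sup>N \<Lambda> g) \<partial>lborel)"
  proof (intro nn_integral_cong)
    fix r :: real
    have "(\<integral>\<^sup>+\<omega>. V (\<omega>, r) \<partial>M) = (\<integral>\<^sup>+\<omega>. jumps g {0<..<r} \<omega> \<partial>M) * indicator {0<..t} r"
      using jumps_measurable[OF g] by (simp add: V_eq nn_integral_multc cong: nn_integral_cong)
    also have "\<dots> = ennreal r * indicator {0..t} r * (integral\<^sup>N \<Lambda> g)"
    proof (cases "r \<in> {0<..t}")
      case True
      then have "(\<integral>\<^sup>+\<omega>. jumps g {0<..<r} \<omega> \<partial>M) = ennreal r * (integral\<^sup>N \<Lambda> g)"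
        by (subst expectation_jumps) auto
      then show ?thesis using True by simp
    next
      case False
      then show ?thesis by (auto simp: indicator_def)
    qed
    finally show "(\<integral>\<^sup>+\<omega>. V (\<omega>, r) \<partial>M) = ennreal r * indicator {0..t} r * (integral\<^sup>N \<Lambda> g)" .
  qed
  also have "\<dots> = (\<integral>\<^sup>+r. ennreal r * indicator {0..t} r \<partial>lborel) * (integral\<^sup>N \<Lambda> g)"
    by (rule nn_integral_multc) measurable
  also have "(\<integral>\<^sup>+r. ennreal r * indicator {0..t} r \<partial>lborel) = ennreal (t\<^sup>2 / 2 - 0\<^sup>2 / 2)"
    using t by (intro nn_integral_FTC_Icc) (auto intro!: derivative_eq_intros)
  finally show ?thesis by simp
qed

end

section \<open>Second moments of the jumps\<close>

context levy_jump_measure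
begin

lemma AE_jumps_finite:
  assumes u: "u \<in> borel_measurable borel" "(integral\<^sup>N \<Lambda> u) < \<infinity>" and t: "0 \<le> t"
  shows "AE \<omega> in M. jumps u {0<..t} \<omega> \<noteq> \<infinity>"
proof -
  have "(\<integral>\<^sup>+\<omega>. jumps u {0<..t} \<omega> \<partial>M) < \<infinity>"
    using t u by (subst expectation_jumps) (auto simp: ennreal_mult_less_top)
  then show ?thesis using u by (intro nn_integral_PInf_AE jumps_measurable) auto
qed

lemma AE_finite_jump_count:
  assumes A[measurable]: "A \<in> sets borel" and fin: "emeasure \<Lambda> A < \<infinity>" and t: "0 \<le> t"
  shows "AE \<omega> in M. emeasure (\<mu> \<omega>) ({0<..t} \<times> A) < \<infinity>"
proof -
  have "AE \<omega> in M. jumps (indicator A) {0<..t} \<omega> \<noteq> \<infinity>"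
    using fin t by (intro AE_jumps_finite) (auto simp: sets_\<Lambda>)
  then show ?thesis
    using AE_space
  proof eventually_elim
    case (elim \<omega>)
    have "{0<..t} \<times> A \<in> sets (borel :: (real \<times> real) measure)" by (simp flip: borel_prod)
    moreover have "jumps (indicator A) {0<..t} \<omega> = (\<integral>\<^sup>+p. indicator ({0<..t} \<times> A) p \<partial>\<mu> \<omega>)"
      unfolding jumps_def by (intro nn_integral_cong) (auto simp: indicator_def mem_Times_iff)
    ultimately show ?case using elim sets_\<mu>[of \<omega>] by (simp add: less_top)
  qed
qed

text \<open>
  On \<open>{0<..t} \<times> A\<close> the random measure is finite and integer-valued, so
  \<open>nn_integral_mult_time_split\<close> applies to its restriction. The two sums over ordered pairs coincide.
\<close>

lemma jumps_square:
  assumes A[measurable]: "A \<in> sets borel" and fin: "emeasure (\<mu> \<omega>) ({0<..t} \<times> A) < \<infinity>" and \<omega>: "\<omega> \<in> space M"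
    and g[measurable]: "g \<in> borel_measurable borel" and gA: "\<And>x. x \<notin> A \<Longrightarrow> g x = 0"
  shows "jumps g {0<..t} \<omega> * jumps g {0<..t} \<omega> = jumps (\<lambda>x. g x * g x) {0<..t} \<omega>
     + 2 * (\<integral>\<^sup>+q. jumps g {0<..<fst q} \<omega> * indicator {0<..t} (fst q) * g (snd q) \<partial>\<mu> \<omega>)"
proof -
  note [measurable_cong] = sets_\<mu>[OF \<omega>]
  let ?K = "{0<..t} \<times> A"
  have K[measurable]: "?K \<in> sets (borel :: (real \<times> real) measure)" by (simp flip: borel_prod)
  define m where "m = density (\<mu> \<omega>) (indicator ?K)"
  have sets_m: "sets m = sets borel" by (simp add: m_def sets_\<mu>[OF \<omega>])
  have em: "emeasure m B = emeasure (\<mu> \<omega>) (?K \<inter> B)" if "B \<in> sets borel" for B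
    unfolding m_def using that \<omega> K
    by (subst emeasure_density) (auto simp: sets_\<mu> nn_integral_indicator[symmetric] indicator_inter_arith intro!: nn_integral_cong simp del: nn_integral_indicator)
  have fin_m: "finite_measure m"
  proof
    show "emeasure m (space m) \<noteq> \<infinity>"
      using fin em[of UNIV] sets_eq_imp_space_eq[OF sets_m] by simp
  qed
  have int_m: "emeasure m B \<in> insert \<infinity> (range of_nat)" if "B \<in> sets borel" for B
    using that em[OF that] emeasure_\<mu>_integer[OF \<omega>, of "?K \<inter> B"] by simp
  have one_m: "emeasure m ({s} \<times> UNIV) \<le> 1" for s
  proof -
    have S: "{s} \<times> (UNIV :: real set) \<in> sets (borel :: (real \<times> real) measure)" by (simp flip: borel_prod)
    have "emeasure m ({s} \<times> UNIV) \<le> emeasure (\<mu> \<omega>) ({s} \<times> UNIV)"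
      unfolding em[OF S] using S by (intro emeasure_mono) (auto simp: sets_\<mu>[OF \<omega>])
    also have "\<dots> \<le> 1" by (rule emeasure_\<mu>_time[OF \<omega>])
    finally show ?thesis .
  qed
  have int_eq: "(\<integral>\<^sup>+p. f p \<partial>m) = (\<integral>\<^sup>+p. indicator ?K p * f p \<partial>\<mu> \<omega>)" if "f \<in> borel_measurable borel" for f
    unfolding m_def using that by (intro nn_integral_density) (auto simp: measurable_cong_sets[OF sets_\<mu>[OF \<omega>] refl])
  have j: "(\<integral>\<^sup>+p. f (snd p) \<partial>m) = jumps f {0<..t} \<omega>" if [measurable]: "f \<in> borel_measurable borel" and "\<And>x. x \<notin> A \<Longrightarrow> f x = 0" for f
    unfolding jumps_def using that(2) by (subst int_eq) (auto intro!: nn_integral_cong simp: indicator_def mem_Times_iff)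
  have j': "(\<integral>\<^sup>+q. g (snd q) * (\<integral>\<^sup>+p. g (snd p) * indicator {..<fst q} (fst p) \<partial>m) \<partial>m)
     = (\<integral>\<^sup>+q. jumps g {0<..<fst q} \<omega> * indicator {0<..t} (fst q) * g (snd q) \<partial>\<mu> \<omega>)"
  proof -
    interpret m: finite_measure m by (rule fin_m)
    have [measurable]: "(\<lambda>q :: real \<times> real. \<integral>\<^sup>+p. g (snd p) * indicator {..<fst q} (fst p) \<partial>m) \<in> borel_measurable borel"
    proof -
      let ?B = "(borel :: (real \<times> real) measure) \<Otimes>\<^sub>M m"
      have id: "(\<lambda>p. p) \<in> measurable m borel" by (rule measurable_ident_sets) (rule sets_m)
      have m1: "(\<lambda>x. fst (fst x)) \<in> borel_measurable ?B"
        by (rule measurable_compose[OF measurable_fst fst_borel_measurable])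
      have m2: "(\<lambda>x. fst (snd x)) \<in> borel_measurable ?B"
        by (rule measurable_compose[OF measurable_compose[OF measurable_snd id] fst_borel_measurable])
      have m3: "(\<lambda>x. g (snd (snd x))) \<in> borel_measurable ?B"
        by (rule measurable_compose[OF measurable_compose[OF measurable_compose[OF measurable_snd id] snd_borel_measurable] g])
      have "(\<lambda>x. if fst (snd x) < fst (fst x) then g (snd (snd x)) else 0) \<in> borel_measurable ?B"
        by (intro measurable_If m3 borel_measurable_const borel_measurable_less[OF m2 m1])
      from m.borel_measurable_nn_integral_fst[OF this]
      have "(\<lambda>q :: real \<times> real. \<integral>\<^sup>+p. (if fst p < fst q then g (snd p) else 0) \<partial>m) \<in> borel_measurable borel"
        unfolding fst_conv snd_conv .
      also have "(\<lambda>q. \<integral>\<^sup>+p. (if fst p < fst q then g (snd p) else 0) \<partial>m) = (\<lambda>q. \<integral>\<^sup>+p. g (snd p) * indicator {..<fst q} (fst p) \<partial>m)"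
        by (intro ext nn_integral_cong) (auto simp: indicator_def)
      finally show ?thesis .
    qed
    have "(\<integral>\<^sup>+q. g (snd q) * (\<integral>\<^sup>+p. g (snd p) * indicator {..<fst q} (fst p) \<partial>m) \<partial>m)
       = (\<integral>\<^sup>+q. indicator ?K q * (g (snd q) * (\<integral>\<^sup>+p. g (snd p) * indicator {..<fst q} (fst p) \<partial>m)) \<partial>\<mu> \<omega>)"
      by (rule int_eq) measurable
    also have "\<dots> = (\<integral>\<^sup>+q. jumps g {0<..<fst q} \<omega> * indicator {0<..t} (fst q) * g (snd q) \<partial>\<mu> \<omega>)"
    proof (rule nn_integral_cong)
      fix q :: "real \<times> real"
      show "indicator ?K q * (g (snd q) * (\<integral>\<^sup>+p. g (snd p) * indicator {..<fst q} (fst p) \<partial>m)) =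
          jumps g {0<..<fst q} \<omega> * indicator {0<..t} (fst q) * g (snd q)"
      proof (cases "q \<in> ?K")
        case True
        have "(\<integral>\<^sup>+p. g (snd p) * indicator {..<fst q} (fst p) \<partial>m) = jumps g {0<..<fst q} \<omega>"
          unfolding jumps_def using gA True
          by (subst int_eq) (auto intro!: nn_integral_cong simp: indicator_def mem_Times_iff)
        then show ?thesis using True by (simp add: mem_Times_iff mult.commute)
      next
        case False
        then show ?thesis using gA[of "snd q"] by (auto simp: mem_Times_iff)
      qed
    qed
    finally show ?thesis .
  qed
  let ?P = "\<integral>\<^sup>+q. g (snd q) * (\<integral>\<^sup>+p. g (snd p) * indicator {..<fst q} (fst p) \<partial>m) \<partial>m"
  have "jumps g {0<..t} \<omega> * jumps g {0<..t} \<omega> = (\<integral>\<^sup>+p. g (snd p) \<partial>m) * (\<integral>\<^sup>+p. g (snd p) \<partial>m)"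
    using gA by (simp add: j)
  also have "\<dots> = (\<integral>\<^sup>+p. g (snd p) * g (snd p) \<partial>m) + ?P + ?P"
  proof (rule nn_integral_mult_time_split[OF fin_m sets_m _ one_m])
    show "\<And>B. B \<in> sets borel \<Longrightarrow> emeasure m B \<in> insert \<infinity> (range of_nat)" by (rule int_m)
  qed measurable
  also have "(\<integral>\<^sup>+p. g (snd p) * g (snd p) \<partial>m) = jumps (\<lambda>x. g x * g x) {0<..t} \<omega>"
    using gA by (intro j) auto
  finally show ?thesis by (simp add: j' mult_2 add.assoc)
qed

text \<open>
  The expectation of \<open>jumps_square\<close>. Expectations of nonnegative functions add up only if these are
  measurable, which is not evident for the sum over ordered pairs. It is almost surely the
  difference \<open>R\<close> of two measurable functions, divided by 2; finiteness of the sum of \<open>g\<^sup>2\<close> makes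
  this subtraction legitimate.
\<close>

lemma expectation_jumps_square:
  assumes A: "A \<in> sets borel" "emeasure \<Lambda> A < \<infinity>" and t: "0 \<le> t"
    and g[measurable]: "g \<in> borel_measurable borel" and gA: "\<And>x. x \<notin> A \<Longrightarrow> g x = 0"
    and fin: "(\<integral>\<^sup>+x. g x * g x \<partial>\<Lambda>) < \<infinity>"
  shows "(\<integral>\<^sup>+\<omega>. jumps g {0<..t} \<omega> * jumps g {0<..t} \<omega> \<partial>M)
    = ennreal t * (\<integral>\<^sup>+x. g x * g x \<partial>\<Lambda>) + ennreal (t\<^sup>2) * (integral\<^sup>N \<Lambda> g) * (integral\<^sup>N \<Lambda> g)"
proof -
  let ?G = "jumps g {0<..t}" and ?J = "jumps (\<lambda>x. g x * g x) {0<..t}"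
  let ?P = "\<lambda>\<omega>. \<integral>\<^sup>+q. jumps g {0<..<fst q} \<omega> * indicator {0<..t} (fst q) * g (snd q) \<partial>\<mu> \<omega>"
  have [measurable]: "?G \<in> borel_measurable M" "?J \<in> borel_measurable M"
    by (auto intro!: jumps_measurable)
  have eq: "AE \<omega> in M. ?G \<omega> * ?G \<omega> = ?J \<omega> + 2 * ?P \<omega>"
    using AE_finite_jump_count[OF A t] AE_space
    by eventually_elim (rule jumps_square[OF A(1) _ _ g gA])
  have EJ: "(\<integral>\<^sup>+\<omega>. ?J \<omega> \<partial>M) = ennreal t * (\<integral>\<^sup>+x. g x * g x \<partial>\<Lambda>)"
    using t by (subst expectation_jumps) auto
  have J_fin: "AE \<omega> in M. ?J \<omega> \<noteq> \<infinity>" by (rule AE_jumps_finite[OF _ fin t]) measurable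
  define R where "R \<omega> = (?G \<omega> * ?G \<omega> - ?J \<omega>) / 2" for \<omega>
  have [measurable]: "R \<in> borel_measurable M" unfolding R_def by measurable
  have RP: "AE \<omega> in M. R \<omega> = ?P \<omega>"
    using eq J_fin
  proof eventually_elim
    case (elim \<omega>)
    then have "?G \<omega> * ?G \<omega> - ?J \<omega> = 2 * ?P \<omega>" by simp
    moreover have "2 * x / 2 = x" for x :: ennreal
      using ennreal_mult_divide_eq[of 2 x] by (simp add: mult.commute)
    ultimately show ?case unfolding R_def by (simp only:)
  qed
  have "(\<integral>\<^sup>+\<omega>. ?G \<omega> * ?G \<omega> \<partial>M) = (\<integral>\<^sup>+\<omega>. ?J \<omega> + 2 * R \<omega> \<partial>M)"
    using eq RP by (intro nn_integral_cong_AE) auto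
  also have "\<dots> = (\<integral>\<^sup>+\<omega>. ?J \<omega> \<partial>M) + 2 * (\<integral>\<^sup>+\<omega>. R \<omega> \<partial>M)"
    by (simp add: nn_integral_add nn_integral_cmult)
  also have "(\<integral>\<^sup>+\<omega>. R \<omega> \<partial>M) = (\<integral>\<^sup>+\<omega>. ?P \<omega> \<partial>M)"
    using RP by (rule nn_integral_cong_AE)
  also have "\<dots> = ennreal (t\<^sup>2 / 2) * (integral\<^sup>N \<Lambda> g) * (integral\<^sup>N \<Lambda> g)"
    by (rule expectation_jumps_before[OF g g t])
  also have "2 * (ennreal (t\<^sup>2 / 2) * (integral\<^sup>N \<Lambda> g) * (integral\<^sup>N \<Lambda> g)) = ennreal (t\<^sup>2) * (integral\<^sup>N \<Lambda> g) * (integral\<^sup>N \<Lambda> g)"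
  proof -
    have "2 * ennreal (t\<^sup>2 / 2) = ennreal 2 * ennreal (t\<^sup>2 / 2)" by simp
    also have "\<dots> = ennreal (t\<^sup>2)" by (subst ennreal_mult[symmetric]) auto
    finally show ?thesis by (simp add: mult.assoc[symmetric])
  qed
  finally show ?thesis unfolding EJ .
qed

text \<open>
  For \<open>s \<le> t\<close> the sum up to \<open>t\<close> is the sum up to \<open>s\<close> plus later jumps, and these factor by
  \<open>expectation_jumps_adapted\<close>.
\<close>

lemma expectation_jumps_mult:
  assumes A: "A \<in> sets borel" "emeasure \<Lambda> A < \<infinity>" and s: "0 \<le> s" and t: "0 \<le> t"
    and g[measurable]: "g \<in> borel_measurable borel" and gA: "\<And>x. x \<notin> A \<Longrightarrow> g x = 0"
    and fin: "(\<integral>\<^sup>+x. g x * g x \<partial>\<Lambda>) < \<infinity>"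
  shows "(\<integral>\<^sup>+\<omega>. jumps g {0<..s} \<omega> * jumps g {0<..t} \<omega> \<partial>M)
    = ennreal (min s t) * (\<integral>\<^sup>+x. g x * g x \<partial>\<Lambda>) + ennreal (s * t) * (integral\<^sup>N \<Lambda> g) * (integral\<^sup>N \<Lambda> g)"
  using s t
proof (induction s t rule: linorder_wlog)
  case (sym s t)
  then show ?case by (simp add: mult.commute min.commute)
next
  case (le s t)
  then have s: "0 \<le> s" and t: "s \<le> t" by auto
  let ?I = "\<integral>\<^sup>+x. g x \<partial>\<Lambda>"
  have [measurable]: "jumps g S \<in> borel_measurable M" if "S \<in> sets borel" for S
    using that by (intro jumps_measurable) auto
  have split: "jumps g {0<..t} \<omega> = jumps g {0<..s} \<omega> + jumps g {s<..t} \<omega>" if \<omega>: "\<omega> \<in> space M" for \<omega>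
  proof -
    note [measurable_cong] = sets_\<mu>[OF \<omega>]
    show ?thesis
      unfolding jumps_def using s t
      by (subst nn_integral_add[symmetric]) (auto intro!: nn_integral_cong simp: indicator_def mem_Times_iff)
  qed
  have "(\<integral>\<^sup>+\<omega>. jumps g {0<..s} \<omega> * jumps g {0<..t} \<omega> \<partial>M) =
      (\<integral>\<^sup>+\<omega>. jumps g {0<..s} \<omega> * jumps g {0<..s} \<omega> + jumps g {0<..s} \<omega> * jumps g {s<..t} \<omega> \<partial>M)"
    by (intro nn_integral_cong) (simp add: split distrib_left)
  also have "\<dots> = (\<integral>\<^sup>+\<omega>. jumps g {0<..s} \<omega> * jumps g {0<..s} \<omega> \<partial>M) + (\<integral>\<^sup>+\<omega>. jumps g {0<..s} \<omega> * jumps g {s<..t} \<omega> \<partial>M)"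
    by (rule nn_integral_add) measurable
  also have "(\<integral>\<^sup>+\<omega>. jumps g {0<..s} \<omega> * jumps g {s<..t} \<omega> \<partial>M) = ennreal s * ?I * ennreal (t - s) * ?I"
  proof -
    have "(\<integral>\<^sup>+\<omega>. jumps g {0<..s} \<omega> \<partial>M) = ennreal s * ?I"
      using s by (subst expectation_jumps) auto
    then show ?thesis
      using s t by (subst expectation_jumps_adapted, intro jumps_adapted) auto
  qed
  also have "\<dots> = ennreal (s * (t - s)) * ?I * ?I"
    using s t by (simp add: ennreal_mult mult_ac)
  also have "(\<integral>\<^sup>+\<omega>. jumps g {0<..s} \<omega> * jumps g {0<..s} \<omega> \<partial>M) =
      ennreal s * (\<integral>\<^sup>+x. g x * g x \<partial>\<Lambda>) + ennreal (s\<^sup>2) * ?I * ?I"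
    by (rule expectation_jumps_square[OF A s g gA fin])
  finally have "(\<integral>\<^sup>+\<omega>. jumps g {0<..s} \<omega> * jumps g {0<..t} \<omega> \<partial>M) =
      ennreal s * (\<integral>\<^sup>+x. g x * g x \<partial>\<Lambda>) + (ennreal (s\<^sup>2) + ennreal (s * (t - s))) * ?I * ?I"
    by (simp add: distrib_right add.assoc)
  also have "ennreal (s\<^sup>2) + ennreal (s * (t - s)) = ennreal (s * t)"
    using s t mult_left_mono[OF t s] by (subst ennreal_plus[symmetric]) (auto simp: power2_eq_square algebra_simps)
  finally show ?case using t by (simp add: min_def)
qed

end

section \<open>Compensated sums of large jumps\<close>

lemma integrable_enn2real:
  assumes [measurable]: "f \<in> borel_measurable M" and fin: "(\<integral>\<^sup>+x. f x \<partial>M) < \<infinity>"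
  shows "integrable M (\<lambda>x. enn2real (f x))" and "(\<integral>x. enn2real (f x) \<partial>M) = enn2real (\<integral>\<^sup>+x. f x \<partial>M)"
proof -
  have "AE x in M. f x \<noteq> \<infinity>" using fin by (intro nn_integral_PInf_AE) auto
  then have eq: "(\<integral>\<^sup>+x. ennreal (enn2real (f x)) \<partial>M) = (\<integral>\<^sup>+x. f x \<partial>M)"
    by (intro nn_integral_cong_AE) (auto elim!: eventually_mono simp: ennreal_enn2real_if)
  show "integrable M (\<lambda>x. enn2real (f x))"
    using fin by (intro integrableI_bounded) (auto simp: eq)
  show "(\<integral>x. enn2real (f x) \<partial>M) = enn2real (\<integral>\<^sup>+x. f x \<partial>M)"
    by (subst integral_eq_nn_integral) (auto simp: eq)
qed

definition large :: "real \<Rightarrow> real set" where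
  "large e = {x. e < \<bar>x\<bar>}"

text \<open>
  The positive and the negative part of \<open>x\<close>, restricted to jumps of size larger than \<open>e\<close>; negative
  arguments of \<open>ennreal\<close> are cut off at 0.
\<close>

definition up_part :: "real \<Rightarrow> real \<Rightarrow> ennreal" where
  "up_part e x = ennreal (indicator (large e) x * x)"

definition down_part :: "real \<Rightarrow> real \<Rightarrow> ennreal" where
  "down_part e x = ennreal (- (indicator (large e) x * x))"

lemma large_borel [measurable]: "large e \<in> sets borel"
  unfolding large_def by measurable

lemma parts_measurable [measurable]: "up_part e \<in> borel_measurable borel" "down_part e \<in> borel_measurable borel"
  unfolding up_part_def[abs_def] down_part_def[abs_def] by measurable

text \<open>
  Markov's inequality for \<open>x\<^sup>2\<close>.
\<close>

lemma emeasure_large_finite: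
  assumes sets: "sets \<Lambda> = sets borel" and sq: "(\<integral>\<^sup>+x. ennreal (x\<^sup>2) \<partial>\<Lambda>) < \<infinity>" and e: "0 < e"
  shows "emeasure \<Lambda> (large e) < \<infinity>"
proof -
  note [measurable_cong] = sets
  have "emeasure \<Lambda> (large e) = (\<integral>\<^sup>+x. indicator (large e) x \<partial>\<Lambda>)"
    by (simp add: sets)
  also have "\<dots> \<le> (\<integral>\<^sup>+x. ennreal (1 / e\<^sup>2) * ennreal (x\<^sup>2) \<partial>\<Lambda>)"
  proof (rule nn_integral_mono)
    fix x
    show "indicator (large e) x \<le> ennreal (1 / e\<^sup>2) * ennreal (x\<^sup>2)"
    proof (cases "x \<in> large e")
      case True
      then have "e\<^sup>2 \<le> \<bar>x\<bar>\<^sup>2" using e by (intro power_mono) (auto simp: large_def)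
      then have "1 \<le> 1 / e\<^sup>2 * x\<^sup>2" using e by (simp add: field_simps)
      then have "ennreal 1 \<le> ennreal (1 / e\<^sup>2 * x\<^sup>2)" by (rule ennreal_leI)
      also have "\<dots> = ennreal (1 / e\<^sup>2) * ennreal (x\<^sup>2)" by (rule ennreal_mult) auto
      finally show ?thesis using True by simp
    qed simp
  qed
  also have "\<dots> = ennreal (1 / e\<^sup>2) * (\<integral>\<^sup>+x. ennreal (x\<^sup>2) \<partial>\<Lambda>)"
    by (rule nn_integral_cmult) measurable
  also have "\<dots> < \<infinity>" using sq by (simp add: ennreal_mult_less_top)
  finally show ?thesis .
qed

lemma sigma_finite_square_integrable:
  assumes sets: "sets \<Lambda> = sets borel" and sq: "(\<integral>\<^sup>+x. ennreal (x\<^sup>2) \<partial>\<Lambda>) < \<infinity>" and zero: "emeasure \<Lambda> {0} = 0"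
  shows "sigma_finite_measure \<Lambda>"
proof
  let ?A = "insert {0} (range (\<lambda>k. large (1 / real (Suc k))))"
  have un: "x \<in> \<Union>?A" for x
  proof (cases "x = 0")
    case False
    then obtain k where "inverse (real (Suc k)) < \<bar>x\<bar>" using reals_Archimedean[of "\<bar>x\<bar>"] by auto
    then have "x \<in> large (1 / real (Suc k))" by (simp add: large_def inverse_eq_divide)
    then show ?thesis by blast
  qed simp
  have fin: "emeasure \<Lambda> a \<noteq> \<infinity>" if a: "a \<in> ?A" for a
  proof -
    consider "a = {0}" | k where "a = large (1 / real (Suc k))" using a by blast
    then show ?thesis
    proof cases
      case 2
      then show ?thesis using emeasure_large_finite[OF sets sq, of "1 / real (Suc k)"] by simp
    qed (simp add: zero)
  qed
  show "\<exists>A. countable A \<and> A \<subseteq> sets \<Lambda> \<and> \<Union>A = space \<Lambda> \<and> (\<forall>a\<in>A. emeasure \<Lambda> a \<noteq> \<infinity>)"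
  proof (intro exI[of _ ?A] conjI ballI)
    show "\<Union>?A = space \<Lambda>" 
      unfolding sets_eq_imp_space_eq[OF sets] space_borel by (intro equalityI subset_UNIV subsetI un)
    show "?A \<subseteq> sets \<Lambda>" unfolding sets by auto
  qed (rule countable_insert, simp, rule fin)
qed

context levy_jump_measure
begin

definition centered_jumps :: "(real \<Rightarrow> ennreal) \<Rightarrow> real \<Rightarrow> 'w \<Rightarrow> real" where
  "centered_jumps g t \<omega> = enn2real (jumps g {0<..t} \<omega>) - t * enn2real (integral\<^sup>N \<Lambda> g)"

lemma centered_jumps_measurable:
  "g \<in> borel_measurable borel \<Longrightarrow> centered_jumps g t \<in> borel_measurable M"
  unfolding centered_jumps_def[abs_def] using jumps_measurable[of g "{0<..t}"] by simp

text \<open>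
  Centering removes the product of the means from \<open>expectation_jumps_mult\<close>; what is left is the
  covariance of a process with orthogonal increments.
\<close>

lemma centered_jumps_moments:
  assumes A: "A \<in> sets borel" "emeasure \<Lambda> A < \<infinity>"
    and g[measurable]: "g \<in> borel_measurable borel" and gA: "\<forall>x. x \<notin> A \<longrightarrow> g x = 0"
    and fin1: "(integral\<^sup>N \<Lambda> g) < \<infinity>" and fin2: "(\<integral>\<^sup>+x. g x * g x \<partial>\<Lambda>) < \<infinity>"
  shows "0 \<le> t \<Longrightarrow> integrable M (\<lambda>\<omega>. (centered_jumps g t \<omega>)\<^sup>2)"
    and "0 \<le> t \<Longrightarrow> integrable M (centered_jumps g t)"
    and "0 \<le> t \<Longrightarrow> expectation (centered_jumps g t) = 0"
    and "0 \<le> s \<Longrightarrow> 0 \<le> t \<Longrightarrow> expectation (\<lambda>\<omega>. centered_jumps g s \<omega> * centered_jumps g t \<omega>) = min s t * enn2real (\<integral>\<^sup>+x. g x * g x \<partial>\<Lambda>)"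
proof -
  let ?c = "enn2real (integral\<^sup>N \<Lambda> g)" and ?v = "enn2real (\<integral>\<^sup>+x. g x * g x \<partial>\<Lambda>)"
  let ?J = "\<lambda>t \<omega>. enn2real (jumps g {0<..t} \<omega>)"
  have jm[measurable]: "jumps g {0<..t} \<in> borel_measurable M" for t by (intro jumps_measurable) auto
  have E1: "(\<integral>\<^sup>+\<omega>. jumps g {0<..t} \<omega> \<partial>M) = ennreal t * (integral\<^sup>N \<Lambda> g)" if "0 \<le> t" for t
    using that by (subst expectation_jumps) auto
  have J1: "integrable M (?J t)" "expectation (?J t) = t * ?c" if "0 \<le> t" for t
    using integrable_enn2real[OF jm[of t]] fin1 that unfolding E1[OF that]
    by (auto simp: ennreal_mult_less_top enn2real_mult)
  have J2: "integrable M (\<lambda>\<omega>. ?J s \<omega> * ?J t \<omega>)" "expectation (\<lambda>\<omega>. ?J s \<omega> * ?J t \<omega>) = min s t * ?v + s * t * ?c * ?c"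
    if s: "0 \<le> s" and t: "0 \<le> t" for s t
  proof -
    have E: "(\<integral>\<^sup>+\<omega>. jumps g {0<..s} \<omega> * jumps g {0<..t} \<omega> \<partial>M) =
      ennreal (min s t) * (\<integral>\<^sup>+x. g x * g x \<partial>\<Lambda>) + ennreal (s * t) * (integral\<^sup>N \<Lambda> g) * (integral\<^sup>N \<Lambda> g)"
      by (rule expectation_jumps_mult[OF A s t g gA[rule_format] fin2])
    have f: "ennreal (min s t) * (\<integral>\<^sup>+x. g x * g x \<partial>\<Lambda>) < \<infinity>" "ennreal (s * t) * (integral\<^sup>N \<Lambda> g) * (integral\<^sup>N \<Lambda> g) < \<infinity>"
      using fin1 fin2 by (auto simp: ennreal_mult_less_top)
    have m: "(\<lambda>\<omega>. jumps g {0<..s} \<omega> * jumps g {0<..t} \<omega>) \<in> borel_measurable M" by measurable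
    have fin: "(\<integral>\<^sup>+\<omega>. jumps g {0<..s} \<omega> * jumps g {0<..t} \<omega> \<partial>M) < \<infinity>"
      unfolding E using f by simp
    show "integrable M (\<lambda>\<omega>. ?J s \<omega> * ?J t \<omega>)"
      using integrable_enn2real(1)[OF m fin] by (simp add: enn2real_mult)
    show "expectation (\<lambda>\<omega>. ?J s \<omega> * ?J t \<omega>) = min s t * ?v + s * t * ?c * ?c"
      using integrable_enn2real(2)[OF m fin] f s t unfolding E by (simp add: enn2real_plus enn2real_mult)
  qed
  have prod: "centered_jumps g s \<omega> * centered_jumps g t \<omega> =
      ?J s \<omega> * ?J t \<omega> - t * ?c * ?J s \<omega> - s * ?c * ?J t \<omega> + s * t * ?c * ?c" for s t \<omega>
    by (simp add: centered_jumps_def algebra_simps)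
  have int: "integrable M (\<lambda>\<omega>. centered_jumps g s \<omega> * centered_jumps g t \<omega>)" if "0 \<le> s" "0 \<le> t" for s t
    unfolding prod using J2[OF that] J1[OF that(1)] J1[OF that(2)] by simp
  show "0 \<le> t \<Longrightarrow> integrable M (\<lambda>\<omega>. (centered_jumps g t \<omega>)\<^sup>2)"
    using int by (simp add: power2_eq_square)
  show "0 \<le> t \<Longrightarrow> integrable M (centered_jumps g t)" "0 \<le> t \<Longrightarrow> expectation (centered_jumps g t) = 0"
    unfolding centered_jumps_def[abs_def] using J1 by (simp_all add: prob_space)
  show "expectation (\<lambda>\<omega>. centered_jumps g s \<omega> * centered_jumps g t \<omega>) = min s t * ?v" if "0 \<le> s" "0 \<le> t"
    unfolding prod using J2[OF that] J1[OF that(1)] J1[OF that(2)]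
    by (simp add: prob_space algebra_simps)
qed

definition large_jumps :: "real \<Rightarrow> real \<Rightarrow> 'w \<Rightarrow> real" where
  "large_jumps e t \<omega> = centered_jumps (up_part e) t \<omega> - centered_jumps (down_part e) t \<omega>"

text \<open>
  The covariance of the signed process follows by polarization: with \<open>C(u)\<close> the centered sum of \<open>u\<close>,
  \<open>C(g) - C(h)\<close> has the products \<open>2 C(g) C(g) + 2 C(h) C(h) - C(g + h) C(g + h)\<close>, and each \<open>C\<close> is
  covered by \<open>centered_jumps_moments\<close>. The positive and negative parts \<open>g\<close> and \<open>h\<close> have disjoint supports.
\<close>

lemma large_jumps_moments:
  assumes e: "0 < e" and sq: "(\<integral>\<^sup>+x. ennreal (x\<^sup>2) \<partial>\<Lambda>) < \<infinity>"
  shows "large_jumps e t \<in> borel_measurable M"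
    and "0 \<le> t \<Longrightarrow> integrable M (\<lambda>\<omega>. (large_jumps e t \<omega>)\<^sup>2)"
    and "0 \<le> s \<Longrightarrow> 0 \<le> t \<Longrightarrow> expectation (\<lambda>\<omega>. large_jumps e s \<omega> * large_jumps e t \<omega>) =
      min s t * enn2real (\<integral>\<^sup>+x. ennreal (indicator (large e) x * x\<^sup>2) \<partial>\<Lambda>)"
    and "emeasure \<Lambda> (large e) < \<infinity>" "(integral\<^sup>N \<Lambda> (up_part e)) < \<infinity>" "(integral\<^sup>N \<Lambda> (down_part e)) < \<infinity>"
    and "0 \<le> t \<Longrightarrow> integrable M (\<lambda>\<omega>. (centered_jumps (up_part e) t \<omega>)\<^sup>2)" "0 \<le> t \<Longrightarrow> integrable M (\<lambda>\<omega>. (centered_jumps (down_part e) t \<omega>)\<^sup>2)"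
    and "0 \<le> t \<Longrightarrow> integrable M (centered_jumps (up_part e) t)" "0 \<le> t \<Longrightarrow> integrable M (centered_jumps (down_part e) t)"
    and "0 \<le> t \<Longrightarrow> expectation (centered_jumps (up_part e) t) = 0" "0 \<le> t \<Longrightarrow> expectation (centered_jumps (down_part e) t) = 0"
proof -
  let ?g = "up_part e" and ?h = "down_part e" and ?f = "\<lambda>x. up_part e x + down_part e x"
  let ?C = centered_jumps and ?v = "\<lambda>u. \<integral>\<^sup>+x. u x * u x \<partial>\<Lambda>"
  have abs: "?f x = ennreal (indicator (large e) x * \<bar>x\<bar>)" for x
    by (cases "0 \<le> x") (auto simp: up_part_def down_part_def indicator_def ennreal_neg)
  have dom: "(integral\<^sup>N \<Lambda> u) < \<infinity>" if u: "\<And>x. u x \<le> ennreal c * ennreal (x\<^sup>2)" for u c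
  proof -
    have "(integral\<^sup>N \<Lambda> u) \<le> (\<integral>\<^sup>+x. ennreal c * ennreal (x\<^sup>2) \<partial>\<Lambda>)"
      using u by (intro nn_integral_mono) auto
    also have "\<dots> < \<infinity>" using sq by (subst nn_integral_cmult) (auto simp: ennreal_mult_less_top)
    finally show ?thesis .
  qed
  have le: "\<bar>x\<bar> \<le> x\<^sup>2 / e" if "x \<in> large e" for x
  proof -
    have "e < \<bar>x\<bar>" using that by (simp add: large_def)
    then have "\<bar>x\<bar> * e \<le> \<bar>x\<bar> * \<bar>x\<bar>"
      using e mult_left_mono[of e "\<bar>x\<bar>" "\<bar>x\<bar>"] by simp
    then show ?thesis
      using e by (simp add: pos_le_divide_eq power2_eq_square abs_mult[symmetric])
  qed
  show A: "emeasure \<Lambda> (large e) < \<infinity>" by (rule emeasure_large_finite[OF sets_\<Lambda> sq e])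
  have f1: "(integral\<^sup>N \<Lambda> ?f) < \<infinity>"
  proof (rule dom[of _ "1 / e"])
    fix x show "?f x \<le> ennreal (1 / e) * ennreal (x\<^sup>2)"
      unfolding abs using le[of x] e by (auto simp: indicator_def ennreal_mult[symmetric] intro!: ennreal_leI)
  qed
  have f2: "(?v ?f) < \<infinity>"
    by (rule dom[of _ 1]) (auto simp: abs indicator_def ennreal_mult[symmetric] power2_eq_square abs_mult[symmetric])
  have g1: "(integral\<^sup>N \<Lambda> ?g) < \<infinity>" and h1: "(integral\<^sup>N \<Lambda> ?h) < \<infinity>"
    by (rule le_less_trans[OF nn_integral_mono f1]; simp)+
  then show "(integral\<^sup>N \<Lambda> (up_part e)) < \<infinity>" "(integral\<^sup>N \<Lambda> (down_part e)) < \<infinity>" .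
  have g2: "(?v ?g) < \<infinity>" and h2: "(?v ?h) < \<infinity>"
    by (rule le_less_trans[OF nn_integral_mono f2]; simp add: mult_mono)+
  have gA: "\<forall>x. x \<notin> large e \<longrightarrow> ?g x = 0" and hA: "\<forall>x. x \<notin> large e \<longrightarrow> ?h x = 0"
    and fA: "\<forall>x. x \<notin> large e \<longrightarrow> ?f x = 0"
    by (auto simp: up_part_def down_part_def)
  have fm[measurable]: "?f \<in> borel_measurable borel" by measurable
  note G = centered_jumps_moments[OF large_borel A parts_measurable(1) gA g1 g2]
  note H = centered_jumps_moments[OF large_borel A parts_measurable(2) hA h1 h2]
  show "0 \<le> t \<Longrightarrow> integrable M (\<lambda>\<omega>. (centered_jumps (up_part e) t \<omega>)\<^sup>2)" "0 \<le> t \<Longrightarrow> integrable M (\<lambda>\<omega>. (centered_jumps (down_part e) t \<omega>)\<^sup>2)"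
    "0 \<le> t \<Longrightarrow> integrable M (centered_jumps (up_part e) t)" "0 \<le> t \<Longrightarrow> integrable M (centered_jumps (down_part e) t)"
    "0 \<le> t \<Longrightarrow> expectation (centered_jumps (up_part e) t) = 0" "0 \<le> t \<Longrightarrow> expectation (centered_jumps (down_part e) t) = 0"
    by (fact G(1) H(1) G(2) H(2) G(3) H(3))+
  note S = centered_jumps_moments[OF large_borel A fm fA f1 f2]
  have cm[measurable]: "?C ?g t \<in> borel_measurable M" "?C ?h t \<in> borel_measurable M" for t
    by (auto intro: centered_jumps_measurable)
  show m: "large_jumps e t \<in> borel_measurable M" for t
    unfolding large_jumps_def[abs_def] by measurable
  have sum: "AE \<omega> in M. ?C ?f t \<omega> = ?C ?g t \<omega> + ?C ?h t \<omega>" if t: "0 \<le> t" for t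
  proof -
    have I: "enn2real (integral\<^sup>N \<Lambda> ?f) = enn2real (integral\<^sup>N \<Lambda> ?g) + enn2real (integral\<^sup>N \<Lambda> ?h)"
      using g1 h1 by (simp add: nn_integral_add enn2real_plus)
    from AE_jumps_finite[OF parts_measurable(1) g1 t] AE_jumps_finite[OF parts_measurable(2) h1 t] AE_space
    show ?thesis
    proof eventually_elim
      case (elim \<omega>)
      note [measurable_cong] = sets_\<mu>[OF elim(3)]
      have "jumps ?f {0<..t} \<omega> = jumps ?g {0<..t} \<omega> + jumps ?h {0<..t} \<omega>"
        unfolding jumps_def distrib_right by (rule nn_integral_add) measurable
      then have "enn2real (jumps ?f {0<..t} \<omega>) = enn2real (jumps ?g {0<..t} \<omega>) + enn2real (jumps ?h {0<..t} \<omega>)"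
        using elim by (simp add: enn2real_plus less_top)
      then show ?case unfolding centered_jumps_def I by (simp add: algebra_simps)
    qed
  qed
  show sqint: "integrable M (\<lambda>\<omega>. (large_jumps e t \<omega>)\<^sup>2)" if "0 \<le> t" for t
    unfolding large_jumps_def diff_conv_add_uminus using G(1)[OF that] H(1)[OF that]
    by (intro integrable_square_add) auto
  show "expectation (\<lambda>\<omega>. large_jumps e s \<omega> * large_jumps e t \<omega>) =
      min s t * enn2real (\<integral>\<^sup>+x. ennreal (indicator (large e) x * x\<^sup>2) \<partial>\<Lambda>)" if st: "0 \<le> s" "0 \<le> t"
  proof -
    have prodint: "integrable M (\<lambda>\<omega>. centered_jumps u s \<omega> * centered_jumps u t \<omega>)"
      if "\<And>t. 0 \<le> t \<Longrightarrow> integrable M (\<lambda>\<omega>. (centered_jumps u t \<omega>)\<^sup>2)" "u \<in> borel_measurable borel" for u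
      using that st by (intro integrable_mult_of_squares centered_jumps_measurable) auto
    note ints = prodint[OF G(1) parts_measurable(1)] prodint[OF H(1) parts_measurable(2)] prodint[OF S(1) fm]
    have "expectation (\<lambda>\<omega>. large_jumps e s \<omega> * large_jumps e t \<omega>) =
      expectation (\<lambda>\<omega>. 2 * (?C ?g s \<omega> * ?C ?g t \<omega>) + 2 * (?C ?h s \<omega> * ?C ?h t \<omega>)
        - ?C ?f s \<omega> * ?C ?f t \<omega>)"
    proof (rule integral_cong_AE)
      show "AE \<omega> in M. large_jumps e s \<omega> * large_jumps e t \<omega> = 2 * (?C ?g s \<omega> * ?C ?g t \<omega>)
        + 2 * (?C ?h s \<omega> * ?C ?h t \<omega>) - ?C ?f s \<omega> * ?C ?f t \<omega>"
        using sum[OF st(1)] sum[OF st(2)]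
        by eventually_elim (simp add: large_jumps_def algebra_simps)
      have [measurable]: "?C ?f t \<in> borel_measurable M" for t by (intro centered_jumps_measurable fm)
      show "(\<lambda>\<omega>. 2 * (?C ?g s \<omega> * ?C ?g t \<omega>)
        + 2 * (?C ?h s \<omega> * ?C ?h t \<omega>) - ?C ?f s \<omega> * ?C ?f t \<omega>) \<in> borel_measurable M"
        by measurable
    qed (use m in measurable)
    also have "\<dots> = 2 * (min s t * enn2real (?v ?g)) + 2 * (min s t * enn2real (?v ?h))
        - min s t * enn2real (?v ?f)"
      using ints G(4)[OF st] H(4)[OF st] S(4)[OF st] by simp
    also have "(?v ?f) = (\<integral>\<^sup>+x. ?g x * ?g x + ?h x * ?h x \<partial>\<Lambda>)"
    proof (rule nn_integral_cong)
      fix x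
      have "?g x = 0 \<or> ?h x = 0" by (cases "0 \<le> x") (auto simp: up_part_def down_part_def indicator_def ennreal_neg)
      then show "?f x * ?f x = ?g x * ?g x + ?h x * ?h x" by auto
    qed
    also have "\<dots> = (?v ?g) + (?v ?h)"
      by (rule nn_integral_add) measurable
    also have "2 * (min s t * enn2real (?v ?g)) + 2 * (min s t * enn2real (?v ?h))
        - min s t * enn2real ((?v ?g) + (?v ?h))
        = min s t * enn2real ((?v ?g) + (?v ?h))"
      using g2 h2 by (simp add: enn2real_plus algebra_simps)
    also have "(?v ?g) + (?v ?h) = (\<integral>\<^sup>+x. ?g x * ?g x + ?h x * ?h x \<partial>\<Lambda>)"
      by (rule nn_integral_add[symmetric]) measurable
    also have "\<dots> = (\<integral>\<^sup>+x. ennreal (indicator (large e) x * x\<^sup>2) \<partial>\<Lambda>)"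
    proof (rule nn_integral_cong)
      fix x
      show "?g x * ?g x + ?h x * ?h x = ennreal (indicator (large e) x * x\<^sup>2)"
      proof (cases "x \<in> large e")
        case True
        show ?thesis
        proof (cases "0 \<le> x")
          case pos: True
          then have "?g x = ennreal x" "?h x = 0" using True by (simp_all add: up_part_def down_part_def ennreal_neg)
          then show ?thesis using True pos ennreal_mult[of x x] by (simp add: power2_eq_square)
        next
          case False
          then have "?g x = 0" "?h x = ennreal (- x)" using True by (simp_all add: up_part_def down_part_def ennreal_neg)
          then show ?thesis using True False ennreal_mult[of "- x" "- x"] by (simp add: power2_eq_square)
        qed
      qed (simp add: up_part_def down_part_def)
    qed
    finally show ?thesis .
  qed
qed

end

section \<open>The driving noise\<close>

text \<open>
  Variances come from the normal distribution of the increments. For \<open>s < t\<close> the increments over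
  \<open>{0..s}\<close> and \<open>{s..t}\<close> are independent and centered, hence orthogonal.
\<close>

lemma (in prob_space) brownian_motion_moments:
  assumes w: "brownian_motion M w"
  shows "0 \<le> t \<Longrightarrow> integrable M (w t)" and "0 \<le> t \<Longrightarrow> expectation (w t) = 0"
    and "0 \<le> t \<Longrightarrow> integrable M (\<lambda>\<omega>. (w t \<omega>)\<^sup>2)"
    and "0 \<le> s \<Longrightarrow> 0 \<le> t \<Longrightarrow> expectation (\<lambda>\<omega>. w s \<omega> * w t \<omega>) = min s t"
proof -
  have wm: "\<And>t. 0 \<le> t \<Longrightarrow> w t \<in> borel_measurable M" and w0: "AE \<omega> in M. w 0 \<omega> = 0"
    and dist: "\<And>s t. 0 \<le> s \<Longrightarrow> s < t \<Longrightarrow> distributed M lborel (\<lambda>\<omega>. w t \<omega> - w s \<omega>) (normal_density 0 (sqrt (t - s)))"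
    and ind: "\<And>(t :: nat \<Rightarrow> real) k. 0 \<le> t 0 \<Longrightarrow> mono t \<Longrightarrow> indep_vars (\<lambda>_. borel) (\<lambda>i \<omega>. w (t (Suc i)) \<omega> - w (t i) \<omega>) {..<k}"
    using w unfolding brownian_motion_def by blast+
  have inc: "integrable M (\<lambda>\<omega>. w t \<omega> - w s \<omega>) \<and> expectation (\<lambda>\<omega>. w t \<omega> - w s \<omega>) = 0 \<and>
      integrable M (\<lambda>\<omega>. (w t \<omega> - w s \<omega>)\<^sup>2) \<and> expectation (\<lambda>\<omega>. (w t \<omega> - w s \<omega>)\<^sup>2) = t - s" if st: "0 \<le> s" "s \<le> t" for s t
  proof (cases "s = t")
    case False
    then have "s < t" using st by simp
    note D = dist[OF st(1) this]
    have pos: "0 < sqrt (t - s)" using \<open>s < t\<close> by simp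
    have E: "expectation (\<lambda>\<omega>. w t \<omega> - w s \<omega>) = 0" by (rule normal_distributed_expectation[OF pos D])
    have "integrable M (\<lambda>\<omega>. (w t \<omega> - w s \<omega>) ^ k)" for k
      using distributed_integrable[OF D, of "\<lambda>x. x ^ k"] integrable_normal_moment[OF pos, of 0 k] by simp
    from this[of 1] this[of 2] show ?thesis
      using E normal_distributed_variance[OF pos D] \<open>s < t\<close> by simp
  qed simp
  have inc0: "AE \<omega> in M. w t \<omega> - w 0 \<omega> = w t \<omega>" for t using w0 by eventually_elim simp
  have mom: "integrable M (w t)" "expectation (w t) = 0" "integrable M (\<lambda>\<omega>. (w t \<omega>)\<^sup>2)" "expectation (\<lambda>\<omega>. (w t \<omega>)\<^sup>2) = t"
    if t: "0 \<le> t" for t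
  proof -
    note [measurable] = wm[OF t] wm[OF order_refl]
    have sq: "AE \<omega> in M. (w t \<omega> - w 0 \<omega>)\<^sup>2 = (w t \<omega>)\<^sup>2" using inc0 by eventually_elim simp
    show "integrable M (w t)"
      using integrable_cong_AE[THEN iffD1, OF _ _ inc0, of t] inc[OF order_refl t] by simp
    show "expectation (w t) = 0"
      using integral_cong_AE[OF _ _ inc0, of t] inc[OF order_refl t] by simp
    show "integrable M (\<lambda>\<omega>. (w t \<omega>)\<^sup>2)"
      using integrable_cong_AE[THEN iffD1, OF _ _ sq] inc[OF order_refl t] by simp
    show "expectation (\<lambda>\<omega>. (w t \<omega>)\<^sup>2) = t"
      using integral_cong_AE[OF _ _ sq] inc[OF order_refl t] by simp
  qed
  show "0 \<le> t \<Longrightarrow> integrable M (w t)" "0 \<le> t \<Longrightarrow> expectation (w t) = 0" "0 \<le> t \<Longrightarrow> integrable M (\<lambda>\<omega>. (w t \<omega>)\<^sup>2)"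
    using mom by auto
  have cov: "expectation (\<lambda>\<omega>. w s \<omega> * w t \<omega>) = s" if st: "0 \<le> s" "s \<le> t" for s t
  proof -
    \<comment> \<open>a monotone sequence of times whose first two increments are the ones needed\<close>
    define r :: "nat \<Rightarrow> real" where "r i = (if i = 0 then 0 else if i = 1 then s else t)" for i
    have "mono r" using st by (auto simp: r_def mono_def)
    then have "indep_vars (\<lambda>_. borel) (\<lambda>i \<omega>. w (r (Suc i)) \<omega> - w (r i) \<omega>) {..<2}"
      by (rule ind[rotated]) (simp add: r_def)
    then have "expectation (\<lambda>\<omega>. \<Prod>i\<in>{..<2}. w (r (Suc i)) \<omega> - w (r i) \<omega>) = (\<Prod>i\<in>{..<2}. expectation (\<lambda>\<omega>. w (r (Suc i)) \<omega> - w (r i) \<omega>))"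
      using inc st by (intro indep_vars_lebesgue_integral) (auto simp: r_def)
    then have zero: "expectation (\<lambda>\<omega>. (w s \<omega> - w 0 \<omega>) * (w t \<omega> - w s \<omega>)) = 0"
      using inc[of s t] st by (simp add: r_def numeral_2_eq_2)
    have st': "0 \<le> t" using st by simp
    note [measurable] = wm[OF st(1)] wm[OF st'] wm[OF order_refl]
    have int: "integrable M (\<lambda>\<omega>. w s \<omega> * (w t \<omega> - w s \<omega>))"
      using mom(3)[OF st(1)] inc[OF st] by (intro integrable_mult_of_squares) auto
    have "expectation (\<lambda>\<omega>. (w s \<omega> - w 0 \<omega>) * (w t \<omega> - w s \<omega>)) = expectation (\<lambda>\<omega>. w s \<omega> * (w t \<omega> - w s \<omega>))"
      using w0 by (intro integral_cong_AE) (auto elim!: eventually_mono)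
    then have "expectation (\<lambda>\<omega>. w s \<omega> * (w t \<omega> - w s \<omega>)) = 0" using zero by simp
    moreover have "expectation (\<lambda>\<omega>. w s \<omega> * w t \<omega>) = expectation (\<lambda>\<omega>. w s \<omega> * (w t \<omega> - w s \<omega>) + (w s \<omega>)\<^sup>2)"
      by (intro Bochner_Integration.integral_cong) (auto simp: algebra_simps power2_eq_square)
    ultimately show ?thesis using int mom(3,4)[OF st(1)] by simp
  qed
  show "expectation (\<lambda>\<omega>. w s \<omega> * w t \<omega>) = min s t" if "0 \<le> s" "0 \<le> t"
  proof (cases "s \<le> t")
    case True
    then show ?thesis using cov[OF that(1) True] by simp
  next
    case False
    then show ?thesis using cov[OF that(2), of s] by (simp add: mult.commute)
  qed
qed

context levy_jump_measure
begin

text \<open>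
  Almost surely the sums of the positive and of the negative large jumps are finite, so the Bochner
  integral is their difference. Time 0 carries no jumps and no compensator mass.
\<close>

lemma truncated_compensated_sum_eq:
  assumes e: "0 < e" and t: "0 \<le> t" and sq: "(\<integral>\<^sup>+x. ennreal (x\<^sup>2) \<partial>\<Lambda>) < \<infinity>"
  shows "AE \<omega> in M. truncated_compensated_sum \<mu> (levy_compensator \<Lambda>) e t \<omega> = large_jumps e t \<omega>"
proof -
  note lj = large_jumps_moments[OF e sq]
  let ?f = "\<lambda>p :: real \<times> real. indicator ({0..t} \<times> {x. e < \<bar>x\<bar>}) p *\<^sub>R snd p"
  have L: "{x. e < \<bar>x\<bar>} = large e" by (simp add: large_def)
  have K: "{0..t} \<times> large e \<in> sets (borel :: (real \<times> real) measure)" by (simp flip: borel_prod)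
  have fm: "?f \<in> borel_measurable borel" unfolding L using K by measurable
  have up: "ennreal (?f p) = indicator {0..t} (fst p) * up_part e (snd p)"
    and down: "ennreal (- ?f p) = indicator {0..t} (fst p) * down_part e (snd p)" for p
    by (auto simp: up_part_def down_part_def L indicator_def mem_Times_iff)
  have gen: "(LINT p:{0..t} \<times> {x. e < \<bar>x\<bar>}|m. snd p) = enn2real (\<integral>\<^sup>+p. indicator {0..t} (fst p) * up_part e (snd p) \<partial>m)
      - enn2real (\<integral>\<^sup>+p. indicator {0..t} (fst p) * down_part e (snd p) \<partial>m)"
    if "sets m = sets borel" "(\<integral>\<^sup>+p. indicator {0..t} (fst p) * up_part e (snd p) \<partial>m) \<noteq> \<infinity>"
      "(\<integral>\<^sup>+p. indicator {0..t} (fst p) * down_part e (snd p) \<partial>m) \<noteq> \<infinity>" for m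
  proof -
    have "integrable m ?f"
      unfolding real_integrable_def up down using that fm by (simp add: measurable_cong_sets[OF that(1) refl])
    then show ?thesis
      unfolding set_lebesgue_integral_def by (subst real_lebesgue_integral_def) (simp_all only: up down)
  qed
  have sets_\<nu>: "sets (levy_compensator \<Lambda>) = sets borel"
    unfolding levy_compensator_def by (simp add: sets_\<Lambda> borel_prod[symmetric] cong: sets_pair_measure_cong)
  have \<nu>: "(\<integral>\<^sup>+p. indicator {0..t} (fst p) * h (snd p) \<partial>levy_compensator \<Lambda>) = ennreal t * (integral\<^sup>N \<Lambda> h)"
    if "h \<in> borel_measurable borel" for h
  proof -
    have "(\<integral>\<^sup>+r. indicator {0..t} r * indicator {0..} r \<partial>lborel) = (\<integral>\<^sup>+r. indicator {0..t} r \<partial>lborel)"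
      by (intro nn_integral_cong) (auto simp: indicator_def)
    then show ?thesis using that t by (subst nn_integral_levy_compensator) auto
  qed
  have comp: "(LINT p:{0..t} \<times> {x. e < \<bar>x\<bar>}|levy_compensator \<Lambda>. snd p) = t * enn2real (integral\<^sup>N \<Lambda> (up_part e)) - t * enn2real (integral\<^sup>N \<Lambda> (down_part e))"
    using lj(5,6) t by (subst gen[OF sets_\<nu>]) (auto simp: \<nu> enn2real_mult ennreal_mult_eq_top_iff)
  from AE_jumps_finite[OF parts_measurable(1) lj(5) t] AE_jumps_finite[OF parts_measurable(2) lj(6) t] AE_space
  show ?thesis
  proof eventually_elim
    case (elim \<omega>)
    have j: "(\<integral>\<^sup>+p. indicator {0..t} (fst p) * h (snd p) \<partial>\<mu> \<omega>) = jumps h {0<..t} \<omega>" for h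
      unfolding jumps_def using AE_\<mu>_support[OF elim(3)]
      by (intro nn_integral_cong_AE, eventually_elim) (auto simp: indicator_def mem_Times_iff)
    have "(LINT p:{0..t} \<times> {x. e < \<bar>x\<bar>}|\<mu> \<omega>. snd p) = enn2real (jumps (up_part e) {0<..t} \<omega>) - enn2real (jumps (down_part e) {0<..t} \<omega>)"
      using elim gen[OF sets_\<mu>[OF elim(3)]] unfolding j by simp
    then show ?case
      unfolding truncated_compensated_sum_def comp large_jumps_def centered_jumps_def by simp
  qed
qed

lemma large_jump_variance_tendsto:
  "(\<lambda>k. \<integral>\<^sup>+x. ennreal (indicator (large (1 / real (Suc k))) x * x\<^sup>2) \<partial>\<Lambda>) \<longlonglongrightarrow> (\<integral>\<^sup>+x. ennreal (x\<^sup>2) \<partial>\<Lambda>)"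
proof (rule nn_integral_LIMSEQ)
  show "incseq (\<lambda>k x. ennreal (indicator (large (1 / real (Suc k))) x * x\<^sup>2))"
  proof (intro incseq_SucI le_funI ennreal_leI mult_right_mono)
    fix k x
    have "1 / real (Suc (Suc k)) \<le> 1 / real (Suc k)" by (intro divide_left_mono) auto
    then show "indicator (large (1 / real (Suc k))) x \<le> (indicator (large (1 / real (Suc (Suc k)))) x :: real)"
      by (auto simp: large_def indicator_def)
  qed simp
  show "(\<lambda>x. ennreal (indicator (large (1 / real (Suc k))) x * x\<^sup>2)) \<in> borel_measurable \<Lambda>" for k
    by measurable
  show "(\<lambda>k. ennreal (indicator (large (1 / real (Suc k))) x * x\<^sup>2)) \<longlonglongrightarrow> ennreal (x\<^sup>2)" for x
  proof (cases "x = 0")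
    case False
    have "(\<lambda>k. 1 / real (Suc k)) \<longlonglongrightarrow> 0"
      using LIMSEQ_inverse_real_of_nat by (simp add: inverse_eq_divide)
    then have "\<forall>\<^sub>F k in sequentially. 1 / real (Suc k) < \<bar>x\<bar>"
      using False by (intro order_tendstoD) auto
    then have "\<forall>\<^sub>F k in sequentially. ennreal (indicator (large (1 / real (Suc k))) x * x\<^sup>2) = ennreal (x\<^sup>2)"
      by eventually_elim (simp add: large_def)
    then show ?thesis by (rule tendsto_eventually)
  qed simp
qed

lemma compensated_jump_process_L2:
  assumes z: "compensated_jump_process M \<mu> (levy_compensator \<Lambda>) z"
    and sq: "(\<integral>\<^sup>+x. ennreal (x\<^sup>2) \<partial>\<Lambda>) < \<infinity>" and t: "0 \<le> t"
  shows "L2_tendsto M (\<lambda>k. large_jumps (1 / real (Suc k)) t) (z t)"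
  unfolding L2_tendsto_def
proof (intro conjI allI)
  show "z t \<in> borel_measurable M" using z t by (simp add: compensated_jump_process_def)
  fix k :: nat
  have e: "0 < 1 / real (Suc k)" by simp
  show "large_jumps (1 / real (Suc k)) t \<in> borel_measurable M" "integrable M (\<lambda>\<omega>. (large_jumps (1 / real (Suc k)) t \<omega>)\<^sup>2)"
    using large_jumps_moments(1,2)[OF e sq] t by auto
next
  have lim: "filterlim (\<lambda>k. 1 / real (Suc k)) (at_right 0) sequentially"
    using LIMSEQ_inverse_real_of_nat
    by (intro tendsto_imp_filterlim_at_right) (auto simp: inverse_eq_divide intro!: always_eventually)
  have "((\<lambda>e. \<integral>\<^sup>+\<omega>. ennreal ((z t \<omega> - truncated_compensated_sum \<mu> (levy_compensator \<Lambda>) e t \<omega>)\<^sup>2) \<partial>M) \<longlongrightarrow> 0) (at_right 0)"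
    using z t by (simp add: compensated_jump_process_def)
  from filterlim_compose[OF this lim]
  have "(\<lambda>k. \<integral>\<^sup>+\<omega>. ennreal ((z t \<omega> - truncated_compensated_sum \<mu> (levy_compensator \<Lambda>) (1 / real (Suc k)) t \<omega>)\<^sup>2) \<partial>M) \<longlonglongrightarrow> 0" .
  moreover have "(\<integral>\<^sup>+\<omega>. ennreal ((z t \<omega> - truncated_compensated_sum \<mu> (levy_compensator \<Lambda>) (1 / real (Suc k)) t \<omega>)\<^sup>2) \<partial>M)
      = (\<integral>\<^sup>+\<omega>. ennreal ((z t \<omega> - large_jumps (1 / real (Suc k)) t \<omega>)\<^sup>2) \<partial>M)" for k
  proof -
    have e: "0 < 1 / real (Suc k)" by simp
    show ?thesis
      using truncated_compensated_sum_eq[OF e t sq] by (intro nn_integral_cong_AE, eventually_elim) simp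
  qed
  ultimately show "(\<lambda>k. \<integral>\<^sup>+\<omega>. ennreal ((z t \<omega> - large_jumps (1 / real (Suc k)) t \<omega>)\<^sup>2) \<partial>M) \<longlonglongrightarrow> 0"
    by simp
qed

text \<open>
  The covariances converge along the truncation levels \<open>1 / (k + 1)\<close>, and the truncated second
  moments of the Levy measure increase to 1.
\<close>

lemma compensated_jump_process_covariance:
  assumes z: "compensated_jump_process M \<mu> (levy_compensator \<Lambda>) z"
    and sq: "(\<integral>\<^sup>+x. ennreal (x\<^sup>2) \<partial>\<Lambda>) = 1" and s: "0 \<le> s" and t: "0 \<le> t"
  shows "expectation (\<lambda>\<omega>. z s \<omega> * z t \<omega>) = min s t"
proof -
  have sq': "(\<integral>\<^sup>+x. ennreal (x\<^sup>2) \<partial>\<Lambda>) < \<infinity>" using sq by simp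
  have "(\<lambda>k. expectation (\<lambda>\<omega>. large_jumps (1 / real (Suc k)) s \<omega> * large_jumps (1 / real (Suc k)) t \<omega>)) \<longlonglongrightarrow> expectation (\<lambda>\<omega>. z s \<omega> * z t \<omega>)"
    by (intro L2_tendsto_integral_mult compensated_jump_process_L2[OF z sq'] s t)
  moreover have "(\<lambda>k. expectation (\<lambda>\<omega>. large_jumps (1 / real (Suc k)) s \<omega> * large_jumps (1 / real (Suc k)) t \<omega>)) \<longlonglongrightarrow> min s t * 1"
  proof -
    have e: "0 < 1 / real (Suc k)" for k by simp
    have "(\<lambda>k. enn2real (\<integral>\<^sup>+x. ennreal (indicator (large (1 / real (Suc k))) x * x\<^sup>2) \<partial>\<Lambda>)) \<longlonglongrightarrow> 1"
      using large_jump_variance_tendsto by (intro tendsto_enn2real) (simp_all only: sq ennreal_1 zero_le_one)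
    then show ?thesis
      unfolding large_jumps_moments(3)[OF e sq' s t] by (rule tendsto_mult_left)
  qed
  ultimately show ?thesis using LIMSEQ_unique by fastforce
qed

lemma jumps_random_measure_events:
  assumes g: "g \<in> borel_measurable borel" "S \<in> sets borel" and B: "B \<in> sets borel"
  shows "jumps g S -` B \<inter> space M \<in> random_measure_events M \<mu>"
proof -
  let ?G = "{(\<lambda>\<omega>. emeasure (\<mu> \<omega>) A) -` B \<inter> space M | A B. A \<in> sets borel \<and> B \<in> sets borel}"
  define N where "N = sigma (space M) ?G"
  have G: "?G \<subseteq> Pow (space M)" by auto
  have space_N: "space N = space M" and sets_N: "sets N = random_measure_events M \<mu>"
    using G by (simp_all add: N_def space_measure_of random_measure_events_def)
  have "jumps g S \<in> borel_measurable N"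
    unfolding jumps_def[abs_def] using g
  proof (intro nn_integral_random_measure_measurable)
    show "(\<lambda>\<omega>. emeasure (\<mu> \<omega>) A) \<in> borel_measurable N" if A: "A \<in> sets borel" for A
    proof (rule measurableI)
      fix C :: "ennreal set" assume "C \<in> sets borel"
      then show "(\<lambda>\<omega>. emeasure (\<mu> \<omega>) A) -` C \<inter> space N \<in> sets N"
        unfolding space_N sets_N random_measure_events_def using A by (intro sigma_sets.Basic) blast
    qed simp
  qed (auto simp: space_N sets_\<mu>)
  from measurable_sets[OF this B] show ?thesis by (simp add: space_N sets_N)
qed

lemma expectation_indep_centered_jumps:
  assumes ind: "indep_set (process_events M w) (random_measure_events M \<mu>)"
    and w: "0 \<le> s" "w s \<in> borel_measurable M" "integrable M (w s)"
    and g: "g \<in> borel_measurable borel" and int: "integrable M (centered_jumps g t)"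
  shows "expectation (\<lambda>\<omega>. w s \<omega> * centered_jumps g t \<omega>) = expectation (w s) * expectation (centered_jumps g t)"
proof (rule indep_var_lebesgue_integral)
  show "indep_var borel (w s) borel (centered_jumps g t)"
    unfolding indep_var_eq
  proof (intro conjI)
    show "random_variable borel (w s)" "random_variable borel (centered_jumps g t)"
      using w g by (auto intro: centered_jumps_measurable)
    have 1: "sigma_sets (space M) {w s -` A \<inter> space M | A. A \<in> sets borel} \<subseteq> process_events M w"
      unfolding process_events_def using w(1) by (intro sigma_sets_subseteq) blast
    have 2: "sigma_sets (space M) {centered_jumps g t -` A \<inter> space M | A. A \<in> sets borel} \<subseteq> random_measure_events M \<mu>"
    proof -
      have "centered_jumps g t -` A \<inter> space M \<in> random_measure_events M \<mu>" if A: "A \<in> sets borel" for A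
      proof -
        let ?h = "\<lambda>y :: ennreal. enn2real y - t * enn2real (integral\<^sup>N \<Lambda> g)"
        have "?h -` A \<inter> space borel \<in> sets borel" by (rule measurable_sets[OF _ A]) measurable
        then have "jumps g {0<..t} -` (?h -` A) \<inter> space M \<in> random_measure_events M \<mu>"
          by (intro jumps_random_measure_events g) auto
        then show ?thesis by (simp add: centered_jumps_def[abs_def] vimage_def)
      qed
      then show ?thesis unfolding random_measure_events_def by (intro sigma_sets_mono) blast
    qed
    show "indep_set (sigma_sets (space M) {w s -` A \<inter> space M | A. A \<in> sets borel})
      (sigma_sets (space M) {centered_jumps g t -` A \<inter> space M | A. A \<in> sets borel})"
      using ind 1 2 unfolding indep_sets2_eq by blast
  qed
qed (use w int in auto)

text \<open>
  For every truncation level the large jumps are a function of the random measure, hence independent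
  of \<open>w\<close>; both factors are centered. This survives the \<open>L\<^sup>2\<close> limit.
\<close>

lemma expectation_brownian_jump_zero:
  assumes ind: "indep_set (process_events M w) (random_measure_events M \<mu>)" and w: "brownian_motion M w"
    and z: "compensated_jump_process M \<mu> (levy_compensator \<Lambda>) z"
    and sq: "(\<integral>\<^sup>+x. ennreal (x\<^sup>2) \<partial>\<Lambda>) < \<infinity>" and s: "0 \<le> s" and t: "0 \<le> t"
  shows "expectation (\<lambda>\<omega>. w s \<omega> * z t \<omega>) = 0"
proof -
  note wm = brownian_motion_moments[OF w]
  have wmeas: "w s \<in> borel_measurable M" using w s by (simp add: brownian_motion_def)
  have zero: "expectation (\<lambda>\<omega>. w s \<omega> * large_jumps e t \<omega>) = 0" if e: "0 < e" for e
  proof -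
    note lj = large_jumps_moments[OF e sq]
    have [measurable]: "centered_jumps (up_part e) t \<in> borel_measurable M" "centered_jumps (down_part e) t \<in> borel_measurable M"
      by (auto intro: centered_jumps_measurable)
    have "expectation (\<lambda>\<omega>. w s \<omega> * large_jumps e t \<omega>) =
        expectation (\<lambda>\<omega>. w s \<omega> * centered_jumps (up_part e) t \<omega> - w s \<omega> * centered_jumps (down_part e) t \<omega>)"
      by (simp add: large_jumps_def right_diff_distrib)
    also have "\<dots> = expectation (\<lambda>\<omega>. w s \<omega> * centered_jumps (up_part e) t \<omega>) - expectation (\<lambda>\<omega>. w s \<omega> * centered_jumps (down_part e) t \<omega>)"
      using wmeas wm(3)[OF s] lj(7,8)[OF t] by (intro Bochner_Integration.integral_diff integrable_mult_of_squares) auto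
    also have "\<dots> = 0"
      using expectation_indep_centered_jumps[OF ind s wmeas wm(1)[OF s] parts_measurable(1) lj(9)[OF t]]
        expectation_indep_centered_jumps[OF ind s wmeas wm(1)[OF s] parts_measurable(2) lj(10)[OF t]] wm(2)[OF s] by simp
    finally show ?thesis .
  qed
  have "(\<lambda>k. expectation (\<lambda>\<omega>. w s \<omega> * large_jumps (1 / real (Suc k)) t \<omega>)) \<longlonglongrightarrow> expectation (\<lambda>\<omega>. w s \<omega> * z t \<omega>)"
    by (intro L2_tendsto_integral_mult compensated_jump_process_L2[OF z sq] L2_tendsto_const wmeas wm(3) s t)
  then show ?thesis by (simp add: zero LIMSEQ_const_iff)
qed

end

section \<open>Stochastic integrals of smooth functions\<close>

text \<open>
  Pathwise convergence of the Riemann--Ito sums along every sequence of partitions implies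
  convergence in probability.
\<close>

lemma (in prob_space) has_stochastic_integral_parts:
  fixes X :: "real \<Rightarrow> 'a \<Rightarrow> real"
  assumes T: "0 \<le> T"
    and X: "\<And>t. t \<in> {0..T} \<Longrightarrow> X t \<in> borel_measurable M"
    and cadlag: "\<And>\<omega>. \<omega> \<in> space M \<Longrightarrow> cadlag_on {0..T} (\<lambda>t. X t \<omega>)"
    and f: "\<And>t. (f has_real_derivative f' t) (at t)" "continuous_on UNIV f'"
  shows "has_stochastic_integral M T f X (\<lambda>\<omega>. parts_integral T f f' (\<lambda>t. X t \<omega>))"
  unfolding has_stochastic_integral_def
proof (intro conjI allI impI)
  let ?I = "\<lambda>\<omega>. parts_integral T f f' (\<lambda>t. X t \<omega>)"
  show I[measurable]: "?I \<in> borel_measurable M"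
  proof (rule borel_measurable_LIMSEQ_real)
    fix \<omega> assume "\<omega> \<in> space M"
    from Riemann_sums_tendsto_parts_integral[OF cadlag[OF this] f uniform_partitions[OF T]]
    show "(\<lambda>k. \<Sum>i<Suc k. f (T * real i / real (Suc k)) * (X (T * real (Suc i) / real (Suc k)) \<omega> - X (T * real i / real (Suc k)) \<omega>)) \<longlonglongrightarrow> ?I \<omega>" .
  qed (rule Riemann_sum_measurable[OF uniform_partitions[OF T] X])
  fix N \<pi> and \<epsilon> :: real
  assume part: "vanishing_partitions T N \<pi>" and \<epsilon>: "0 < \<epsilon>"
  let ?S = "\<lambda>k \<omega>. \<Sum>i<N k. f (\<pi> k i) * (X (\<pi> k (Suc i)) \<omega> - X (\<pi> k i) \<omega>)"
  have S[measurable]: "?S k \<in> borel_measurable M" for k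
    by (rule Riemann_sum_measurable[OF part X])
  let ?A = "\<lambda>k. {\<omega> \<in> space M. \<epsilon> < \<bar>?S k \<omega> - ?I \<omega>\<bar>}"
  have "(\<lambda>k. \<integral>\<omega>. indicator (?A k) \<omega> \<partial>M) \<longlonglongrightarrow> (\<integral>\<omega>. 0 \<partial>M :: real)"
  proof (rule integral_dominated_convergence[where w="\<lambda>_. 1"])
    show "(\<lambda>\<omega>. indicator (?A k) \<omega> :: real) \<in> borel_measurable M" for k
      by (intro borel_measurable_indicator) measurable
    show "AE \<omega> in M. (\<lambda>k. indicator (?A k) \<omega> :: real) \<longlonglongrightarrow> 0"
    proof (rule AE_I2)
      fix \<omega> assume "\<omega> \<in> space M"
      from Riemann_sums_tendsto_parts_integral[OF cadlag[OF this] f part]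
      have "(\<lambda>k. ?S k \<omega>) \<longlonglongrightarrow> ?I \<omega>" .
      from tendstoD[OF this \<epsilon>]
      have "\<forall>\<^sub>F k in sequentially. indicator (?A k) \<omega> = (0 :: real)"
        by eventually_elim (auto simp: dist_real_def indicator_def)
      then show "(\<lambda>k. indicator (?A k) \<omega> :: real) \<longlonglongrightarrow> 0" by (rule tendsto_eventually)
    qed
  qed (auto simp: indicator_def)
  moreover have "(\<integral>\<omega>. indicator (?A k) \<omega> \<partial>M) = measure M (?A k)" for k
  proof -
    have "?A k \<in> sets M" by measurable
    then show ?thesis by simp
  qed
  ultimately show "(\<lambda>k. measure M (?A k)) \<longlonglongrightarrow> 0" by simp
qed

lemma (in prob_space) has_stochastic_integral_unique:
  fixes X :: "real \<Rightarrow> 'a \<Rightarrow> real"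
  assumes T: "0 \<le> T" and X: "\<And>t. t \<in> {0..T} \<Longrightarrow> X t \<in> borel_measurable M"
    and I: "has_stochastic_integral M T f X I" and J: "has_stochastic_integral M T f X J"
  shows "AE \<omega> in M. I \<omega> = J \<omega>"
proof -
  have [measurable]: "I \<in> borel_measurable M" "J \<in> borel_measurable M"
    using I J by (auto simp: has_stochastic_integral_def)
  define \<pi> where "\<pi> = (\<lambda>k i. T * real i / real (Suc k))"
  have part: "vanishing_partitions T Suc \<pi>" unfolding \<pi>_def by (rule uniform_partitions[OF T])
  let ?S = "\<lambda>k \<omega>. \<Sum>i<Suc k. f (\<pi> k i) * (X (\<pi> k (Suc i)) \<omega> - X (\<pi> k i) \<omega>)"
  have S[measurable]: "?S k \<in> borel_measurable M" for k
    by (rule Riemann_sum_measurable[OF part X])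
  let ?D = "\<lambda>\<epsilon>. {\<omega> \<in> space M. \<epsilon> < \<bar>I \<omega> - J \<omega>\<bar>}"
  have zero: "measure M (?D \<epsilon>) = 0" if \<epsilon>: "0 < \<epsilon>" for \<epsilon>
  proof -
    let ?A = "\<lambda>K k. {\<omega> \<in> space M. \<epsilon> / 2 < \<bar>?S k \<omega> - K \<omega>\<bar>}"
    have lim: "(\<lambda>k. measure M (?A K k)) \<longlonglongrightarrow> 0" if "has_stochastic_integral M T f X K" for K
      using that part half_gt_zero[OF \<epsilon>] unfolding has_stochastic_integral_def by blast
    have "measure M (?D \<epsilon>) \<le> measure M (?A I k) + measure M (?A J k)" for k
    proof -
      have sets: "?A I k \<in> sets M" "?A J k \<in> sets M" by measurable
      have "?D \<epsilon> \<subseteq> ?A I k \<union> ?A J k"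
      proof
        fix \<omega> assume \<omega>: "\<omega> \<in> ?D \<epsilon>"
        have "\<epsilon> / 2 < \<bar>s - i\<bar> \<or> \<epsilon> / 2 < \<bar>s - j\<bar>" if "\<epsilon> < \<bar>i - j\<bar>" for s i j :: real
          using that by linarith
        with \<omega> show "\<omega> \<in> ?A I k \<union> ?A J k" by blast
      qed
      then have "measure M (?D \<epsilon>) \<le> measure M (?A I k \<union> ?A J k)"
        by (rule finite_measure_mono) (rule sets.Un[OF sets])
      also have "\<dots> \<le> measure M (?A I k) + measure M (?A J k)"
        by (rule measure_Un_le) (rule sets)+
      finally show ?thesis .
    qed
    moreover have "(\<lambda>k. measure M (?A I k) + measure M (?A J k)) \<longlonglongrightarrow> 0 + 0"
      by (intro tendsto_add lim I J)
    ultimately have "measure M (?D \<epsilon>) \<le> 0 + 0"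
      by (intro LIMSEQ_le_const) auto
    then show ?thesis by (simp add: measure_le_0_iff)
  qed
  have "AE \<omega> in M. \<forall>m::nat. \<not> 1 / real (Suc m) < \<bar>I \<omega> - J \<omega>\<bar>"
    unfolding AE_all_countable
  proof
    fix m
    have set: "?D (1 / real (Suc m)) \<in> sets M" by measurable
    have "measure M (?D (1 / real (Suc m))) = 0" by (rule zero) simp
    then show "AE \<omega> in M. \<not> 1 / real (Suc m) < \<bar>I \<omega> - J \<omega>\<bar>"
      using set by (intro AE_I[of _ _ "?D (1 / real (Suc m))"]) (auto simp: emeasure_eq_measure)
  qed
  then show ?thesis
  proof eventually_elim
    case (elim \<omega>)
    show ?case
    proof (rule ccontr)
      assume "I \<omega> \<noteq> J \<omega>"
      then obtain m where "inverse (real (Suc m)) < \<bar>I \<omega> - J \<omega>\<bar>" using reals_Archimedean[of "\<bar>I \<omega> - J \<omega>\<bar>"] by auto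
      then show False using elim by (simp add: inverse_eq_divide)
    qed
  qed
qed

section \<open>Fourier coefficients of the Ornstein--Uhlenbeck--Levy process\<close>

text \<open>
  The Brownian and the jump part contribute \<open>\<rho>1\<^sup>2 min s t\<close> and \<open>\<rho>2\<^sup>2 min s t\<close>; the mixed terms
  vanish.
\<close>

lemma OU_levy_noise_moments:
  assumes OU: "OU_levy_process M F w \<mu> \<Lambda> z a \<rho>1 \<rho>2 \<xi>"
  defines "u \<equiv> \<lambda>t \<omega>. \<rho>1 * w t \<omega> + \<rho>2 * z t \<omega>"
  shows "0 \<le> t \<Longrightarrow> u t \<in> borel_measurable M"
    and "AE \<omega> in M. cadlag_on {0..} (\<lambda>t. u t \<omega>)"
    and "0 \<le> t \<Longrightarrow> integrable M (\<lambda>\<omega>. (u t \<omega>)\<^sup>2)"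
    and "0 \<le> s \<Longrightarrow> 0 \<le> t \<Longrightarrow> (\<integral>\<omega>. u s \<omega> * u t \<omega> \<partial>M) = (\<rho>1\<^sup>2 + \<rho>2\<^sup>2) * min s t"
proof -
  have OU': "prob_space M" "filtration (space M) F" "\<And>t. subalgebra M (F t)" "brownian_motion M w" "levy_measure \<Lambda>"
    "(\<integral>\<^sup>+x. ennreal (x\<^sup>2) \<partial>\<Lambda>) = 1" "integer_valued_random_measure M F \<mu>"
    "deterministic_compensator M F \<mu> (levy_compensator \<Lambda>)"
    "prob_space.indep_set M (process_events M w) (random_measure_events M \<mu>)"
    "compensated_jump_process M \<mu> (levy_compensator \<Lambda>) z"
    using OU unfolding OU_levy_process_def by blast+
  note w = OU'(4) and sq = OU'(6) and ind = OU'(9) and z = OU'(10)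
  have sq': "(\<integral>\<^sup>+x. ennreal (x\<^sup>2) \<partial>\<Lambda>) < \<infinity>" using sq by simp
  have sets: "sets \<Lambda> = sets borel" and zero: "emeasure \<Lambda> {0} = 0" using OU'(5) by (auto simp: levy_measure_def)
  interpret prob_space M by (rule OU'(1))
  interpret levy_jump_measure M F \<mu> \<Lambda>
    by unfold_locales (use OU' sets sigma_finite_square_integrable[OF sets sq' zero] in
      \<open>auto simp: sigma_finite_measure_def filtration_def\<close>)
  note wm = brownian_motion_moments[OF w]
  have wmeas: "w t \<in> borel_measurable M" if "0 \<le> t" for t using w that by (simp add: brownian_motion_def)
  have zmeas: "z t \<in> borel_measurable M" if "0 \<le> t" for t using z that by (simp add: compensated_jump_process_def)
  have zsq: "integrable M (\<lambda>\<omega>. (z t \<omega>)\<^sup>2)" if "0 \<le> t" for t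
    by (rule L2_tendsto_square_integrable(1)[OF compensated_jump_process_L2[OF z sq' that]])
  show um: "u t \<in> borel_measurable M" if "0 \<le> t" for t
    unfolding u_def using wmeas[OF that] zmeas[OF that] by simp
  show "AE \<omega> in M. cadlag_on {0..} (\<lambda>t. u t \<omega>)"
  proof -
    have "AE \<omega> in M. continuous_on {0..} (\<lambda>t. w t \<omega>)" using w by (simp add: brownian_motion_def)
    then show ?thesis
      using AE_space
    proof eventually_elim
      case (elim \<omega>)
      have "cadlag_on {0..} (\<lambda>t. z t \<omega>)" using z elim(2) by (simp add: compensated_jump_process_def)
      then show ?case
        unfolding u_def using elim(1)
        by (intro cadlag_on_add cadlag_on_mult cadlag_on_continuous[of _ "\<lambda>t. w t \<omega>"] cadlag_on_continuous[of _ "\<lambda>_. _"] continuous_intros)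
    qed
  qed
  show "integrable M (\<lambda>\<omega>. (u t \<omega>)\<^sup>2)" if t: "0 \<le> t" for t
    unfolding u_def using wmeas[OF t] zmeas[OF t] wm(3)[OF t] zsq[OF t]
    by (intro integrable_square_add) (auto simp: power_mult_distrib)
  show "expectation (\<lambda>\<omega>. u s \<omega> * u t \<omega>) = (\<rho>1\<^sup>2 + \<rho>2\<^sup>2) * min s t" if s: "0 \<le> s" and t: "0 \<le> t"
  proof -
    have "expectation (\<lambda>\<omega>. u s \<omega> * u t \<omega>) = expectation (\<lambda>\<omega>. \<rho>1\<^sup>2 * (w s \<omega> * w t \<omega>) + \<rho>1 * \<rho>2 * (w s \<omega> * z t \<omega>)
        + \<rho>1 * \<rho>2 * (w t \<omega> * z s \<omega>) + \<rho>2\<^sup>2 * (z s \<omega> * z t \<omega>))"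
      by (intro Bochner_Integration.integral_cong) (auto simp: u_def power2_eq_square algebra_simps)
    also have "\<dots> = \<rho>1\<^sup>2 * expectation (\<lambda>\<omega>. w s \<omega> * w t \<omega>) + \<rho>1 * \<rho>2 * expectation (\<lambda>\<omega>. w s \<omega> * z t \<omega>)
        + \<rho>1 * \<rho>2 * expectation (\<lambda>\<omega>. w t \<omega> * z s \<omega>) + \<rho>2\<^sup>2 * expectation (\<lambda>\<omega>. z s \<omega> * z t \<omega>)"
    proof -
      have "integrable M (\<lambda>\<omega>. w s \<omega> * w t \<omega>)" "integrable M (\<lambda>\<omega>. w s \<omega> * z t \<omega>)"
        "integrable M (\<lambda>\<omega>. w t \<omega> * z s \<omega>)" "integrable M (\<lambda>\<omega>. z s \<omega> * z t \<omega>)"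
        by (intro integrable_mult_of_squares wmeas zmeas wm(3) zsq s t)+
      then show ?thesis by simp
    qed
    finally show ?thesis
      using wm(4)[OF s t] compensated_jump_process_covariance[OF z sq s t]
        expectation_brownian_jump_zero[OF ind w z sq' s t] expectation_brownian_jump_zero[OF ind w z sq' t s]
      by (simp add: algebra_simps)
  qed
qed

text \<open>
  The coefficient is computed in two places. On the path space, the chosen stochastic integral is almost
  surely \<open>parts_integral\<close> of the coordinate process. Pulled back along \<open>\<xi>\<close>, this is \<open>parts_integral\<close> of
  the noise with the adjoint solution \<open>g\<close> in place of \<open>Tr j\<close>, to which the isometry applies.
\<close>

lemma expectation_fourier_noise_square:
  assumes OU: "OU_levy_process M F w \<mu> \<Lambda> z a \<rho>1 \<rho>2 \<xi>" and n: "1 \<le> n"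
    and Q: "Q = distr M (skorokhod_space n) (\<lambda>\<omega>. restrict (\<lambda>t. \<xi> t \<omega>) {0..real n})"
    and f: "\<And>t. (Tr j has_real_derivative f' t) (at t)" "continuous_on UNIV f'"
    and g: "\<And>t. (g has_real_derivative g' t) (at t)" "continuous_on UNIV g'"
    and ode: "\<And>t. g' t = f' t - a * g t" and gn: "g (real n) = Tr j (real n)"
  shows "(LINT x|Q. (fourier_noise n Q j x)\<^sup>2) = (\<rho>1\<^sup>2 + \<rho>2\<^sup>2) * ((LINT t:{0..real n}|lborel. (g t)\<^sup>2) / real n)"
proof -
  let ?T = "real n" and ?S = "skorokhod_space n"
  have \<xi>: "prob_space M" "\<And>t. 0 \<le> t \<Longrightarrow> \<xi> t \<in> borel_measurable M" "\<And>\<omega>. \<omega> \<in> space M \<Longrightarrow> cadlag_on {0..} (\<lambda>t. \<xi> t \<omega>)"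
    "AE \<omega> in M. \<xi> 0 \<omega> = 0"
    "AE \<omega> in M. \<forall>t\<ge>0. \<xi> t \<omega> = a * (LINT s:{0..t}|lborel. \<xi> s \<omega>) + (\<rho>1 * w t \<omega> + \<rho>2 * z t \<omega>)"
    using OU unfolding OU_levy_process_def by blast+
  interpret prob_space M by (rule \<xi>(1))
  define u where "u t \<omega> = \<rho>1 * w t \<omega> + \<rho>2 * z t \<omega>" for t \<omega>
  note noise = OU_levy_noise_moments[OF OU, folded u_def]
  define X where "X \<omega> = restrict (\<lambda>t. \<xi> t \<omega>) {0..?T}" for \<omega>
  have cad: "cadlag_on {0..?T} (\<lambda>t. \<xi> t \<omega>)" if "\<omega> \<in> space M" for \<omega>
    using \<xi>(3)[OF that] by (rule cadlag_on_subset) auto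
  have X: "X \<in> measurable M ?S"
    unfolding skorokhod_space_def
  proof (rule measurable_restrict_space2)
    show "X \<in> space M \<rightarrow> {x. cadlag_on {0..?T} x}"
      using cad cadlag_on_cong[of "{0..?T}" "X _" "\<lambda>t. \<xi> t _"] by (auto simp: X_def)
    show "X \<in> measurable M (\<Pi>\<^sub>M t\<in>{0..?T}. borel)"
      unfolding X_def[abs_def] using \<xi>(2) by (intro measurable_restrict) auto
  qed
  have Q': "Q = distr M ?S X" by (simp only: Q X_def[abs_def])
  interpret Q: prob_space Q unfolding Q' by (rule prob_space_distr[OF X])
  have coord: "(\<lambda>x. x t) \<in> borel_measurable Q" if "t \<in> {0..?T}" for t
    unfolding Q' skorokhod_space_def using that
    by (simp add: measurable_restrict_space1 measurable_component_singleton)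
  have cadQ: "cadlag_on {0..?T} (\<lambda>t. x t)" if "x \<in> space Q" for x
    using that by (simp add: Q' skorokhod_space_def space_restrict_space)
  define I where "I x = parts_integral ?T (Tr j) f' x" for x
  have hasI: "has_stochastic_integral Q ?T (Tr j) (\<lambda>t y. y t) I"
    unfolding I_def using Q.has_stochastic_integral_parts[OF _ coord cadQ f] by simp
  then have Im: "I \<in> borel_measurable Q" by (simp add: has_stochastic_integral_def)
  have "has_stochastic_integral Q ?T (Tr j) (\<lambda>t y. y t) (stochastic_integral Q ?T (Tr j) (\<lambda>t y. y t))"
    unfolding stochastic_integral_def by (rule someI[of "has_stochastic_integral Q ?T (Tr j) (\<lambda>t y. y t)", OF hasI])
  note hasS = this
  have AE_eq: "AE x in Q. stochastic_integral Q ?T (Tr j) (\<lambda>t y. y t) x = I x"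
    by (rule Q.has_stochastic_integral_unique[OF _ coord hasS hasI]) auto
  have "(LINT x|Q. (fourier_noise n Q j x)\<^sup>2) = (LINT x|Q. (1 / ?T) * (I x)\<^sup>2)"
  proof (rule integral_cong_AE)
    have norm: "(?T powr (- 1 / 2))\<^sup>2 = 1 / ?T"
      using n by (simp add: power2_eq_square powr_add[symmetric] powr_minus_divide)
    show "AE x in Q. (fourier_noise n Q j x)\<^sup>2 = (1 / ?T) * (I x)\<^sup>2"
      using AE_eq by eventually_elim (simp only: fourier_noise_def power_mult_distrib norm)
    show "(\<lambda>x. (fourier_noise n Q j x)\<^sup>2) \<in> borel_measurable Q"
      using hasS unfolding fourier_noise_def has_stochastic_integral_def
      by (intro borel_measurable_power borel_measurable_times borel_measurable_const) (rule conjunct1)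
  qed (use Im in simp)
  also have "\<dots> = (1 / ?T) * (LINT x|Q. (I x)\<^sup>2)" by simp
  also have "(LINT x|Q. (I x)\<^sup>2) = expectation (\<lambda>\<omega>. (I (X \<omega>))\<^sup>2)"
    unfolding Q' using X Im by (intro integral_distr) (auto simp: Q')
  also have "\<dots> = (\<rho>1\<^sup>2 + \<rho>2\<^sup>2) * (LINT t:{0..?T}|lborel. (g t)\<^sup>2)"
  proof (rule second_moment_parts_integral[where u=u and g=g and g'=g'])
    show "AE \<omega> in M. cadlag_on {0..?T} (\<lambda>t. u t \<omega>)"
      using noise(2) by eventually_elim (rule cadlag_on_subset, auto)
    show "(\<lambda>\<omega>. I (X \<omega>)) \<in> borel_measurable M"
      using measurable_compose[OF X, of I borel] Im by (simp add: Q')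
    show "AE \<omega> in M. I (X \<omega>) = parts_integral ?T g g' (\<lambda>t. u t \<omega>)"
      using \<xi>(4) \<xi>(5) AE_space
    proof eventually_elim
      case (elim \<omega>)
      have "I (X \<omega>) = parts_integral ?T (Tr j) f' (\<lambda>t. \<xi> t \<omega>)"
        unfolding I_def parts_integral_def X_def
        by (intro arg_cong2[where f="(-)"] set_lebesgue_integral_cong) auto
      also have "\<dots> = parts_integral ?T g g' (\<lambda>t. u t \<omega>)"
        using elim cad[OF elim(3)]
        by (intro parts_integral_of_linear_equation[where a=a and f="Tr j" and f'=f'] g ode gn) (auto simp: u_def)
      finally show ?case .
    qed
  qed (use noise g in auto)
  finally show ?thesis by simp
qed

theorem proposition7p9:
  fixes amax \<rho>low \<sigma>max :: "nat \<Rightarrow> real"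
    and n :: nat
    and Q :: "(real \<Rightarrow> real) measure"
    and a \<rho>1 \<rho>2 \<sigma>Q :: real
  assumes "admissible_bounds amax \<rho>low \<sigma>max"
    and "n \<ge> 1"
    and "(Q, a, \<rho>1, \<rho>2) \<in> OU_family TYPE('w) amax \<rho>low \<sigma>max n"
    and "\<sigma>Q = \<rho>1\<^sup>2 + \<rho>2\<^sup>2"
  shows "L1 n Q \<sigma>Q \<le> 2 * \<sigma>Q * (4 * a\<^sup>2 + 15 * \<bar>a\<bar> + 2)"
proof -
  obtain M :: "'w measure" and F w \<mu> \<Lambda> z \<xi> where a: "a \<le> 0"
    and OU: "OU_levy_process M F w \<mu> \<Lambda> z a \<rho>1 \<rho>2 \<xi>"
    and Q: "Q = distr M (skorokhod_space n) (\<lambda>\<omega>. restrict (\<lambda>t. \<xi> t \<omega>) {0..real n})"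
    using assms(3) unfolding OU_family_def by blast
  have \<sigma>: "0 \<le> \<sigma>Q" by (simp add: assms(4))
  define b where "b = - a"
  have b: "0 \<le> b" using a by (simp add: b_def)
  define C where "C = b\<^sup>2 + 5 * b"
  have C: "0 \<le> C" using b by (simp add: C_def)
  have coeff: "\<bar>(LINT x|Q. (fourier_noise n Q j x)\<^sup>2) - \<sigma>Q\<bar> \<le> \<sigma>Q * (if j = 1 then 1 else C / (real j)\<^sup>2)"
    if j: "1 \<le> j" for j
  proof -
    obtain f' g g' where f: "\<And>t. (Tr j has_real_derivative f' t) (at t)" "continuous_on UNIV f'"
      and g: "\<And>t. (g has_real_derivative g' t) (at t)" "continuous_on UNIV g'"
      and ode: "\<And>t. g' t = f' t + b * g t" and gn: "g (real n) = Tr j (real n)"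
      and bound: "\<bar>(LINT s:{0..real n}|lborel. (g s)\<^sup>2) / real n - 1\<bar> \<le> (if j = 1 then 1 else (b\<^sup>2 + 5 * b) / (real j)\<^sup>2)"
      by (rule response_Tr[OF b assms(2) j]) blast
    have ode': "g' t = f' t - a * g t" for t using ode by (simp add: b_def)
    have "(LINT x|Q. (fourier_noise n Q j x)\<^sup>2) - \<sigma>Q = \<sigma>Q * ((LINT s:{0..real n}|lborel. (g s)\<^sup>2) / real n - 1)"
      unfolding expectation_fourier_noise_square[OF OU assms(2) Q f g ode' gn] assms(4) by (simp add: algebra_simps)
    also have "\<bar>\<dots>\<bar> \<le> \<sigma>Q * (if j = 1 then 1 else C / (real j)\<^sup>2)"
      unfolding abs_mult abs_of_nonneg[OF \<sigma>] C_def by (rule mult_left_mono[OF bound \<sigma>])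
    finally show ?thesis .
  qed
  have "L1 n Q \<sigma>Q \<le> (\<Sum>j=1..n. \<sigma>Q * (if j = 1 then 1 else C / (real j)\<^sup>2))"
    unfolding L1_def by (intro sum_mono coeff) auto
  also have "\<dots> = \<sigma>Q * (1 + C * (\<Sum>j=2..n. 1 / (real j)\<^sup>2))"
  proof -
    have "{1..n} = insert 1 {2..n}" using assms(2) by auto
    then show ?thesis by (simp add: sum_distrib_left distrib_left)
  qed
  also have "\<dots> \<le> \<sigma>Q * (1 + C * 1)"
    by (intro mult_left_mono add_left_mono sum_inverse_squares_le C \<sigma>)
  also have "\<dots> \<le> \<sigma>Q * (2 * (4 * a\<^sup>2 + 15 * \<bar>a\<bar> + 2))"
  proof (rule mult_left_mono[OF _ \<sigma>])
    show "1 + C * 1 \<le> 2 * (4 * a\<^sup>2 + 15 * \<bar>a\<bar> + 2)"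
    proof -
      have "1 + (s + 5 * - x) * 1 \<le> 2 * (4 * s + 15 * - x + 2)" if "0 \<le> s" "x \<le> 0" for s x :: real
        using that by (simp add: algebra_simps)
      from this[OF zero_le_power2 a] show ?thesis
        unfolding C_def b_def power2_minus abs_of_nonpos[OF a] .
    qed
  qed
  finally show ?thesis by (simp add: mult_ac)
qed

end
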